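(* Let a refined solvable presentation with ordered generators $x_1<x_2<\dots<x_m$, partition $X=X_1\cup\dots\cup X_r$, $X_i=\bigcup_p X_i(p)\cup X_i(\infty)$, and presentation maps $n,\pi,\delta$ be given (as defined in the context), and let $G$ be the group it defines. Then this presentation is a consistent presentation for a polycyclic group if and only if the following criteria hold for all $z$ with $x_2\le z\le x_m$ (the criteria for $z=x_{k+1}$ being equations in the group $H_k$, read recursively as explained in the context): \begin{align*} (1)\quad & \pi(z)^{\delta(z)}=\pi(z) && \text{(if } n(z)<\infty),\\ (2)\quad & \pi(x)^{\delta(z)}=(x^{\delta(z)})^{n(x)} && (x_1\le x<z,\ n(x)<\infty),\\ (3)\quad & x^{\delta(z)^{n(z)}}=x^{\pi(z)} && (x_1\le x<z;\ \text{if } n(z)<\infty),\\ (4)\quad & (x^{y})^{\delta(z)}=(x^{\delta(z)})^{(y^{\delta(z)})} && (x_1\le x<y<z), \end{align*} and, for all $1\le s<r(z)$ and all primes $p$, $$(5)\quad \det\big(\delta(z)_{(s,p)}\big)\not\equiv 0 \pmod p,\qquad \det\big(\delta(z)_{(s,\infty)}\big)=\pm1 .$$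
   Context: Notation: $a^b=b^{-1}ab$ for group elements $a,b$; maps are written as exponents, so $g^{\phi}$ is the image of $g$ under $\phi$, and $g^{\phi^e}$ is the image under the $e$-fold iterate of $\phi$. Refined solvable presentation. Data: a finite alphabet $X=\{x_1,\dots,x_m\}$ ordered by $x_1<\dots<x_m$; a partition of $X$ into disjoint non-empty subsets $X_1,\dots,X_r$ such that the elements of $X_i$ precede those of $X_j$ whenever $i<j$; for each $i$ a further partition $X_i=\big(\bigcup_{p\text{ prime}}X_i(p)\big)\cup X_i(\infty)$ into disjoint (possibly empty) subsets. For $z\in X$, $r(z)$ is the index with $z\in X_{r(z)}$. Let $F$ be the free group on $X$. The presentation maps are: (i) $n:X\to\mathbb N\cup\{\infty\}$ with $n(x)=\infty$ if $x\in X_i(\infty)$, and $n(x)=p^e$ for some $e\ge1$ if $x\in X_i(p)$. Put $\mathbb Z_x=\mathbb Z$ if $n(x)=\infty$, and $\mathbb Z_x=\{0,1,\dots,n(x)-1\}$ otherwise. (ii) $\pi:\{x\in X: n(x)<\infty\}\to F$, where for $x\in X_s(p)$ one has $\pi(x)=x_m^{\alpha_x(m)}\cdots x_1^{\alpha_x(1)}$ with $\alpha_x(i)\in\mathbb Z_{x_i}$ and $\alpha_x(i)=0$ whenever $x_i\notin X_1\cup\dots\cup X_{s-1}$. (iii) $\delta:\{(x,y)\in X\times X:x<y\}\to F$, $\delta(x,y)=x_m^{\beta_{(x,y)}(m)}\cdots x_1^{\beta_{(x,y)}(1)}$ with $\beta_{(x,y)}(i)\in\mathbb Z_{x_i}$,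 such that: - if $x,y\in X_s$, then $\beta_{(x,y)}(i)=0$ for $x_i\notin X_1\cup\dots\cup X_{s-1}\cup\{x\}$ and $\beta_{(x,y)}(i)=1$ for $x_i=x$; - if $x\in X_s(p)$, $y\in X_t$ with $s<t$, then $\beta_{(x,y)}(i)=0$ for $x_i\notin X_1\cup\dots\cup X_{s-1}\cup X_s(p)$; - if $x\in X_s(\infty)$, $y\in X_t$ with $s<t$, then $\beta_{(x,y)}(i)=0$ for $x_i\notin X_1\cup\dots\cup X_s$. The associated refined solvable presentation has generators $x_1,\dots,x_m$, power relations $x^{n(x)}=\pi(x)$ for all $x\in X$ with $n(x)<\infty$, and conjugacy relations $x^y=\delta(x,y)$ for all $x<y$ in $X$. Consistency. The presentation is a consistent presentation for a polycyclic group if the group $G$ it defines is polycyclic and every $g\in G$ has a unique expression (normal form) $g=x_m^{r_m}\cdots x_1^{r_1}$ with $r_i\in\mathbb Z_{x_i}$. Sub-presentations. For $0\le k\le m$, $H_k$ is the group defined by the sub-presentation with generators $x_1,\dots,x_k$ and those of the power relations $x^{n(x)}=\pi(x)$ and conjugacy relations $x^y=\delta(x,y)$ that involve only $x_1,\dots,x_k$ (i.e. the power relations for $x\le x_k$ with $n(x)<\infty$, and the conjugacy relations for $x<y\le x_k$). Consistency of this sub-presentation is defined in the same way, with normal forms $x_k^{r_k}\cdots x_1^{r_1}$. The maps $\delta(z)$. Let $z=x_{k+1}$ and suppose that the sub-presentation for $H_k$ is a consistent presentation for a polycyclic group. Define $\delta(z):H_k\to H_k$ by $x_i^{\delta(z)}=\delta(x_i,z)$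 for $1\le i\le k$ and, on normal forms, $(x_k^{r_k}\cdots x_1^{r_1})^{\delta(z)}=(x_k^{\delta(z)})^{r_k}\cdots(x_1^{\delta(z)})^{r_1}$. In criteria (1)–(4), all of $\pi(z),\pi(x),x^y$ etc. are regarded as elements of $H_k$. For $1\le s<r(z)$ and $p$ prime, $\delta(z)_{(s,p)}$ denotes the map induced by $\delta(z)$ on $\langle X_1\cup\dots\cup X_{s-1}\cup X_s(p)\rangle/\langle X_1\cup\dots\cup X_{s-1}\rangle$, and $\delta(z)_{(s,\infty)}$ the map induced on $\langle X_1\cup\dots\cup X_s\rangle/\langle X_1\cup\dots\cup X_{s-1}\cup\bigcup_pX_s(p)\rangle$. Their determinants are those of the integer matrices with respect to the generators in $X_s(p)$, respectively $X_s(\infty)$, i.e. of the matrices $(\beta_{(x,z)}(i))$ with $x$ and $x_i$ ranging over $X_s(p)$, respectively $X_s(\infty)$ (the determinant of an empty matrix being $1$). Recursive reading of the criteria. The criteria are checked for $z=x_2,\dots,x_m$ in ascending order; when checking $z=x_{k+1}$, consistency of the sub-presentation for $H_k$ may be assumed. Thus "the criteria hold for all $z$" means: for every $k\in\{1,\dots,m-1\}$ for which the sub-presentation for $H_k$ is a consistent presentation for a polycyclic group, criteria (1)–(5) hold for $z=x_{k+1}$ in $H_k$. *)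

theory Defs
  imports
    "HOL-Algebra.Elementary_Groups"
    "HOL-Algebra.Coset"
    "HOL-Library.Extended_Nat"
    "HOL-Library.FuncSet"
    "HOL-Library.Disjoint_Sets"
    "HOL-Number_Theory.Cong"
    "HOL-Computational_Algebra.Primes"
    "Jordan_Normal_Form.Determinant"
begin

section \<open>Groups given by generators and relations\<close>

text \<open>
  The letter \<open>(x, True)\<close> stands for the generator \<open>x\<close> and \<open>(x, False)\<close> for its inverse. Words
  need not be reduced: they represent the elements of the free group.
\<close>

type_synonym 'a word = "('a \<times> bool) list"

definition words :: "'a set \<Rightarrow> 'a word set" where
  "words S = lists (S \<times> UNIV)"

text \<open>
  The congruence generated by free cancellation and by the relations \<open>u = v\<close>, for \<open>(u, v) \<in> R\<close>.
\<close>

inductive word_eq :: "'a set \<Rightarrow> ('a word \<times> 'a word) set \<Rightarrow> 'a word \<Rightarrow> 'a word \<Rightarrow> bool"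
  for S :: "'a set" and R :: "('a word \<times> 'a word) set"
where
  refl: "w \<in> words S \<Longrightarrow> word_eq S R w w"
| sym: "word_eq S R u v \<Longrightarrow> word_eq S R v u"
| trans: "word_eq S R u v \<Longrightarrow> word_eq S R v w \<Longrightarrow> word_eq S R u w"
| append: "word_eq S R u u' \<Longrightarrow> word_eq S R v v' \<Longrightarrow> word_eq S R (u @ v) (u' @ v')"
| cancel: "x \<in> S \<Longrightarrow> word_eq S R [(x, b), (x, \<not> b)] []"
| relation: "(u, v) \<in> R \<Longrightarrow> u \<in> words S \<Longrightarrow> v \<in> words S \<Longrightarrow> word_eq S R u v"

definition word_class :: "'a set \<Rightarrow> ('a word \<times> 'a word) set \<Rightarrow> 'a word \<Rightarrow> 'a word set" where
  "word_class S R w = {v. word_eq S R w v}"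

definition presented_group :: "'a set \<Rightarrow> ('a word \<times> 'a word) set \<Rightarrow> 'a word set monoid" where
  "presented_group S R =
     \<lparr>carrier = word_class S R ` words S,
      monoid.mult = (\<lambda>A B. {w. \<exists>u\<in>A. \<exists>v\<in>B. word_eq S R (u @ v) w}),
      monoid.one = word_class S R []\<rparr>"


section \<open>Polycyclic groups\<close>

definition polycyclic :: "('a, 'b) monoid_scheme \<Rightarrow> bool" where
  "polycyclic G \<longleftrightarrow> group G \<and>
     (\<exists>l C. C 0 = {\<one>\<^bsub>G\<^esub>} \<and> C l = carrier G \<and>
        (\<forall>i\<le>l. subgroup (C i) G) \<and>
        (\<forall>i<l. C i \<lhd> G\<lparr>carrier := C (Suc i)\<rparr> \<and>
               cyclic_group (G\<lparr>carrier := C (Suc i)\<rparr> Mod C i)))"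

definition conj_by :: "('a, 'b) monoid_scheme \<Rightarrow> 'a \<Rightarrow> 'a \<Rightarrow> 'a" where
  "conj_by G a b = inv\<^bsub>G\<^esub> b \<otimes>\<^bsub>G\<^esub> a \<otimes>\<^bsub>G\<^esub> b"

text \<open>The product \<open>g\<^sub>k\<^bsup>e\<^sub>k\<^esup> \<cdots> g\<^sub>1\<^bsup>e\<^sub>1\<^esup>\<close>, with descending indices.\<close>

primrec descending_prod ::
  "('a, 'b) monoid_scheme \<Rightarrow> (nat \<Rightarrow> 'a) \<Rightarrow> (nat \<Rightarrow> int) \<Rightarrow> nat \<Rightarrow> 'a"
where
  "descending_prod G g e 0 = \<one>\<^bsub>G\<^esub>"
| "descending_prod G g e (Suc k) =
     g (Suc k) [^]\<^bsub>G\<^esub> e (Suc k) \<otimes>\<^bsub>G\<^esub> descending_prod G g e k"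


section \<open>Refined solvable presentations\<close>

text \<open>
  The alphabet is \<open>{1..m}\<close> with its usual order: the number \<open>i\<close> is the generator \<open>x\<^sub>i\<close>. The sets
  \<open>X\<^sub>s\<close>, \<open>X\<^sub>s(p)\<close> and \<open>X\<^sub>s(\<infinity>)\<close> are \<open>layer s\<close>, \<open>torsion_part s p\<close> and \<open>free_part s\<close>, and
  \<open>n(x)\<close> is \<open>exponent x\<close>. The maps \<open>\<pi>\<close> and \<open>\<delta>\<close> are given by their exponents:
  \<open>\<alpha>\<^sub>x(i)\<close> is \<open>power_exp x i\<close> and \<open>\<beta>\<^bsub>(x,y)\<^esub>(i)\<close> is \<open>conj_exp x y i\<close>.
\<close>

record presentation_data =
  num_gens :: nat
  num_layers :: nat
  layer :: "nat \<Rightarrow> nat set"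
  torsion_part :: "nat \<Rightarrow> nat \<Rightarrow> nat set"
  free_part :: "nat \<Rightarrow> nat set"
  exponent :: "nat \<Rightarrow> enat"
  power_exp :: "nat \<Rightarrow> nat \<Rightarrow> int"
  conj_exp :: "nat \<Rightarrow> nat \<Rightarrow> nat \<Rightarrow> int"

definition exp_range :: "presentation_data \<Rightarrow> nat \<Rightarrow> int set" where
  "exp_range D x = (case exponent D x of enat q \<Rightarrow> {0..<int q} | \<infinity> \<Rightarrow> UNIV)"

text \<open>\<open>lower_layers D s\<close> is \<open>X\<^sub>1 \<union> \<dots> \<union> X\<^bsub>s-1\<^esub>\<close>.\<close>

definition lower_layers :: "presentation_data \<Rightarrow> nat \<Rightarrow> nat set" where
  "lower_layers D s = (\<Union>t\<in>{1..<s}. layer D t)"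

definition valid_partition :: "presentation_data \<Rightarrow> bool" where
  "valid_partition D \<longleftrightarrow>
     (\<Union>s\<in>{1..num_layers D}. layer D s) = {1..num_gens D} \<and>
     disjoint_family_on (layer D) {1..num_layers D} \<and>
     (\<forall>s\<in>{1..num_layers D}. layer D s \<noteq> {}) \<and>
     (\<forall>s\<in>{1..num_layers D}. \<forall>t\<in>{1..num_layers D}. s < t \<longrightarrow>
        (\<forall>x\<in>layer D s. \<forall>y\<in>layer D t. x < y)) \<and>
     (\<forall>s\<in>{1..num_layers D}.
        layer D s = (\<Union>p\<in>{p. prime p}. torsion_part D s p) \<union> free_part D s \<and>
        disjoint_family_on (torsion_part D s) {p. prime p} \<and>
        (\<forall>p. prime p \<longrightarrow> torsion_part D s p \<inter> free_part D s = {}))"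

definition valid_exponents :: "presentation_data \<Rightarrow> bool" where
  "valid_exponents D \<longleftrightarrow>
     (\<forall>s\<in>{1..num_layers D}.
        (\<forall>x\<in>free_part D s. exponent D x = \<infinity>) \<and>
        (\<forall>p. prime p \<longrightarrow>
           (\<forall>x\<in>torsion_part D s p. \<exists>e\<ge>1. exponent D x = enat (p ^ e))))"

definition valid_powers :: "presentation_data \<Rightarrow> bool" where
  "valid_powers D \<longleftrightarrow>
     (\<forall>s\<in>{1..num_layers D}. \<forall>p. prime p \<longrightarrow> (\<forall>x\<in>torsion_part D s p. \<forall>i\<in>{1..num_gens D}.
        power_exp D x i \<in> exp_range D i \<and>
        (i \<notin> lower_layers D s \<longrightarrow> power_exp D x i = 0)))"

definition valid_conjugates :: "presentation_data \<Rightarrow> bool" where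
  "valid_conjugates D \<longleftrightarrow>
     (\<forall>x\<in>{1..num_gens D}. \<forall>y\<in>{1..num_gens D}. x < y \<longrightarrow>
        (\<forall>i\<in>{1..num_gens D}. conj_exp D x y i \<in> exp_range D i)) \<and>
     (\<forall>s\<in>{1..num_layers D}. \<forall>x\<in>layer D s. \<forall>y\<in>layer D s. x < y \<longrightarrow>
        (\<forall>i\<in>{1..num_gens D}. i \<notin> lower_layers D s \<union> {x} \<longrightarrow> conj_exp D x y i = 0) \<and>
        conj_exp D x y x = 1) \<and>
     (\<forall>s\<in>{1..num_layers D}. \<forall>t\<in>{1..num_layers D}. s < t \<longrightarrow>
        (\<forall>p. prime p \<longrightarrow> (\<forall>x\<in>torsion_part D s p. \<forall>y\<in>layer D t. \<forall>i\<in>{1..num_gens D}.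
           i \<notin> lower_layers D s \<union> torsion_part D s p \<longrightarrow> conj_exp D x y i = 0)) \<and>
        (\<forall>x\<in>free_part D s. \<forall>y\<in>layer D t. \<forall>i\<in>{1..num_gens D}.
           i \<notin> lower_layers D s \<union> layer D s \<longrightarrow> conj_exp D x y i = 0))"

definition refined_solvable_presentation :: "presentation_data \<Rightarrow> bool" where
  "refined_solvable_presentation D \<longleftrightarrow>
     valid_partition D \<and> valid_exponents D \<and> valid_powers D \<and> valid_conjugates D"

definition word_power :: "nat \<Rightarrow> int \<Rightarrow> nat word" where
  "word_power x e = replicate (nat \<bar>e\<bar>) (x, 0 \<le> e)"

text \<open>The word \<open>x\<^sub>m\<^bsup>e\<^sub>m\<^esup> \<cdots> x\<^sub>1\<^bsup>e\<^sub>1\<^esup>\<close>.\<close>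

definition normal_word :: "nat \<Rightarrow> (nat \<Rightarrow> int) \<Rightarrow> nat word" where
  "normal_word m e = concat (map (\<lambda>i. word_power i (e i)) (rev [1..<Suc m]))"

definition power_word :: "presentation_data \<Rightarrow> nat \<Rightarrow> nat word" where
  "power_word D x = normal_word (num_gens D) (power_exp D x)"

definition conj_word :: "presentation_data \<Rightarrow> nat \<Rightarrow> nat \<Rightarrow> nat word" where
  "conj_word D x y = normal_word (num_gens D) (conj_exp D x y)"

definition sub_relations :: "presentation_data \<Rightarrow> nat \<Rightarrow> (nat word \<times> nat word) set" where
  "sub_relations D k =
     {(replicate (the_enat (exponent D x)) (x, True), power_word D x) | x.
        x \<in> {1..k} \<and> exponent D x < \<infinity>} \<union>
     {([(y, False), (x, True), (y, True)], conj_word D x y) | x y.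
        x \<in> {1..k} \<and> y \<in> {1..k} \<and> x < y}"

text \<open>
  The group \<open>H\<^sub>k\<close> of the sub-presentation on \<open>x\<^sub>1, \<dots>, x\<^sub>k\<close>; for \<open>k = m\<close> this is the group \<open>G\<close> of
  the whole presentation. The words \<open>\<pi>(x)\<close> and \<open>\<delta>(x, y)\<close> run over all of \<open>x\<^sub>m, \<dots>, x\<^sub>1\<close>, but for
  \<open>x, y \<le> x\<^sub>k\<close> the conditions on the exponents make them words in \<open>x\<^sub>1, \<dots>, x\<^sub>k\<close>.
\<close>

definition sub_group :: "presentation_data \<Rightarrow> nat \<Rightarrow> nat word set monoid" where
  "sub_group D k = presented_group {1..k} (sub_relations D k)"

definition sub_elem :: "presentation_data \<Rightarrow> nat \<Rightarrow> nat word \<Rightarrow> nat word set" where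
  "sub_elem D k w = word_class {1..k} (sub_relations D k) w"

definition gen :: "presentation_data \<Rightarrow> nat \<Rightarrow> nat \<Rightarrow> nat word set" where
  "gen D k x = sub_elem D k [(x, True)]"

text \<open>
  Exponent vectors are functions on \<open>{1..k}\<close>, extended by \<open>undefined\<close>, so that uniqueness of the
  normal form is uniqueness of \<open>r\<^sub>1, \<dots>, r\<^sub>k\<close>.
\<close>

definition is_normal_form :: "presentation_data \<Rightarrow> nat \<Rightarrow> nat word set \<Rightarrow> (nat \<Rightarrow> int) \<Rightarrow> bool" where
  "is_normal_form D k g r \<longleftrightarrow>
     r \<in> (\<Pi>\<^sub>E i\<in>{1..k}. exp_range D i) \<and> g = descending_prod (sub_group D k) (gen D k) r k"

definition consistent :: "presentation_data \<Rightarrow> nat \<Rightarrow> bool" where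
  "consistent D k \<longleftrightarrow>
     polycyclic (sub_group D k) \<and>
     (\<forall>g\<in>carrier (sub_group D k). \<exists>!r. is_normal_form D k g r)"


section \<open>The consistency criteria\<close>

text \<open>
  \<open>delta_map D k\<close> is \<open>\<delta>(z) : H\<^sub>k \<rightarrow> H\<^sub>k\<close> for \<open>z = x\<^bsub>k+1\<^esub>\<close>. It is meaningful on \<open>H\<^sub>k\<close> when
  \<open>consistent D k\<close> holds; the normal form of \<open>x\<^sub>i\<close> then has the single exponent \<open>1\<close>, so \<open>x\<^sub>i\<close> is
  mapped to \<open>\<delta>(x\<^sub>i, z)\<close>. The criteria below are those for \<open>z = x\<^bsub>k+1\<^esub>\<close>, in the group \<open>H\<^sub>k\<close>.
\<close>

definition delta_map :: "presentation_data \<Rightarrow> nat \<Rightarrow> nat word set \<Rightarrow> nat word set" where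
  "delta_map D k g =
     descending_prod (sub_group D k) (\<lambda>i. sub_elem D k (conj_word D i (Suc k)))
       (THE r. is_normal_form D k g r) k"

definition layer_index :: "presentation_data \<Rightarrow> nat \<Rightarrow> nat" where
  "layer_index D x = (THE s. s \<in> {1..num_layers D} \<and> x \<in> layer D s)"

text \<open>
  The determinant of the matrix \<open>(\<beta>\<^bsub>(x,z)\<^esub>(i))\<close> with \<open>x\<close> and \<open>x\<^sub>i\<close> ranging over \<open>S\<close> in ascending
  order.
\<close>

definition section_det :: "presentation_data \<Rightarrow> nat \<Rightarrow> nat set \<Rightarrow> int" where
  "section_det D z S =
     det (mat (card S) (card S)
       (\<lambda>(a, b). conj_exp D (sorted_list_of_set S ! a) z (sorted_list_of_set S ! b)))"

definition criterion1 :: "presentation_data \<Rightarrow> nat \<Rightarrow> bool" where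
  "criterion1 D k \<longleftrightarrow>
     (exponent D (Suc k) < \<infinity> \<longrightarrow>
        delta_map D k (sub_elem D k (power_word D (Suc k))) = sub_elem D k (power_word D (Suc k)))"

definition criterion2 :: "presentation_data \<Rightarrow> nat \<Rightarrow> bool" where
  "criterion2 D k \<longleftrightarrow>
     (\<forall>x\<in>{1..k}. exponent D x < \<infinity> \<longrightarrow>
        delta_map D k (sub_elem D k (power_word D x)) =
        delta_map D k (gen D k x) [^]\<^bsub>sub_group D k\<^esub> the_enat (exponent D x))"

definition criterion3 :: "presentation_data \<Rightarrow> nat \<Rightarrow> bool" where
  "criterion3 D k \<longleftrightarrow>
     (exponent D (Suc k) < \<infinity> \<longrightarrow>
        (\<forall>x\<in>{1..k}.
           (delta_map D k ^^ the_enat (exponent D (Suc k))) (gen D k x) =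
           conj_by (sub_group D k) (gen D k x) (sub_elem D k (power_word D (Suc k)))))"

definition criterion4 :: "presentation_data \<Rightarrow> nat \<Rightarrow> bool" where
  "criterion4 D k \<longleftrightarrow>
     (\<forall>x\<in>{1..k}. \<forall>y\<in>{1..k}. x < y \<longrightarrow>
        delta_map D k (conj_by (sub_group D k) (gen D k x) (gen D k y)) =
        conj_by (sub_group D k) (delta_map D k (gen D k x)) (delta_map D k (gen D k y)))"

definition criterion5 :: "presentation_data \<Rightarrow> nat \<Rightarrow> bool" where
  "criterion5 D k \<longleftrightarrow>
     (\<forall>s\<in>{1..<layer_index D (Suc k)}.
        (\<forall>p. prime p \<longrightarrow>
           \<not> [section_det D (Suc k) (torsion_part D s p) = 0] (mod int p)) \<and>
        section_det D (Suc k) (free_part D s) \<in> {1, -1})"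

end

theory Submission
  imports Defs "HOL-Algebra.Bij"
begin

text \<open>
  Polycyclic groups satisfy the maximal condition on subgroups. It has two consequences that carry
  both directions: an element \<open>z\<close> with \<open>U\<^sup>z \<subseteq> U\<close> normalizes the subgroup \<open>U\<close>, and a surjective
  endomorphism is injective.

  If \<open>G\<close> is consistent, then \<open>H\<^sub>k\<close> embeds into \<open>G\<close> by uniqueness of normal forms, and \<open>\<delta>(z)\<close> is the
  restriction of conjugation by \<open>z\<close>; this gives (1)--(4). Conjugation by \<open>z\<close> is onto on each term of
  the layer filtration, so the matrices in (5) have a left inverse over \<open>\<int>/p\<close> or \<open>\<int>\<close>.

  Conversely, (2) and (4) make \<open>\<delta>(z)\<close> an endomorphism of \<open>H\<^sub>k\<close> by von Dyck's theorem, (5) makes it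
  surjective layer by layer, hence an automorphism. By (1) and (3) there is then a cyclic extension
  of \<open>H\<^sub>k\<close> by an element acting as \<open>\<delta>(z)\<close>, and mapping \<open>H\<^bsub>k+1\<^esub>\<close> to it shows that normal forms in
  \<open>H\<^bsub>k+1\<^esub>\<close> are unique.
\<close>

section \<open>Words and presented groups\<close>

text \<open>The obstacle is that consistency of \<open>G\<close> does not pass to \<open>H k\<close>
  by itself. The relations describe conjugation by z but not by its inverse, so even the existence
  of normal forms in \<open>H k\<close> hinges on maps \<delta>(y) of earlier letters y being onto,
  that is, on (5); and the embedding of \<open>H k\<close> into \<open>G\<close> uses normal forms
  in \<open>H k\<close>. The two directions are therefore interleaved: the subpresentations of a
  consistent presentation are shown to be consistent one letter at a time, by extracting the
  criteria for the next letter from \<open>G\<close> and feeding them to the sufficiency step.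

  Exponent sums yield (5) because the exponent sum of a letter x is an invariant modulo n(x), but
  only in the group whose last letter ends the layer of x: conjugation by later layers changes it.
  Identities found in \<open>G\<close> must first be pulled back to that group. In the other
  direction a determinant prime to p suffices for X_s(p), since the n(x)-th power of each generator
  there already falls into the lower layers.\<close>

definition inverse_word :: "'a word \<Rightarrow> 'a word" where
  "inverse_word w = rev (map (\<lambda>(x, b). (x, \<not> b)) w)"

primrec word_eval :: "('b, 'c) monoid_scheme \<Rightarrow> ('a \<Rightarrow> 'b) \<Rightarrow> 'a word \<Rightarrow> 'b" where
  "word_eval G f [] = \<one>\<^bsub>G\<^esub>"
| "word_eval G f (l # w) =
     (if snd l then f (fst l) else inv\<^bsub>G\<^esub> f (fst l)) \<otimes>\<^bsub>G\<^esub> word_eval G f w"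

lemma words_Nil [simp]: "[] \<in> words S"
  by (simp add: words_def)

lemma words_Cons [simp]: "l # w \<in> words S \<longleftrightarrow> fst l \<in> S \<and> w \<in> words S"
  by (cases l) (auto simp: words_def)

lemma words_append [simp]: "u @ v \<in> words S \<longleftrightarrow> u \<in> words S \<and> v \<in> words S"
  by (auto simp: words_def)

lemma words_replicate: "x \<in> S \<Longrightarrow> replicate n (x, b) \<in> words S"
  by (induction n) auto

lemma words_mono: "S \<subseteq> T \<Longrightarrow> words S \<subseteq> words T"
  unfolding words_def by (rule lists_mono) auto

lemma inverse_word_Nil [simp]: "inverse_word [] = []"
  by (simp add: inverse_word_def)

lemma inverse_word_Cons: "inverse_word (l # w) = inverse_word w @ [(fst l, \<not> snd l)]"
  by (cases l) (simp add: inverse_word_def)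

lemma inverse_word_words [simp]: "inverse_word w \<in> words S \<longleftrightarrow> w \<in> words S"
  by (induction w) (auto simp: inverse_word_Cons)

lemma words_word_power: "x \<in> S \<Longrightarrow> word_power x e \<in> words S"
  by (simp add: word_power_def words_replicate)

lemma normal_word_0 [simp]: "normal_word 0 e = []"
  by (simp add: normal_word_def)

lemma normal_word_Suc: "normal_word (Suc k) e = word_power (Suc k) (e (Suc k)) @ normal_word k e"
  by (simp add: normal_word_def)

lemma normal_word_words:
  assumes "\<And>i. i \<in> {1..k} \<Longrightarrow> e i \<noteq> 0 \<Longrightarrow> i \<in> S"
  shows "normal_word k e \<in> words S"
  using assms
proof (induction k)
  case (Suc k)
  then show ?case
    by (cases "e (Suc k) = 0") (auto simp: normal_word_Suc words_word_power, simp add: word_power_def)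
qed simp

lemma normal_word_restrict:
  "\<lbrakk>k \<le> m; \<And>i. k < i \<Longrightarrow> i \<le> m \<Longrightarrow> e i = 0\<rbrakk> \<Longrightarrow> normal_word m e = normal_word k e"
proof (induction m)
  case (Suc m)
  then show ?case
    by (cases "k = Suc m") (auto simp: normal_word_Suc word_power_def)
qed simp

lemma word_eval_cong:
  "w \<in> words S \<Longrightarrow> (\<And>x. x \<in> S \<Longrightarrow> f x = g x) \<Longrightarrow> word_eval G f w = word_eval G g w"
  by (induction w) auto

lemma descending_prod_cong:
  "(\<And>i. i \<in> {1..k} \<Longrightarrow> g i = h i) \<Longrightarrow> (\<And>i. i \<in> {1..k} \<Longrightarrow> d i = e i) \<Longrightarrow>
    descending_prod G g d k = descending_prod G h e k"
  by (induction k) auto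

context group
begin

lemma word_eval_closed [simp]:
  "f \<in> S \<rightarrow> carrier G \<Longrightarrow> w \<in> words S \<Longrightarrow> word_eval G f w \<in> carrier G"
  by (induction w) auto

lemma word_eval_append:
  "f \<in> S \<rightarrow> carrier G \<Longrightarrow> u \<in> words S \<Longrightarrow> v \<in> words S \<Longrightarrow>
    word_eval G f (u @ v) = word_eval G f u \<otimes> word_eval G f v"
  by (induction u) (auto simp: Pi_iff m_assoc)

lemma word_eval_inverse:
  "f \<in> S \<rightarrow> carrier G \<Longrightarrow> w \<in> words S \<Longrightarrow> word_eval G f (inverse_word w) = inv (word_eval G f w)"
proof (induction w)
  case (Cons l w)
  then have "f (fst l) \<in> carrier G"
    by auto
  with Cons show ?case
    by (auto simp: inverse_word_Cons word_eval_append inv_mult_group)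
qed simp

lemma word_eval_replicate:
  "f x \<in> carrier G \<Longrightarrow> word_eval G f (replicate n (x, b)) = (if b then f x else inv f x) [^] n"
proof (induction n)
  case (Suc n)
  have "y \<otimes> y [^] n = y [^] Suc n" if "y \<in> carrier G" for y
    using that by (metis nat_pow_Suc2)
  with Suc show ?case
    by (cases b) (simp_all del: nat_pow_Suc)
qed simp

lemma word_eval_word_power:
  "f x \<in> carrier G \<Longrightarrow> word_eval G f (word_power x e) = f x [^] e"
  using int_pow_def2[of G "f x" e]
  by (cases "0 \<le> e") (simp_all add: word_power_def word_eval_replicate int_pow_inv)

lemma descending_prod_closed [simp]:
  "g \<in> {1..k} \<rightarrow> carrier G \<Longrightarrow> descending_prod G g e k \<in> carrier G"
  by (induction k) (auto simp: Pi_iff)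

lemma word_eval_normal_word:
  "f \<in> {1..k} \<rightarrow> carrier G \<Longrightarrow> word_eval G f (normal_word k e) = descending_prod G f e k"
proof (induction k)
  case (Suc k)
  then have f: "f \<in> {1..k} \<rightarrow> carrier G" "f (Suc k) \<in> carrier G"
    by auto
  have "word_eval G f (normal_word (Suc k) e)
      = word_eval G f (word_power (Suc k) (e (Suc k))) \<otimes> word_eval G f (normal_word k e)"
    unfolding normal_word_Suc
    by (rule word_eval_append[OF Suc.prems]) (auto intro!: words_word_power normal_word_words)
  with f Suc.IH show ?case
    by (simp add: word_eval_word_power)
qed simp

lemma descending_prod_hom:
  assumes "h \<in> hom G K" "group K"
  shows "g \<in> {1..k} \<rightarrow> carrier G \<Longrightarrow>
    h (descending_prod G g e k) = descending_prod K (\<lambda>i. h (g i)) e k"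
proof (induction k)
  case 0
  interpret h: group_hom G K h
    using assms by (simp add: group_hom_def group_hom_axioms_def)
  show ?case
    by simp
next
  case (Suc k)
  interpret h: group_hom G K h
    using assms by (simp add: group_hom_def group_hom_axioms_def)
  from Suc have g: "g \<in> {1..k} \<rightarrow> carrier G" "g (Suc k) \<in> carrier G"
    by auto
  with Suc.IH show ?case
    by (simp add: h.hom_int_pow)
qed

lemma word_eval_hom:
  assumes "h \<in> hom G K" "group K"
  shows "f \<in> S \<rightarrow> carrier G \<Longrightarrow> w \<in> words S \<Longrightarrow>
    h (word_eval G f w) = word_eval K (\<lambda>x. h (f x)) w"
proof (induction w)
  interpret h: group_hom G K h
    using assms by (simp add: group_hom_def group_hom_axioms_def)
  {
    case Nil
    show ?case
      by simp
  next
    case (Cons l w)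
    then have "f (fst l) \<in> carrier G"
      by auto
    with Cons show ?case
      by simp
  }
qed

lemma descending_prod_extend:
  assumes "k \<le> m" "\<And>i. k < i \<Longrightarrow> i \<le> m \<Longrightarrow> e i = 0" "g \<in> {1..k} \<rightarrow> carrier G"
  shows "descending_prod G g e m = descending_prod G g e k"
  using assms
proof (induction m)
  case (Suc m)
  then show ?case
    by (cases "k = Suc m") (auto simp: le_Suc_eq)
qed simp

lemma descending_prod_single:
  assumes "g \<in> {1..k} \<rightarrow> carrier G" "i \<in> {1..k}"
  shows "descending_prod G g (\<lambda>j. if j = i then a else 0) k = g i [^] a"
proof -
  have zero: "descending_prod G g (\<lambda>j. if j = i then a else 0) j = \<one>" if "j < i" for j
    using that by (induction j) auto
  show ?thesis
    using assms
  proof (induction k)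
    case (Suc k)
    then have gi: "g i \<in> carrier G"
      by auto
    show ?case
    proof (cases "i = Suc k")
      case True
      then show ?thesis
        using gi zero[of k] by simp
    next
      case False
      with Suc have "g \<in> {1..k} \<rightarrow> carrier G" "i \<in> {1..k}"
        by auto
      with False Suc.IH gi show ?thesis
        by simp
    qed
  qed simp
qed

text \<open>Membership is asked only where the exponent is nonzero; in this way the support
  conditions on \<pi> and \<delta> turn into membership in the subgroup generated by lower
  layers.\<close>

lemma descending_prod_in_subgroup:
  assumes "subgroup U G" "\<And>i. i \<in> {1..k} \<Longrightarrow> g i \<in> carrier G"
    and "\<And>i. i \<in> {1..k} \<Longrightarrow> e i \<noteq> 0 \<Longrightarrow> g i \<in> U"
  shows "descending_prod G g e k \<in> U"
  using assms(2,3)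
proof (induction k)
  case 0
  then show ?case
    using assms(1) by (simp add: subgroup.one_closed)
next
  case (Suc k)
  have "g (Suc k) [^] e (Suc k) \<in> U"
    using Suc.prems assms(1) subgroup.one_closed[OF assms(1)] subgroup_int_pow_closed
    by (cases "e (Suc k) = 0") auto
  with Suc show ?case
    using assms(1) by (simp add: subgroup.m_closed)
qed

text \<open>Membership in \<open>words S\<close> is part of the conclusion because the
  \<open>append\<close> case needs it to split the evaluation of a concatenation.\<close>

lemma word_eq_imp_word_eval_eq:
  assumes "word_eq S R u v" "f \<in> S \<rightarrow> carrier G"
    and "\<And>u v. (u, v) \<in> R \<Longrightarrow> u \<in> words S \<Longrightarrow> v \<in> words S \<Longrightarrow> word_eval G f u = word_eval G f v"
  shows "u \<in> words S \<and> v \<in> words S \<and> word_eval G f u = word_eval G f v"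
  using assms(1)
proof (induction rule: word_eq.induct)
  case (append u u' v v')
  then show ?case
    using assms(2) by (simp add: word_eval_append)
next
  case (cancel x b)
  then show ?case
    using assms(2) by (cases b) (auto simp: Pi_iff)
qed (use assms(3) in auto)

end

section \<open>The presented group and von Dyck's theorem\<close>

lemma word_class_eq_iff:
  "u \<in> words S \<Longrightarrow> v \<in> words S \<Longrightarrow> word_class S R u = word_class S R v \<longleftrightarrow> word_eq S R u v"
  unfolding word_class_def by (auto intro: word_eq.intros)

lemma word_eq_inverse:
  "w \<in> words S \<Longrightarrow> word_eq S R (inverse_word w @ w) []"
proof (induction w)
  case Nil
  then show ?case
    by (auto intro: word_eq.refl)
next
  case (Cons l w)
  then have "word_eq S R [(fst l, \<not> snd l), (fst l, \<not> \<not> snd l)] []"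
    by (intro word_eq.cancel) simp
  then have "word_eq S R [(fst l, \<not> snd l), l] []"
    by (cases l) simp
  with Cons have "word_eq S R (inverse_word w @ [(fst l, \<not> snd l), l] @ w) (inverse_word w @ [] @ w)"
    by (intro word_eq.append word_eq.refl) auto
  with Cons show ?case
    by (auto simp: inverse_word_Cons intro: word_eq.trans)
qed

lemma presented_group_mult:
  assumes "u \<in> words S" "v \<in> words S"
  shows "word_class S R u \<otimes>\<^bsub>presented_group S R\<^esub> word_class S R v = word_class S R (u @ v)"
  using assms unfolding presented_group_def word_class_def
  by (auto intro: word_eq.intros)

lemma carrier_presented_group: "carrier (presented_group S R) = word_class S R ` words S"
  by (simp add: presented_group_def)

lemma one_presented_group: "\<one>\<^bsub>presented_group S R\<^esub> = word_class S R []"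
  by (simp add: presented_group_def)

lemma group_presented_group: "group (presented_group S R)"
proof (rule groupI)
  fix x assume "x \<in> carrier (presented_group S R)"
  then obtain w where w: "w \<in> words S" "x = word_class S R w"
    by (auto simp: carrier_presented_group)
  then have "word_class S R (inverse_word w) \<otimes>\<^bsub>presented_group S R\<^esub> x = \<one>\<^bsub>presented_group S R\<^esub>"
    by (simp add: presented_group_mult one_presented_group word_class_eq_iff word_eq_inverse)
  with w show "\<exists>y\<in>carrier (presented_group S R). y \<otimes>\<^bsub>presented_group S R\<^esub> x = \<one>\<^bsub>presented_group S R\<^esub>"
    by (auto simp: carrier_presented_group)
qed (auto simp: carrier_presented_group one_presented_group presented_group_mult)

lemma inv_presented_group:
  assumes "w \<in> words S"
  shows "inv\<^bsub>presented_group S R\<^esub> word_class S R w = word_class S R (inverse_word w)"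
proof -
  interpret group "presented_group S R"
    by (rule group_presented_group)
  show ?thesis
    using assms by (intro inv_equality)
      (auto simp: presented_group_mult carrier_presented_group one_presented_group
        word_class_eq_iff word_eq_inverse)
qed

lemma word_eval_presented_group:
  "w \<in> words S \<Longrightarrow>
    word_eval (presented_group S R) (\<lambda>x. word_class S R [(x, True)]) w = word_class S R w"
proof (induction w)
  case (Cons l w)
  have "inv\<^bsub>presented_group S R\<^esub> word_class S R [(fst l, True)] = word_class S R [(fst l, False)]"
    using Cons.prems by (simp add: inv_presented_group inverse_word_Cons)
  with Cons show ?case
    by (cases l) (auto simp: presented_group_mult)
qed (simp add: one_presented_group)

theorem von_Dyck:
  assumes "group G" "f \<in> S \<rightarrow> carrier G"
    and "\<And>u v. (u, v) \<in> R \<Longrightarrow> u \<in> words S \<Longrightarrow> v \<in> words S \<Longrightarrow> word_eval G f u = word_eval G f v"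
  obtains h where "h \<in> hom (presented_group S R) G"
    and "\<And>w. w \<in> words S \<Longrightarrow> h (word_class S R w) = word_eval G f w"
proof -
  interpret G: group G
    by fact
  \<comment> \<open>A class is evaluated at an arbitrary representative; the choice is immaterial
    because evaluation respects \<open>word_eq\<close>.\<close>
  define h where "h A = word_eval G f (SOME w. w \<in> A)" for A
  have h: "h (word_class S R w) = word_eval G f w" if "w \<in> words S" for w
  proof -
    have "w \<in> word_class S R w"
      using that by (simp add: word_class_def word_eq.refl)
    then have "(SOME v. v \<in> word_class S R w) \<in> word_class S R w"
      by (rule someI)
    then have "word_eq S R w (SOME v. v \<in> word_class S R w)"
      by (simp add: word_class_def)
    from G.word_eq_imp_word_eval_eq[OF this assms(2,3)] show ?thesis
      by (simp add: h_def)
  qed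
  moreover have "h \<in> hom (presented_group S R) G"
    using assms(2)
    by (auto simp: hom_def carrier_presented_group presented_group_mult h G.word_eval_append)
  ultimately show thesis
    using that by blast
qed

section \<open>Polycyclic groups and the maximal condition\<close>

text \<open>The least positive integer d occurring anywhere in the chain lies in some
  \<open>E N\<close>. Division with remainder shows that every later member consists of multiples of
  d, hence adds nothing to \<open>E N\<close>.\<close>

lemma int_subgroup_chain_stabilizes:
  fixes E :: "nat \<Rightarrow> int set"
  assumes zero: "\<And>n. 0 \<in> E n" and diff: "\<And>n a b. a \<in> E n \<Longrightarrow> b \<in> E n \<Longrightarrow> a - b \<in> E n"
    and mono: "\<And>n. E n \<subseteq> E (Suc n)"
  shows "\<exists>N. \<forall>n\<ge>N. E n = E N"
proof (cases "\<exists>n. \<exists>d\<in>E n. d \<noteq> 0")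
  case False
  then have "E n = {0}" for n
    using zero by auto
  then show ?thesis
    by auto
next
  case True
  have neg: "- a \<in> E n" if "a \<in> E n" for a n
    using diff[OF zero that] by simp
  have add: "a + b \<in> E n" if "a \<in> E n" "b \<in> E n" for a b n
    using diff[OF that(1) neg[OF that(2)]] by simp
  have nat_mult: "int k * a \<in> E n" if "a \<in> E n" for a n k
    by (induction k) (use that zero add in \<open>auto simp: algebra_simps\<close>)
  have mult: "k * a \<in> E n" if "a \<in> E n" for a n k
  proof (cases "0 \<le> k")
    case True
    then show ?thesis
      using nat_mult[OF that, of "nat k"] by simp
  next
    case False
    then show ?thesis
      using neg[OF nat_mult[OF that, of "nat (- k)"]] by simp
  qed
  define P where "P d \<longleftrightarrow> 0 < d \<and> (\<exists>n. int d \<in> E n)" for d :: nat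
  obtain n d where "d \<in> E n" "d \<noteq> 0"
    using True by auto
  then have "P (nat \<bar>d\<bar>)"
    using neg[of d n] by (cases "0 \<le> d") (auto simp: P_def)
  then have least: "P (LEAST d. P d)"
    by (rule LeastI)
  define d where "d = (LEAST d. P d)"
  obtain N where N: "int d \<in> E N" and "0 < d"
    using least by (auto simp: P_def d_def)
  have up: "E N \<subseteq> E n" if "N \<le> n" for n
    using mono that by (rule lift_Suc_mono_le)
  have "E n \<subseteq> E N" if "N \<le> n" for n
  proof
    fix e assume e: "e \<in> E n"
    have "e mod int d = e - (e div int d) * int d"
      by (simp add: minus_div_mult_eq_mod)
    then have "e mod int d \<in> E n"
      using diff[OF e mult[of "int d"]] N up[OF that] by auto
    moreover have "0 \<le> e mod int d" "e mod int d < int d"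
      using \<open>0 < d\<close> by auto
    ultimately have "P (nat (e mod int d))" if "e mod int d \<noteq> 0"
      using that by (auto simp: P_def)
    then have "e mod int d = 0"
      using not_less_Least[of "nat (e mod int d)" P] \<open>0 < d\<close> \<open>e mod int d < int d\<close>
        \<open>0 \<le> e mod int d\<close> unfolding d_def[symmetric] by linarith
    then have "e = (e div int d) * int d"
      by (metis add.right_neutral div_mult_mod_eq)
    then show "e \<in> E N"
      using mult[OF N] by metis
  qed
  with up show ?thesis
    by (intro exI[of _ N]) auto
qed

text \<open>All members of a chain are subgroups of the fixed group \<open>G\<close> that lie in
  \<open>K\<close>. The induction along a polycyclic series can then enlarge \<open>K\<close>
  without changing the ambient group.\<close>

definition max_condition_on :: "('a, 'b) monoid_scheme \<Rightarrow> 'a set \<Rightarrow> bool" where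
  "max_condition_on G K \<longleftrightarrow>
     (\<forall>S::nat \<Rightarrow> 'a set. (\<forall>n. subgroup (S n) G \<and> S n \<subseteq> K \<and> S n \<subseteq> S (Suc n)) \<longrightarrow>
        (\<exists>N. \<forall>n\<ge>N. S n = S N))"

lemma max_conditionD:
  fixes S :: "nat \<Rightarrow> 'a set"
  assumes "max_condition_on G K"
    and "\<And>n. subgroup (S n) G" "\<And>n. S n \<subseteq> K" "\<And>n. S n \<subseteq> S (Suc n)"
  shows "\<exists>N. \<forall>n\<ge>N. S n = S N"
  using assms unfolding max_condition_on_def by blast

text \<open>The normalizer of \<open>N\<close>. Both inclusions are demanded because in an infinite
  group conjugation may map a subgroup properly into itself.\<close>

definition normalizing :: "('a, 'b) monoid_scheme \<Rightarrow> 'a set \<Rightarrow> 'a set" where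
  "normalizing G N =
     {g \<in> carrier G. \<forall>x\<in>N. g \<otimes>\<^bsub>G\<^esub> x \<otimes>\<^bsub>G\<^esub> inv\<^bsub>G\<^esub> g \<in> N \<and> inv\<^bsub>G\<^esub> g \<otimes>\<^bsub>G\<^esub> x \<otimes>\<^bsub>G\<^esub> g \<in> N}"

text \<open>\<open>N\<close> is normal in \<open>K\<close> and the coset of \<open>t\<close>
  generates \<open>K/N\<close>, expressed by elements so that no quotient has to be formed. It is
  enough that \<open>t\<close> normalizes \<open>N\<close>, since every element of \<open>K\<close>
  is one of \<open>N\<close> times a power of \<open>t\<close>.\<close>

definition cyclic_extension :: "('a, 'b) monoid_scheme \<Rightarrow> 'a set \<Rightarrow> 'a set \<Rightarrow> 'a \<Rightarrow> bool" where
  "cyclic_extension G N K t \<longleftrightarrow> subgroup N G \<and> subgroup K G \<and> N \<subseteq> K \<and> t \<in> K \<and>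
     t \<in> normalizing G N \<and> (\<forall>g\<in>K. \<exists>n::int. g \<otimes>\<^bsub>G\<^esub> t [^]\<^bsub>G\<^esub> n \<in> N)"

context group
begin

lemma inv_mult_cancel [simp]:
  "\<lbrakk>x \<in> carrier G; y \<in> carrier G\<rbrakk> \<Longrightarrow> inv x \<otimes> (x \<otimes> y) = y"
  "\<lbrakk>x \<in> carrier G; y \<in> carrier G\<rbrakk> \<Longrightarrow> x \<otimes> (inv x \<otimes> y) = y"
  by (simp_all add: m_assoc[symmetric])

lemma conj_mult:
  "\<lbrakk>g \<in> carrier G; x \<in> carrier G; y \<in> carrier G\<rbrakk> \<Longrightarrow>
    inv g \<otimes> (x \<otimes> y) \<otimes> g = (inv g \<otimes> x \<otimes> g) \<otimes> (inv g \<otimes> y \<otimes> g)"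
  by (simp add: m_assoc)

lemma conj_inv:
  "\<lbrakk>g \<in> carrier G; x \<in> carrier G\<rbrakk> \<Longrightarrow> inv g \<otimes> inv x \<otimes> g = inv (inv g \<otimes> x \<otimes> g)"
  by (simp add: m_assoc inv_mult_group)

lemma conj_hom: "g \<in> carrier G \<Longrightarrow> (\<lambda>x. inv g \<otimes> x \<otimes> g) \<in> hom G G"
  by (auto intro!: homI simp: conj_mult)

lemma subgroup_conj_preimage:
  assumes "subgroup U G" "g \<in> carrier G"
  shows "subgroup {x \<in> carrier G. inv g \<otimes> x \<otimes> g \<in> U} G"
proof -
  interpret U: subgroup U G
    by fact
  show ?thesis
    using assms(2) by unfold_locales (auto simp: conj_mult conj_inv)
qed

lemma subgroup_normalizing:
  assumes "N \<subseteq> carrier G"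
  shows "subgroup (normalizing G N) G"
proof
  fix g h assume gh: "g \<in> normalizing G N" "h \<in> normalizing G N"
  then have [simp]: "g \<in> carrier G" "h \<in> carrier G"
    by (auto simp: normalizing_def)
  have "g \<otimes> h \<otimes> x \<otimes> inv (g \<otimes> h) \<in> N \<and> inv (g \<otimes> h) \<otimes> x \<otimes> (g \<otimes> h) \<in> N" if "x \<in> N" for x
  proof -
    have [simp]: "x \<in> carrier G"
      using that assms by auto
    have "g \<otimes> (h \<otimes> x \<otimes> inv h) \<otimes> inv g \<in> N" "inv h \<otimes> (inv g \<otimes> x \<otimes> g) \<otimes> h \<in> N"
      using gh that by (auto simp: normalizing_def)
    moreover have "g \<otimes> h \<otimes> x \<otimes> inv (g \<otimes> h) = g \<otimes> (h \<otimes> x \<otimes> inv h) \<otimes> inv g"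
      "inv (g \<otimes> h) \<otimes> x \<otimes> (g \<otimes> h) = inv h \<otimes> (inv g \<otimes> x \<otimes> g) \<otimes> h"
      by (simp_all add: inv_mult_group m_assoc)
    ultimately show ?thesis
      by simp
  qed
  then show "g \<otimes> h \<in> normalizing G N"
    by (auto simp: normalizing_def)
qed (use assms in \<open>auto simp: normalizing_def\<close>)

lemma normalI_normalizing:
  assumes "subgroup N G" "carrier G \<subseteq> normalizing G N"
  shows "N \<lhd> G"
  using assms by (auto simp: normal_inv_iff normalizing_def)

lemma subset_normalizing:
  "subgroup N G \<Longrightarrow> N \<subseteq> normalizing G N"
  by (auto simp: normalizing_def subgroup.mem_carrier subgroup.m_closed subgroup.m_inv_closed)

lemma cyclic_FactGroup_iff:
  assumes "N \<lhd> G"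
  shows "cyclic_group (G Mod N) \<longleftrightarrow>
    (\<exists>t\<in>carrier G. \<forall>g\<in>carrier G. \<exists>n::int. g \<otimes> t [^] n \<in> N)"
proof -
  interpret N: normal N G
    by fact
  interpret Q: group "G Mod N"
    by (rule N.factorgroup_is_group)
  have "(N #> g = N #> t [^] (- n)) \<longleftrightarrow> g \<otimes> t [^] n \<in> N" if "t \<in> carrier G" "g \<in> carrier G" for t g and n :: int
  proof -
    have "N #> g = N #> t [^] (- n) \<longleftrightarrow> g \<in> N #> t [^] (- n)"
      using that by (metis N.subgroup_axioms int_pow_closed rcos_self repr_independence)
    also have "\<dots> \<longleftrightarrow> g \<otimes> inv (t [^] (- n)) \<in> N"
      using that by (intro N.rcos_module[OF is_group]) auto
    finally show ?thesis
      using that by (simp add: int_pow_neg)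
  qed
  then have *: "(\<exists>n::int. N #> g = N #> t [^] n) \<longleftrightarrow> (\<exists>n::int. g \<otimes> t [^] n \<in> N)"
    if "t \<in> carrier G" "g \<in> carrier G" for t g
    using that by (metis add.inverse_inverse)
  have "cyclic_group (G Mod N) \<longleftrightarrow>
    (\<exists>t\<in>carrier G. carrier (G Mod N) = range (\<lambda>n::int. N #> t [^] n))"
    unfolding Q.cyclic_group by (auto simp: carrier_FactGroup N.FactGroup_int_pow)
  also have "\<dots> \<longleftrightarrow> (\<exists>t\<in>carrier G. \<forall>g\<in>carrier G. \<exists>n::int. N #> g = N #> t [^] n)"
    unfolding carrier_FactGroup by (intro bex_cong) (auto simp: set_eq_iff image_iff)
  finally show ?thesis
    using * by simp
qed

lemma cyclic_extension_iff:
  assumes N: "subgroup N G" and K: "subgroup K G"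
  shows "N \<lhd> G\<lparr>carrier := K\<rparr> \<and> cyclic_group (G\<lparr>carrier := K\<rparr> Mod N) \<longleftrightarrow>
    (\<exists>t. cyclic_extension G N K t)" (is "?L \<longleftrightarrow> ?R")
proof
  interpret K: group "G\<lparr>carrier := K\<rparr>"
    using K by (rule subgroup.subgroup_is_group) (rule is_group)
  assume L: ?L
  then interpret N: normal N "G\<lparr>carrier := K\<rparr>"
    by simp
  from L obtain t where t: "t \<in> K" "\<And>g. g \<in> K \<Longrightarrow> \<exists>n::int. g \<otimes> t [^]\<^bsub>G\<lparr>carrier := K\<rparr>\<^esub> n \<in> N"
    by (auto simp: K.cyclic_FactGroup_iff)
  have "t \<in> normalizing G N"
    using t(1) N.inv_op_closed1[of t] N.inv_op_closed2[of t] K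
    by (auto simp: normalizing_def m_inv_consistent subgroup.mem_carrier)
  with t N K N.subset show ?R
    by (auto simp: cyclic_extension_def int_pow_consistent[symmetric])
next
  assume ?R
  then obtain t where t: "cyclic_extension G N K t"
    by blast
  interpret K: group "G\<lparr>carrier := K\<rparr>"
    using K by (rule subgroup.subgroup_is_group) (rule is_group)
  interpret N: subgroup N G
    by fact
  interpret K': subgroup K G
    by fact
  have "K \<subseteq> normalizing G N"
  proof
    fix g assume g: "g \<in> K"
    then obtain n :: int where n: "g \<otimes> t [^] n \<in> N"
      using t by (auto simp: cyclic_extension_def)
    interpret S: subgroup "normalizing G N" G
      by (rule subgroup_normalizing) (rule N.subset)
    have "t \<in> carrier G"
      using t K by (auto simp: cyclic_extension_def)
    then have "g = (g \<otimes> t [^] n) \<otimes> inv (t [^] n)"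
      using g by (simp add: m_assoc)
    moreover have "t [^] n \<in> normalizing G N"
      using t subgroup_normalizing[OF N.subset]
      by (intro subgroup_int_pow_closed) (auto simp: cyclic_extension_def)
    ultimately show "g \<in> normalizing G N"
      using n subset_normalizing[OF N] by (metis S.m_closed S.m_inv_closed subsetD)
  qed
  moreover have "subgroup N (G\<lparr>carrier := K\<rparr>)"
    using t K N by (intro subgroup_incl) (auto simp: cyclic_extension_def)
  ultimately have normal: "N \<lhd> G\<lparr>carrier := K\<rparr>"
    using K by (auto simp: K.normal_inv_iff normalizing_def m_inv_consistent)
  with t K show ?L
    by (auto simp: K.cyclic_FactGroup_iff cyclic_extension_def int_pow_consistent[symmetric])
qed

text \<open>Nested subgroups of \<open>K\<close> coincide if they have the same intersection with
  \<open>N\<close> and the same image in the cyclic group \<open>K/N\<close>. Both become constant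
  along a chain: the intersections by hypothesis, the images as subgroups of a cyclic group.\<close>

lemma max_condition_cyclic_extension:
  assumes ext: "cyclic_extension G N K t" and max: "max_condition_on G N"
  shows "max_condition_on G K"
  unfolding max_condition_on_def
proof (intro allI impI)
  fix S :: "nat \<Rightarrow> 'a set"
  assume "\<forall>n. subgroup (S n) G \<and> S n \<subseteq> K \<and> S n \<subseteq> S (Suc n)"
  then have S: "subgroup (S n) G" "S n \<subseteq> K" "S n \<subseteq> S (Suc n)" for n
    by auto
  have mono: "S i \<subseteq> S j" if "i \<le> j" for i j
    using S(3) that by (rule lift_Suc_mono_le)
  interpret N: subgroup N G
    using ext by (simp add: cyclic_extension_def)
  have t: "t \<in> normalizing G N" and [simp]: "t \<in> carrier G"
    using ext by (auto simp: cyclic_extension_def normalizing_def)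
  have pow_t: "t [^] i \<in> normalizing G N" for i :: int
    using t by (intro subgroup_int_pow_closed subgroup_normalizing N.subset)
  have SG: "s \<in> carrier G" if "s \<in> S n" for s n
    using that subgroup.subset[OF S(1)] by auto
  have "\<exists>M. \<forall>n\<ge>M. S n \<inter> N = S M \<inter> N"
    using S N.subgroup_axioms by (intro max_conditionD[OF max]) (blast intro: subgroups_Inter_pair)+
  then obtain M1 where M1: "\<And>n. M1 \<le> n \<Longrightarrow> S n \<inter> N = S M1 \<inter> N"
    by auto
  \<comment> \<open>The exponents i for which the coset of t^(-i) lies in the image of
    \<open>S n\<close> in \<open>K/N\<close>; this is a subgroup of the integers.\<close>
  define E where "E n = {i::int. \<exists>s\<in>S n. s \<otimes> t [^] i \<in> N}" for n
  have "\<exists>M. \<forall>n\<ge>M. E n = E M"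
  proof (rule int_subgroup_chain_stabilizes)
    show "0 \<in> E n" for n
      using S(1)[of n] by (auto simp: E_def intro!: bexI[of _ \<one>] subgroup.one_closed)
    show "E n \<subseteq> E (Suc n)" for n
      using S(3) by (auto simp: E_def)
    fix n i j assume "i \<in> E n" "j \<in> E n"
    then obtain s s' where s: "s \<in> S n" "s \<otimes> t [^] i \<in> N" and s': "s' \<in> S n" "s' \<otimes> t [^] j \<in> N"
      by (auto simp: E_def)
    have [simp]: "s \<in> carrier G" "s' \<in> carrier G"
      using s s' SG by auto
    have "inv (s' \<otimes> t [^] j) \<otimes> (s \<otimes> t [^] i) \<in> N"
      using s s' by simp
    \<comment> \<open>Conjugating by \<open>t [^] j\<close> moves the outer power of t to the right,
      which leaves s'^(-1) s t^(i-j) in \<open>N\<close>.\<close>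
    then have "t [^] j \<otimes> (inv (s' \<otimes> t [^] j) \<otimes> (s \<otimes> t [^] i)) \<otimes> inv (t [^] j) \<in> N"
      using pow_t[of j] by (simp add: normalizing_def)
    also have "t [^] j \<otimes> (inv (s' \<otimes> t [^] j) \<otimes> (s \<otimes> t [^] i)) \<otimes> inv (t [^] j)
        = inv s' \<otimes> s \<otimes> (t [^] i \<otimes> inv (t [^] j))"
      by (simp add: inv_mult_group m_assoc)
    also have "t [^] i \<otimes> inv (t [^] j) = t [^] (i - j)"
      by (simp add: int_pow_diff)
    finally show "i - j \<in> E n"
      using subgroup.m_closed[OF S(1) subgroup.m_inv_closed[OF S(1) s'(1)] s(1)] by (auto simp: E_def)
  qed
  then obtain M2 where M2: "\<And>n. M2 \<le> n \<Longrightarrow> E n = E M2"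
    by auto
  define M where "M = max M1 M2"
  have "S n \<subseteq> S M" if "M \<le> n" for n
  proof
    fix s assume s: "s \<in> S n"
    then obtain i :: int where i: "s \<otimes> t [^] i \<in> N"
      using S(2)[of n] ext unfolding cyclic_extension_def by blast
    \<comment> \<open>Some \<open>s'\<close> in the smaller subgroup has the same exponent i as
      \<open>s\<close>, so the two differ by an element of \<open>N\<close> that lies in
      \<open>S n\<close>, hence in \<open>S M\<close>.\<close>
    then have "i \<in> E M"
      using s that M2[of n] M2[of M] by (auto simp: E_def M_def)
    then obtain s' where s': "s' \<in> S M" "s' \<otimes> t [^] i \<in> N"
      by (auto simp: E_def)
    have [simp]: "s \<in> carrier G" "s' \<in> carrier G"
      using s s' SG by auto
    have "s \<otimes> t [^] i \<otimes> inv (s' \<otimes> t [^] i) \<in> N"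
      using i s' by simp
    also have "s \<otimes> t [^] i \<otimes> inv (s' \<otimes> t [^] i) = s \<otimes> (t [^] i \<otimes> inv (t [^] i)) \<otimes> inv s'"
      by (simp add: inv_mult_group m_assoc del: r_inv)
    finally have "s \<otimes> inv s' \<in> N"
      by simp
    moreover have "s \<otimes> inv s' \<in> S n"
      using s s' mono[OF that] by (intro subgroup.m_closed[OF S(1)] subgroup.m_inv_closed[OF S(1)]) auto
    ultimately have "s \<otimes> inv s' \<in> S M"
      using M1[of n] M1[of M] that by (auto simp: M_def)
    then have "s \<otimes> inv s' \<otimes> s' \<in> S M"
      using s'(1) by (rule subgroup.m_closed[OF S(1)])
    then show "s \<in> S M"
      by (simp add: m_assoc)
  qed
  with mono show "\<exists>M. \<forall>n\<ge>M. S n = S M"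
    by (intro exI[of _ M]) blast
qed

text \<open>The subgroups z^n U z^(-n) ascend because z^(-1) U z lies in \<open>U\<close>. Once two
  consecutive ones agree, conjugating back gives z U z^(-1) inside \<open>U\<close>.\<close>

lemma max_condition_conj_stable:
  assumes max: "max_condition_on G (carrier G)" and U: "subgroup U G" and z: "z \<in> carrier G"
    and sub: "\<And>u. u \<in> U \<Longrightarrow> inv z \<otimes> u \<otimes> z \<in> U"
  shows "z \<in> normalizing G U"
proof -
  interpret U: subgroup U G
    by fact
  define S where "S n = {g \<in> carrier G. inv (z [^] n) \<otimes> g \<otimes> z [^] n \<in> U}" for n :: nat
  have "S n \<subseteq> S (Suc n)" for n
  proof
    fix g assume g: "g \<in> S n"
    then have "inv z \<otimes> (inv (z [^] n) \<otimes> g \<otimes> z [^] n) \<otimes> z \<in> U"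
      by (auto simp: S_def sub)
    also have "inv z \<otimes> (inv (z [^] n) \<otimes> g \<otimes> z [^] n) \<otimes> z = inv (z [^] Suc n) \<otimes> g \<otimes> z [^] Suc n"
      using z g by (simp add: inv_mult_group m_assoc S_def)
    finally show "g \<in> S (Suc n)"
      using g by (simp add: S_def)
  qed
  moreover have "subgroup (S n) G" for n
    unfolding S_def using U z by (intro subgroup_conj_preimage) auto
  moreover have "S n \<subseteq> carrier G" for n
    by (auto simp: S_def)
  ultimately obtain N where N: "\<And>n. N \<le> n \<Longrightarrow> S n = S N"
    using max_conditionD[OF max, of S] by metis
  have "z \<otimes> u \<otimes> inv z \<in> U" if "u \<in> U" for u
  proof -
    have [simp]: "u \<in> carrier G"
      using that by simp
    \<comment> \<open>This element lies in term N+1 of the chain, hence in term N; conjugating it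
      back by only \<open>z [^] N\<close> leaves exactly z u z^(-1).\<close>
    define g where "g = z [^] Suc N \<otimes> u \<otimes> inv (z [^] Suc N)"
    have [simp]: "g \<in> carrier G"
      using z by (simp add: g_def)
    have "inv (z [^] Suc N) \<otimes> g \<otimes> z [^] Suc N
        = (inv (z [^] Suc N) \<otimes> z [^] Suc N) \<otimes> u \<otimes> (inv (z [^] Suc N) \<otimes> z [^] Suc N)"
      unfolding g_def using z by (simp only: m_assoc m_closed inv_closed nat_pow_closed \<open>u \<in> carrier G\<close>)
    then have "inv (z [^] Suc N) \<otimes> g \<otimes> z [^] Suc N = u"
      using z by (simp del: nat_pow_Suc)
    then have "g \<in> S (Suc N)"
      using that by (simp add: S_def del: nat_pow_Suc)
    then have "inv (z [^] N) \<otimes> g \<otimes> z [^] N \<in> U"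
      unfolding N[of "Suc N", OF le_SucI[OF order_refl]] by (simp add: S_def)
    moreover have "inv (z [^] N) \<otimes> g \<otimes> z [^] N
        = (inv (z [^] N) \<otimes> z [^] N) \<otimes> z \<otimes> u \<otimes> inv z \<otimes> (inv (z [^] N) \<otimes> z [^] N)"
      unfolding g_def using z by (simp only: m_assoc m_closed inv_closed nat_pow_closed
          \<open>u \<in> carrier G\<close> nat_pow_Suc inv_mult_group)
    ultimately show ?thesis
      using z by simp
  qed
  with sub z show ?thesis
    by (auto simp: normalizing_def)
qed

lemma funpow_hom: "h \<in> hom G G \<Longrightarrow> h ^^ n \<in> hom G G"
  by (induction n) (auto simp: hom_def Pi_iff)

text \<open>The kernels of the iterates of \<open>h\<close> ascend and become constant at some N. An
  element killed by \<open>h\<close> is the value of the N-th iterate at some x, by surjectivity;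
  then x lies in kernel N+1, which is kernel N, so the element is trivial.\<close>

lemma max_condition_Hopfian:
  assumes max: "max_condition_on G (carrier G)" and h: "h \<in> hom G G"
    and surj: "h ` carrier G = carrier G"
  shows "inj_on h (carrier G)"
proof -
  have hom: "group_hom G G (h ^^ n)" for n
    using funpow_hom[OF h, of n] by (simp add: group_hom_def group_hom_axioms_def)
  define S where "S n = kernel G G (h ^^ n)" for n
  have "S n \<subseteq> S (Suc n)" for n
    using group_hom.hom_one[OF hom[of 1]] by (auto simp: S_def kernel_def)
  moreover have "subgroup (S n) G" for n
    unfolding S_def by (rule group_hom.subgroup_kernel[OF hom])
  moreover have "S n \<subseteq> carrier G" for n
    by (auto simp: S_def kernel_def)
  ultimately obtain N where N: "\<And>n. N \<le> n \<Longrightarrow> S n = S N"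
    using max_conditionD[OF max, of S] by metis
  interpret h: group_hom G G h
    using hom[of 1] by simp
  have surj_pow: "(h ^^ n) ` carrier G = carrier G" for n
  proof (induction n)
    case (Suc n)
    then show ?case
      by (simp only: funpow.simps image_comp[symmetric] surj)
  qed simp
  have "g = \<one>" if "g \<in> carrier G" "h g = \<one>" for g
  proof -
    have "g \<in> (h ^^ N) ` carrier G"
      using that(1) by (simp only: surj_pow)
    then obtain x where x: "x \<in> carrier G" "g = (h ^^ N) x"
      by auto
    then have "x \<in> S (Suc N)"
      using that by (simp add: S_def kernel_def)
    then show ?thesis
      unfolding N[of "Suc N", OF le_SucI[OF order_refl]] using x by (simp add: S_def kernel_def)
  qed
  then show ?thesis
    by (auto simp: h.inj_on_one_iff)
qed

lemma polycyclic_imp_series: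
  assumes "polycyclic G"
  shows "\<exists>l C t. C 0 = {\<one>} \<and> C l = carrier G \<and>
    (\<forall>i<l. cyclic_extension G (C i) (C (Suc i)) (t i))"
proof -
  from assms obtain l C where C: "C 0 = {\<one>}" "C l = carrier G" "\<And>i. i \<le> l \<Longrightarrow> subgroup (C i) G"
    "\<And>i. i < l \<Longrightarrow> C i \<lhd> G\<lparr>carrier := C (Suc i)\<rparr> \<and> cyclic_group (G\<lparr>carrier := C (Suc i)\<rparr> Mod C i)"
    by (auto simp: polycyclic_def)
  then have "\<forall>i. \<exists>t. i < l \<longrightarrow> cyclic_extension G (C i) (C (Suc i)) t"
    using cyclic_extension_iff by (metis Suc_leI less_imp_le)
  then have "\<exists>t. \<forall>i<l. cyclic_extension G (C i) (C (Suc i)) (t i)"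
    by metis
  with C(1,2) show ?thesis
    by blast
qed

lemma polycyclicI:
  assumes "C 0 = {\<one>}" "C l = carrier G"
    and "\<And>i. i < l \<Longrightarrow> \<exists>t. cyclic_extension G (C i) (C (Suc i)) t"
  shows "polycyclic G"
proof -
  have "subgroup (C i) G" if "i \<le> l" for i
    using assms that subgroup_self by (cases "i = l") (auto simp: cyclic_extension_def less_le)
  then show ?thesis
    using assms cyclic_extension_iff is_group unfolding polycyclic_def
    by (intro conjI exI[of _ l] exI[of _ C]) auto
qed

lemma polycyclic_max_condition:
  assumes "polycyclic G"
  shows "max_condition_on G (carrier G)"
proof -
  obtain l C t where C: "C 0 = {\<one>}" "C l = carrier G"
    "\<And>i. i < l \<Longrightarrow> cyclic_extension G (C i) (C (Suc i)) (t i)"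
    using polycyclic_imp_series[OF assms] by auto
  have "max_condition_on G (C i)" if "i \<le> l" for i
    using that
  proof (induction i)
    case 0
    have trivial: "S = {\<one>}" if "subgroup S G" "S \<subseteq> {\<one>}" for S
      using that subgroup.one_closed by blast
    show ?case
      unfolding C max_condition_on_def using trivial by (intro allI impI exI[of _ 0]) metis
  next
    case (Suc i)
    then show ?case
      using max_condition_cyclic_extension[OF C(3)] by auto
  qed
  from this[of l] C(2) show ?thesis
    by simp
qed

end

lemma (in group_hom) cyclic_extension_image:
  assumes "cyclic_extension G N K t"
  shows "cyclic_extension H (h ` N) (h ` K) (h t)"
proof -
  have N: "subgroup N G" "subgroup K G" and t: "t \<in> carrier G"
    using assms by (auto simp: cyclic_extension_def normalizing_def)
  have NK: "x \<in> carrier G" if "x \<in> N \<or> x \<in> K" for x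
    using that subgroup.subset[OF N(1)] subgroup.subset[OF N(2)] by auto
  have "\<exists>n::int. h g \<otimes>\<^bsub>H\<^esub> h t [^]\<^bsub>H\<^esub> n \<in> h ` N" if "g \<in> K" for g
  proof -
    obtain n :: int where "g \<otimes> t [^] n \<in> N"
      using assms \<open>g \<in> K\<close> by (auto simp: cyclic_extension_def)
    then have "h (g \<otimes> t [^] n) \<in> h ` N"
      by blast
    then show ?thesis
      using t NK that by (auto simp: hom_int_pow)
  qed
  moreover have "h t \<otimes>\<^bsub>H\<^esub> h x \<otimes>\<^bsub>H\<^esub> inv\<^bsub>H\<^esub> h t \<in> h ` N" "inv\<^bsub>H\<^esub> h t \<otimes>\<^bsub>H\<^esub> h x \<otimes>\<^bsub>H\<^esub> h t \<in> h ` N" if "x \<in> N" for x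
  proof -
    have "h (t \<otimes> x \<otimes> inv t) \<in> h ` N" "h (inv t \<otimes> x \<otimes> t) \<in> h ` N"
      using assms that by (auto simp: cyclic_extension_def normalizing_def)
    then show "h t \<otimes>\<^bsub>H\<^esub> h x \<otimes>\<^bsub>H\<^esub> inv\<^bsub>H\<^esub> h t \<in> h ` N" "inv\<^bsub>H\<^esub> h t \<otimes>\<^bsub>H\<^esub> h x \<otimes>\<^bsub>H\<^esub> h t \<in> h ` N"
      using t NK that by auto
  qed
  ultimately show ?thesis
    using assms N t unfolding cyclic_extension_def normalizing_def
    by (auto intro: subgroup_img_is_subgroup)
qed

text \<open>The series of \<open>G\<close> is pushed forward along \<open>h\<close>, which may have
  a kernel, and one cyclic step is put on top.\<close>

lemma (in group_hom) polycyclic_extension: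
  assumes "polycyclic G" "cyclic_extension H (h ` carrier G) (carrier H) t"
  shows "polycyclic H"
proof -
  obtain l C s where C: "C 0 = {\<one>}" "C l = carrier G"
    "\<And>i. i < l \<Longrightarrow> cyclic_extension G (C i) (C (Suc i)) (s i)"
    using G.polycyclic_imp_series[OF assms(1)] by auto
  define C' where "C' i = (if i \<le> l then h ` C i else carrier H)" for i
  show ?thesis
  proof (rule H.polycyclicI)
    show "C' 0 = {\<one>\<^bsub>H\<^esub>}" "C' (Suc l) = carrier H"
      by (auto simp: C'_def C)
    fix i assume "i < Suc l"
    then consider "i < l" | "i = l"
      by linarith
    then show "\<exists>t. cyclic_extension H (C' i) (C' (Suc i)) t"
    proof cases
      case 1
      then show ?thesis
        using cyclic_extension_image[OF C(3)[OF 1]] by (auto simp: C'_def)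
    next
      case 2
      then show ?thesis
        using assms(2) C by (auto simp: C'_def)
    qed
  qed
qed

section \<open>Integer matrices\<close>

definition det_on :: "nat set \<Rightarrow> (nat \<Rightarrow> nat \<Rightarrow> int) \<Rightarrow> int" where
  "det_on T a = det (mat (card T) (card T)
     (\<lambda>(r, c). a (sorted_list_of_set T ! r) (sorted_list_of_set T ! c)))"

lemma int_lattice_closed:
  fixes M :: "(nat \<Rightarrow> int) set"
  assumes zero: "(\<lambda>_. 0) \<in> M" and diff: "\<And>v w. v \<in> M \<Longrightarrow> w \<in> M \<Longrightarrow> (\<lambda>l. v l - w l) \<in> M"
  shows "v \<in> M \<Longrightarrow> w \<in> M \<Longrightarrow> (\<lambda>l. v l + w l) \<in> M"
    and "v \<in> M \<Longrightarrow> (\<lambda>l. c * v l) \<in> M"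
    and "finite S \<Longrightarrow> (\<And>s. s \<in> S \<Longrightarrow> f s \<in> M) \<Longrightarrow> (\<lambda>l. \<Sum>s\<in>S. f s l) \<in> M"
proof -
  have neg: "(\<lambda>l. - v l) \<in> M" if "v \<in> M" for v
    using diff[OF zero that] by simp
  have add: "(\<lambda>l. v l + w l) \<in> M" if "v \<in> M" "w \<in> M" for v w
    using diff[OF that(1) neg[OF that(2)]] by simp
  then show "v \<in> M \<Longrightarrow> w \<in> M \<Longrightarrow> (\<lambda>l. v l + w l) \<in> M" .
  have nat: "(\<lambda>l. int n * v l) \<in> M" if "v \<in> M" for n v
    by (induction n) (use that zero add in \<open>simp_all add: algebra_simps\<close>)
  show "(\<lambda>l. c * v l) \<in> M" if "v \<in> M"
    using nat[OF that] neg[OF nat[OF that]] by (cases c rule: int_cases2) auto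
  show "(\<lambda>l. \<Sum>s\<in>S. f s l) \<in> M" if "finite S" "\<And>s. s \<in> S \<Longrightarrow> f s \<in> M"
    using that by (induction S) (auto intro: zero add)
qed

text \<open>The row of adj(A) A = det(A) I that belongs to i exhibits the vector as an integral
  combination of the given rows, without any division.\<close>

lemma det_mem_lattice:
  fixes M :: "(nat \<Rightarrow> int) set" and a :: "nat \<Rightarrow> nat \<Rightarrow> int"
  assumes zero: "(\<lambda>_. 0) \<in> M" and diff: "\<And>v w. v \<in> M \<Longrightarrow> w \<in> M \<Longrightarrow> (\<lambda>l. v l - w l) \<in> M"
    and T: "finite T" and rows: "\<And>j. j \<in> T \<Longrightarrow> (\<lambda>l. if l \<in> T then a j l else 0) \<in> M"
    and "i \<in> T"
  shows "(\<lambda>l. if l = i then det_on T a else 0) \<in> M"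
proof -
  define L where "L = sorted_list_of_set T"
  define n where "n = card T"
  define A where "A = mat n n (\<lambda>(r, c). a (L ! r) (L ! c))"
  have L: "set L = T" "distinct L" "length L = n"
    using T by (simp_all add: L_def n_def)
  have LT: "L ! s \<in> T" if "s < n" for s
    using that L nth_mem by blast
  obtain r where r: "r < n" "L ! r = i"
    using \<open>i \<in> T\<close> L by (metis in_set_conv_nth)
  have A: "A \<in> carrier_mat n n"
    by (simp add: A_def)
  define v where "v s l = (if l \<in> T then a (L ! s) l else 0)" for s l
  have "(\<lambda>l. \<Sum>s<n. adj_mat A $$ (r, s) * v s l) \<in> M"
    by (intro int_lattice_closed zero diff) (auto simp: v_def LT rows)
  also have "(\<lambda>l. \<Sum>s<n. adj_mat A $$ (r, s) * v s l) = (\<lambda>l. if l = i then det A else 0)"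
  proof
    fix l
    show "(\<Sum>s<n. adj_mat A $$ (r, s) * v s l) = (if l = i then det A else 0)"
    proof (cases "l \<in> T")
      case False
      then show ?thesis
        using \<open>i \<in> T\<close> by (auto simp: v_def)
    next
      case True
      then obtain c where c: "c < n" "L ! c = l"
        using L by (metis in_set_conv_nth)
      have "(\<Sum>s<n. adj_mat A $$ (r, s) * v s l) = (\<Sum>s<n. adj_mat A $$ (r, s) * A $$ (s, c))"
        using c True by (intro sum.cong) (auto simp: v_def A_def)
      also have "\<dots> = (adj_mat A * A) $$ (r, c)"
        using adj_mat(1)[OF A] A r c
        by (auto simp: times_mat_def scalar_prod_def atLeast0LessThan)
      also have "\<dots> = (if r = c then det A else 0)"
        using adj_mat(3)[OF A] r c by simp
      also have "r = c \<longleftrightarrow> l = i"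
        using r c L nth_eq_iff_index_eq by auto
      finally show ?thesis
        by simp
    qed
  qed
  finally show ?thesis
    unfolding A_def det_on_def L_def n_def .
qed

lemma det_cong_mod:
  fixes A B :: "int mat"
  assumes "A \<in> carrier_mat n n" "B \<in> carrier_mat n n"
    and "\<And>i j. i < n \<Longrightarrow> j < n \<Longrightarrow> [A $$ (i, j) = B $$ (i, j)] (mod q)"
  shows "[det A = det B] (mod q)"
proof -
  have "p i < n" if "p permutes {0..<n}" "i < n" for p i
    using permutes_in_image[OF that(1), of i] that(2) by simp
  then show ?thesis
    unfolding det_def'[OF assms(1)] det_def'[OF assms(2)]
    by (intro cong_sum cong_mult cong_prod cong_refl assms(3)) auto
qed

text \<open>Taking determinants in B A = I modulo q shows that det B inverts det A. For q = 0
  congruence is equality, so the same lemma serves the free parts.\<close>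

lemma det_unit_mod:
  fixes a b :: "nat \<Rightarrow> nat \<Rightarrow> int"
  assumes T: "finite T"
    and inv: "\<And>i l. i \<in> T \<Longrightarrow> l \<in> T \<Longrightarrow>
      [(\<Sum>j\<in>T. b i j * a j l) = (if i = l then 1 else 0)] (mod q)"
  shows "\<exists>d. [d * det_on T a = 1] (mod q)"
proof -
  define L where "L = sorted_list_of_set T"
  define n where "n = card T"
  define A where "A = mat n n (\<lambda>(r, c). a (L ! r) (L ! c))"
  define B where "B = mat n n (\<lambda>(r, c). b (L ! r) (L ! c))"
  have L: "set L = T" "distinct L" "length L = n"
    using T by (simp_all add: L_def n_def)
  have LT: "L ! s \<in> T" if "s < n" for s
    using that L nth_mem by blast
  have bij: "bij_betw (nth L) {..<n} T"
    using L by (auto simp: bij_betw_nth)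
  have AB: "A \<in> carrier_mat n n" "B \<in> carrier_mat n n"
    by (simp_all add: A_def B_def)
  have "[det (B * A) = det (1\<^sub>m n)] (mod q)"
  proof (rule det_cong_mod)
    fix r c assume rc: "r < n" "c < n"
    have "(B * A) $$ (r, c) = (\<Sum>s<n. b (L ! r) (L ! s) * a (L ! s) (L ! c))"
      using rc by (simp add: A_def B_def scalar_prod_def atLeast0LessThan)
    also have "\<dots> = (\<Sum>j\<in>T. b (L ! r) j * a j (L ! c))"
      by (rule sum.reindex_bij_betw[OF bij, of "\<lambda>j. b (L ! r) j * a j (L ! c)"])
    finally show "[(B * A) $$ (r, c) = 1\<^sub>m n $$ (r, c)] (mod q)"
      using inv[OF LT[OF rc(1)] LT[OF rc(2)]] rc L by (simp add: nth_eq_iff_index_eq)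
  qed (use AB in auto)
  then have "[det B * det A = 1] (mod q)"
    using det_mult[OF AB(2,1)] by simp
  then show ?thesis
    unfolding A_def L_def n_def det_on_def by blast
qed

section \<open>Cyclic extensions with prescribed action\<close>

text \<open>The data for an extension of \<open>H\<close> by an element z with g^z = \<phi>(g) and
  z^q = c. The value q = 0 stands for infinite order; then c is 1 and the extension is a semidirect
  product with the integers.\<close>

locale cyclic_extension_data = group H for H (structure) +
  fixes \<phi> :: "'a \<Rightarrow> 'a" and q :: nat and c :: 'a
  assumes auto: "\<phi> \<in> iso H H" and c [simp]: "c \<in> carrier H" and fix_c: "\<phi> c = c"
    and power: "\<And>g. g \<in> carrier H \<Longrightarrow> (\<phi> ^^ q) g = inv c \<otimes> g \<otimes> c"
    and c_one: "q = 0 \<Longrightarrow> c = \<one>"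
begin

text \<open>Powers are taken in the automorphism group so that negative exponents make sense. Its
  elements are extensional functions, hence the restriction of \<phi>.\<close>

definition act :: "int \<Rightarrow> 'a \<Rightarrow> 'a" where
  "act b = restrict \<phi> (carrier H) [^]\<^bsub>AutoGroup H\<^esub> b"

lemma restrict_auto: "restrict \<phi> (carrier H) \<in> carrier (AutoGroup H)"
proof -
  have "bij_betw (restrict \<phi> (carrier H)) (carrier H) (carrier H)"
    using auto by (auto simp: iso_def cong: bij_betw_cong)
  moreover have "restrict \<phi> (carrier H) \<in> hom H H"
    using auto by (auto simp: iso_def hom_def)
  ultimately show ?thesis
    by (simp add: AutoGroup_def auto_def Bij_def)
qed

lemma act_auto: "act b \<in> carrier (AutoGroup H)"
  unfolding act_def by (rule group.int_pow_closed[OF AutoGroup restrict_auto])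

lemma mult_AutoGroup:
  "\<lbrakk>f \<in> carrier (AutoGroup H); g \<in> carrier (AutoGroup H); x \<in> carrier H\<rbrakk> \<Longrightarrow>
    (f \<otimes>\<^bsub>AutoGroup H\<^esub> g) x = f (g x)"
  by (simp add: AutoGroup_def BijGroup_def auto_def compose_def)

lemma act_hom: "act b \<in> hom H H"
  using act_auto[of b] by (simp add: AutoGroup_def auto_def)

lemma act_closed [simp]: "g \<in> carrier H \<Longrightarrow> act b g \<in> carrier H"
  using act_hom[of b] by (auto simp: hom_def)

lemma act_mult [simp]:
  "\<lbrakk>g \<in> carrier H; h \<in> carrier H\<rbrakk> \<Longrightarrow> act b (g \<otimes> h) = act b g \<otimes> act b h"
  using act_hom[of b] by (auto simp: hom_def)

lemma act_one [simp]: "act b \<one> = \<one>"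
  using act_hom by (rule hom_one) (rule is_group)+

lemma act_add: "g \<in> carrier H \<Longrightarrow> act (a + b) g = act a (act b g)"
  using mult_AutoGroup[OF act_auto[of a] act_auto[of b]] group.int_pow_mult[OF AutoGroup restrict_auto]
  unfolding act_def by metis

lemma act_0 [simp]: "g \<in> carrier H \<Longrightarrow> act 0 g = g"
  by (simp add: act_def AutoGroup_def BijGroup_def)

lemma act_1: "g \<in> carrier H \<Longrightarrow> act 1 g = \<phi> g"
  using group.int_pow_1[OF AutoGroup restrict_auto] by (simp add: act_def)

lemma act_int: "g \<in> carrier H \<Longrightarrow> act (int n) g = (\<phi> ^^ n) g"
proof (induction n)
  case (Suc n)
  then show ?case
    using act_add[of g 1 "int n"] act_1[of "act (int n) g"] act_closed[of g "int n"] by simp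
qed simp

lemma act_c [simp]: "act b c = c"
proof -
  have nat: "act (int n) c = c" for n
  proof -
    have "(\<phi> ^^ n) c = c"
      by (induction n) (simp_all add: fix_c)
    then show ?thesis
      by (simp add: act_int)
  qed
  show ?thesis
  proof (cases "0 \<le> b")
    case True
    then show ?thesis
      using nat[of "nat b"] by simp
  next
    case False
    then have "act b (act (- b) c) = act b c"
      using nat[of "nat (- b)"] by simp
    then show ?thesis
      using act_add[of c b "- b"] by simp
  qed
qed

lemma act_inv_c [simp]: "act b (inv c) = inv c"
  using group_hom.hom_inv[of H H "act b" c] act_hom[of b] is_group
  by (simp add: group_hom_def group_hom_axioms_def)

text \<open>The pair (a, h) stands for t^a h, where t acts on \<open>H\<close> by \<phi>; moving h
  to the right past t^b turns it into \<open>act b h\<close>.\<close>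

definition semidirect :: "(int \<times> 'a) monoid" where
  "semidirect = \<lparr>carrier = UNIV \<times> carrier H,
     monoid.mult = (\<lambda>(a, h) (b, g). (a + b, act b h \<otimes> g)), one = (0, \<one>)\<rparr>"

lemma carrier_semidirect [simp]: "carrier semidirect = UNIV \<times> carrier H"
  by (simp add: semidirect_def)

lemma mult_semidirect [simp]: "(a, h) \<otimes>\<^bsub>semidirect\<^esub> (b, g) = (a + b, act b h \<otimes> g)"
  by (simp add: semidirect_def)

lemma one_semidirect [simp]: "\<one>\<^bsub>semidirect\<^esub> = (0, \<one>)"
  by (simp add: semidirect_def)

lemma group_semidirect: "group semidirect"
proof (rule groupI)
  fix x assume "x \<in> carrier semidirect"
  then obtain a h where x: "x = (a, h)" "h \<in> carrier H"
    by auto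
  then have "act a (act (- a) (inv h)) = inv h"
    using act_add[of "inv h" a "- a"] by simp
  then have "(- a, act (- a) (inv h)) \<otimes>\<^bsub>semidirect\<^esub> x = \<one>\<^bsub>semidirect\<^esub>"
    using x by simp
  moreover have "(- a, act (- a) (inv h)) \<in> carrier semidirect"
    using x by simp
  ultimately show "\<exists>y\<in>carrier semidirect. y \<otimes>\<^bsub>semidirect\<^esub> x = \<one>\<^bsub>semidirect\<^esub>"
    by blast
next
  fix x y z assume "x \<in> carrier semidirect" "y \<in> carrier semidirect" "z \<in> carrier semidirect"
  then show "x \<otimes>\<^bsub>semidirect\<^esub> y \<otimes>\<^bsub>semidirect\<^esub> z = x \<otimes>\<^bsub>semidirect\<^esub> (y \<otimes>\<^bsub>semidirect\<^esub> z)"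
    by (auto simp: m_assoc act_add[symmetric] ac_simps)
qed auto

text \<open>The extension is the semidirect product modulo the subgroup generated by w = t^q c^(-1).
  The assumptions \<phi>(c) = c and \<phi>^q = conjugation by c say precisely that w commutes with t
  and with \<open>H\<close>, so this subgroup is central.\<close>

lemma cyclic_extension_exists:
  obtains E :: "(int \<times> 'a) set monoid" and \<iota> z
  where "group E" "\<iota> \<in> hom H E" "z \<in> carrier E"
    and "\<And>g. g \<in> carrier H \<Longrightarrow> inv\<^bsub>E\<^esub> z \<otimes>\<^bsub>E\<^esub> \<iota> g \<otimes>\<^bsub>E\<^esub> z = \<iota> (\<phi> g)"
    and "z [^]\<^bsub>E\<^esub> q = \<iota> c"
    and "\<And>(a::int) b g h. \<lbrakk>g \<in> carrier H; h \<in> carrier H; q = 0 \<or> \<bar>a - b\<bar> < int q;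
      z [^]\<^bsub>E\<^esub> a \<otimes>\<^bsub>E\<^esub> \<iota> g = z [^]\<^bsub>E\<^esub> b \<otimes>\<^bsub>E\<^esub> \<iota> h\<rbrakk> \<Longrightarrow> a = b \<and> g = h"
proof -
  interpret S: group semidirect
    by (rule group_semidirect)
  define t :: "int \<times> 'a" where "t = (1, \<one>)"
  define w where "w = (int q, inv c)"
  have t [simp]: "t \<in> carrier semidirect" and w [simp]: "w \<in> carrier semidirect"
    by (simp_all add: t_def w_def)
  have t_pow_nat: "t [^]\<^bsub>semidirect\<^esub> n = (int n, \<one>)" for n :: nat
    by (induction n) (simp_all add: t_def)
  have inv_pair: "inv\<^bsub>semidirect\<^esub> (n, \<one>) = (- n, \<one>)" for n
    by (rule S.inv_equality) auto
  have t_pow: "t [^]\<^bsub>semidirect\<^esub> a = (a, \<one>)" for a :: int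
  proof (cases a rule: int_cases2)
    case (nonneg n)
    then show ?thesis
      using t_pow_nat[of n] by (simp add: int_pow_int)
  next
    case (nonpos n)
    then show ?thesis
      using t_pow_nat[of n] inv_pair[of "int n"] by (simp only: S.int_pow_neg_int t)
  qed
  have w_central: "x \<otimes>\<^bsub>semidirect\<^esub> w = w \<otimes>\<^bsub>semidirect\<^esub> x" if "x \<in> carrier semidirect" for x
    using that by (auto simp: w_def act_int power m_assoc add.commute)
  define N where "N = range (\<lambda>j::int. w [^]\<^bsub>semidirect\<^esub> j)"
  have "subgroup N semidirect"
    using S.generate_is_subgroup[of "{w}"] S.generate_pow[OF w] w
    by (simp add: N_def full_SetCompr_eq del: carrier_semidirect)
  moreover have "x \<otimes>\<^bsub>semidirect\<^esub> w [^]\<^bsub>semidirect\<^esub> j \<otimes>\<^bsub>semidirect\<^esub> inv\<^bsub>semidirect\<^esub> x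
      = w [^]\<^bsub>semidirect\<^esub> j" if x: "x \<in> carrier semidirect" for x and j :: int
  proof -
    interpret conj: group_hom semidirect semidirect
      "\<lambda>y. inv\<^bsub>semidirect\<^esub> (inv\<^bsub>semidirect\<^esub> x) \<otimes>\<^bsub>semidirect\<^esub> y \<otimes>\<^bsub>semidirect\<^esub> inv\<^bsub>semidirect\<^esub> x"
      using S.conj_hom[OF S.inv_closed[OF x]] S.is_group
      by (simp add: group_hom_def group_hom_axioms_def)
    have "x \<otimes>\<^bsub>semidirect\<^esub> w \<otimes>\<^bsub>semidirect\<^esub> inv\<^bsub>semidirect\<^esub> x = w"
      using x by (simp only: w_central S.m_assoc S.inv_closed S.r_inv S.r_one w)
    then show ?thesis
      using conj.hom_int_pow[OF w, of j] S.inv_inv[OF x] by simp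
  qed
  ultimately have "N \<lhd> semidirect"
    by (auto simp: S.normal_inv_iff N_def)
  then interpret N: normal N semidirect .
  define E where "E = semidirect Mod N"
  define p where "p x = N #>\<^bsub>semidirect\<^esub> x" for x
  have E: "group E"
    unfolding E_def by (rule N.factorgroup_is_group)
  interpret p: group_hom semidirect E p
    using N.r_coset_hom_Mod S.is_group E
    unfolding p_def E_def by (simp add: group_hom_def group_hom_axioms_def)
  define \<iota> where "\<iota> g = p (0, g)" for g
  have "\<iota> \<in> hom H E"
  proof (rule homI)
    fix g h assume "g \<in> carrier H" "h \<in> carrier H"
    then show "\<iota> (g \<otimes> h) = \<iota> g \<otimes>\<^bsub>E\<^esub> \<iota> h"
      using p.hom_mult[of "(0, g)" "(0, h)"] by (simp add: \<iota>_def)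
  qed (simp add: \<iota>_def)
  moreover have "p t \<in> carrier E"
    using t p.hom_closed by blast
  moreover have "inv\<^bsub>E\<^esub> p t \<otimes>\<^bsub>E\<^esub> \<iota> g \<otimes>\<^bsub>E\<^esub> p t = \<iota> (\<phi> g)" if "g \<in> carrier H" for g
  proof -
    have "inv\<^bsub>semidirect\<^esub> t \<otimes>\<^bsub>semidirect\<^esub> (0, g) \<otimes>\<^bsub>semidirect\<^esub> t = (0, \<phi> g)"
      using that unfolding t_def inv_pair by (simp add: act_1[symmetric])
    moreover have "(0, g) \<in> carrier semidirect"
      using that by simp
    ultimately show ?thesis
      using t p.hom_mult p.hom_inv S.m_closed S.inv_closed unfolding \<iota>_def by metis
  qed
  moreover have "p t [^]\<^bsub>E\<^esub> q = \<iota> c"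
  proof -
    \<comment> \<open>t^q and c differ by the factor w itself, so they have the same coset.\<close>
    have "(int q, \<one>) \<in> N #>\<^bsub>semidirect\<^esub> (0, c)"
    proof -
      have "w [^]\<^bsub>semidirect\<^esub> (1::int) \<otimes>\<^bsub>semidirect\<^esub> (0, c) \<in> N #>\<^bsub>semidirect\<^esub> (0, c)"
        unfolding r_coset_def N_def by blast
      then show ?thesis
        using S.int_pow_1[OF w] by (simp add: w_def)
    qed
    then have "p (0, c) = p (int q, \<one>)"
      unfolding p_def by (intro S.repr_independence) (auto intro: N.subgroup_axioms)
    then show ?thesis
      using p.hom_nat_pow[OF t, of q] by (simp add: \<iota>_def t_pow_nat)
  qed
  moreover have "a = b \<and> g = h" if gh: "g \<in> carrier H" "h \<in> carrier H"
    and q: "q = 0 \<or> \<bar>a - b\<bar> < int q"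
    and eq: "p t [^]\<^bsub>E\<^esub> a \<otimes>\<^bsub>E\<^esub> \<iota> g = p t [^]\<^bsub>E\<^esub> b \<otimes>\<^bsub>E\<^esub> \<iota> h" for a b :: int and g h
  proof -
    have "p t [^]\<^bsub>E\<^esub> a \<otimes>\<^bsub>E\<^esub> \<iota> g = p (a, g)" if "g \<in> carrier H" for a :: int and g
    proof -
      have "p t [^]\<^bsub>E\<^esub> a \<otimes>\<^bsub>E\<^esub> \<iota> g = p ((a, \<one>) \<otimes>\<^bsub>semidirect\<^esub> (0, g))"
        using that p.hom_mult[of "(a, \<one>)" "(0, g)"] p.hom_int_pow[OF t, of a]
        by (simp add: \<iota>_def t_pow)
      then show ?thesis
        using that by simp
    qed
    then have "p (a, g) = p (b, h)"
      using eq gh by metis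
    then have "(a, g) \<in> N #>\<^bsub>semidirect\<^esub> (b, h)"
      using gh S.rcos_self[of "(a, g)" N] N.subgroup_axioms by (simp add: p_def)
    then obtain j :: int where j: "(a, g) = w [^]\<^bsub>semidirect\<^esub> j \<otimes>\<^bsub>semidirect\<^esub> (b, h)"
      by (auto simp: r_coset_def N_def)
    \<comment> \<open>The projection to the integers shows that w^j has first coordinate j q. For q
      > 0 the bound on the difference of a and b then forces j = 0; for q = 0 the element w is
      trivial.\<close>
    have "fst \<in> hom semidirect integer_group"
      by (auto simp: hom_def)
    then interpret fst: group_hom semidirect integer_group fst
      using S.is_group by (simp add: group_hom_def group_hom_axioms_def)
    have "fst (w [^]\<^bsub>semidirect\<^esub> j) = j * int q"
      using fst.hom_int_pow[OF w, of j] by (simp add: w_def)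
    moreover have "w [^]\<^bsub>semidirect\<^esub> j \<in> carrier semidirect"
      by (rule S.int_pow_closed) (rule w)
    ultimately obtain k where wj: "w [^]\<^bsub>semidirect\<^esub> j = (j * int q, k)"
      by (metis prod.collapse)
    then have a: "a - b = j * int q"
      using j by simp
    have "w [^]\<^bsub>semidirect\<^esub> j = \<one>\<^bsub>semidirect\<^esub>"
    proof (cases "q = 0")
      case True
      then have "w = \<one>\<^bsub>semidirect\<^esub>"
        by (simp add: w_def c_one)
      then show ?thesis
        using S.int_pow_one by simp
    next
      case False
      then have "\<bar>j\<bar> * int q < 1 * int q"
        using q a by (simp add: abs_mult)
      then have "\<bar>j\<bar> < 1"
        using False by (simp only: mult_less_cancel_right)
      then have "j = 0"
        by simp
      then show ?thesis
        by simp
    qed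
    then show ?thesis
      using j gh by simp
  qed
  ultimately show thesis
    by - (rule that[OF E, of \<iota> "p t"]; assumption)
qed

end

section \<open>Presentations and their subpresentations\<close>

lemma (in group) word_eval_in_subgroup:
  assumes "subgroup U G" "\<And>i. i \<in> S \<Longrightarrow> f i \<in> U" "w \<in> words S"
  shows "word_eval G f w \<in> U"
  using assms(3)
  by (induction w) (auto simp: assms(1,2) subgroup.one_closed subgroup.m_closed subgroup.m_inv_closed)

locale presentation =
  fixes D :: presentation_data
  assumes refined: "refined_solvable_presentation D"
begin

abbreviation "m \<equiv> num_gens D"
abbreviation "H \<equiv> sub_group D"
abbreviation "x \<equiv> gen D"
abbreviation "layers \<equiv> {1..num_layers D}"

lemma partition: "valid_partition D"
  and valid_exponents: "valid_exponents D"
  and valid_powers: "valid_powers D"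
  and valid_conjugates: "valid_conjugates D"
  using refined by (simp_all add: refined_solvable_presentation_def)

lemma Union_layers: "(\<Union>s\<in>layers. layer D s) = {1..m}"
  using partition unfolding valid_partition_def by (elim conjE)

lemma layers_nonempty: "\<forall>s\<in>layers. layer D s \<noteq> {}"
  using partition unfolding valid_partition_def by (elim conjE)

lemma layers_less: "\<forall>s\<in>layers. \<forall>t\<in>layers. s < t \<longrightarrow> (\<forall>x\<in>layer D s. \<forall>y\<in>layer D t. x < y)"
  using partition unfolding valid_partition_def by (elim conjE)

lemma layer_parts: "\<forall>s\<in>layers.
    layer D s = (\<Union>p\<in>{p. prime p}. torsion_part D s p) \<union> free_part D s \<and>
    disjoint_family_on (torsion_part D s) {p. prime p} \<and>
    (\<forall>p. prime p \<longrightarrow> torsion_part D s p \<inter> free_part D s = {})"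
  using partition unfolding valid_partition_def by (elim conjE)

lemma torsion_free_disjoint: "\<lbrakk>s \<in> layers; prime p\<rbrakk> \<Longrightarrow> torsion_part D s p \<inter> free_part D s = {}"
  using bspec[OF layer_parts] by blast

lemma layer_subset: "s \<in> layers \<Longrightarrow> layer D s \<subseteq> {1..m}"
  using Union_layers by blast

lemma obtain_layer:
  assumes "i \<in> {1..m}"
  obtains s where "s \<in> layers" "i \<in> layer D s"
  using assms unfolding Union_layers[symmetric] by blast

lemma layer_less:
  "\<lbrakk>s \<in> layers; t \<in> layers; s < t; i \<in> layer D s; j \<in> layer D t\<rbrakk> \<Longrightarrow> i < j"
  using layers_less by blast

lemma layer_unique:
  "\<lbrakk>s \<in> layers; t \<in> layers; i \<in> layer D s; i \<in> layer D t\<rbrakk> \<Longrightarrow> s = t"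
  using layer_less[of s t i i] layer_less[of t s i i] by (cases s t rule: linorder_cases) auto

lemma layer_le:
  "\<lbrakk>s \<in> layers; t \<in> layers; i \<in> layer D s; j \<in> layer D t; i \<le> j\<rbrakk> \<Longrightarrow> s \<le> t"
  using layer_less[of t s j i] by (cases "t < s") auto

lemma layer_index_eq: "\<lbrakk>s \<in> layers; i \<in> layer D s\<rbrakk> \<Longrightarrow> layer_index D i = s"
  unfolding layer_index_def using layer_unique by blast

lemma torsion_subset: "\<lbrakk>s \<in> layers; prime p\<rbrakk> \<Longrightarrow> torsion_part D s p \<subseteq> layer D s"
  and free_subset: "s \<in> layers \<Longrightarrow> free_part D s \<subseteq> layer D s"
  using bspec[OF layer_parts, of s] by blast+

lemma layer_cases:
  assumes "s \<in> layers" "i \<in> layer D s"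
  obtains (free) "i \<in> free_part D s" | (torsion) p where "prime p" "i \<in> torsion_part D s p"
  using assms bspec[OF layer_parts assms(1)] by blast

lemma exponent_free: "\<lbrakk>s \<in> layers; i \<in> free_part D s\<rbrakk> \<Longrightarrow> exponent D i = \<infinity>"
  using refined by (auto simp: refined_solvable_presentation_def valid_exponents_def)

lemma exponent_torsion:
  assumes "s \<in> layers" "prime p" "i \<in> torsion_part D s p"
  obtains e where "e \<ge> 1" "exponent D i = enat (p ^ e)"
  using assms that valid_exponents unfolding valid_exponents_def by blast

lemma lower_layersE:
  assumes "i \<in> lower_layers D s" "s \<in> layers"
  obtains t where "t \<in> layers" "t < s" "i \<in> layer D t"
  using assms by (auto simp: lower_layers_def)

lemma lower_less: "\<lbrakk>s \<in> layers; i \<in> lower_layers D s; j \<in> layer D s\<rbrakk> \<Longrightarrow> i < j"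
  using layer_less by (blast elim: lower_layersE)

lemma lower_iff:
  assumes "s \<in> layers" "t \<in> layers" "i \<in> layer D t"
  shows "i \<in> lower_layers D s \<longleftrightarrow> t < s"
proof
  assume "i \<in> lower_layers D s"
  then show "t < s"
    using assms layer_unique by (metis lower_layersE)
qed (use assms in \<open>auto simp: lower_layers_def\<close>)

lemma lower_subset: "s \<in> layers \<Longrightarrow> lower_layers D s \<subseteq> {1..m}"
  using layer_subset by (blast elim: lower_layersE)

section \<open>Supports of the exponent vectors\<close>

lemma power_exp_props:
  assumes "s \<in> layers" "i \<in> layer D s" "exponent D i < \<infinity>" "j \<in> {1..m}"
  shows power_exp_range: "power_exp D i j \<in> exp_range D j"
    and power_exp_support: "power_exp D i j \<noteq> 0 \<Longrightarrow> j \<in> lower_layers D s"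
proof -
  obtain p where "prime p" "i \<in> torsion_part D s p"
    using assms exponent_free by (cases rule: layer_cases[OF assms(1,2)]) auto
  then show "power_exp D i j \<in> exp_range D j"
    "power_exp D i j \<noteq> 0 \<Longrightarrow> j \<in> lower_layers D s"
    using assms valid_powers unfolding valid_powers_def by blast+
qed

lemma power_exp_zero:
  assumes "i \<in> {1..m}" "exponent D i < \<infinity>" "i \<le> j" "j \<le> m"
  shows "power_exp D i j = 0"
proof -
  obtain s where "s \<in> layers" "i \<in> layer D s"
    using obtain_layer assms(1) by blast
  then show ?thesis
    using power_exp_support[of s i j] lower_less[of s j i] assms by fastforce
qed

lemma conj_exp_range:
  assumes "i \<in> {1..m}" "j \<in> {1..m}" "i < j" "l \<in> {1..m}"
  shows "conj_exp D i j l \<in> exp_range D l"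
proof -
  have "\<forall>i\<in>{1..m}. \<forall>j\<in>{1..m}. i < j \<longrightarrow> (\<forall>l\<in>{1..m}. conj_exp D i j l \<in> exp_range D l)"
    using valid_conjugates unfolding valid_conjugates_def by (elim conjE)
  with assms show ?thesis
    by blast
qed

lemma conj_exp_same_layer_props: "\<forall>s\<in>layers. \<forall>i\<in>layer D s. \<forall>j\<in>layer D s. i < j \<longrightarrow>
    (\<forall>l\<in>{1..m}. l \<notin> lower_layers D s \<union> {i} \<longrightarrow> conj_exp D i j l = 0) \<and> conj_exp D i j i = 1"
  using valid_conjugates unfolding valid_conjugates_def by (elim conjE)

lemma conj_exp_diff_layer: "\<forall>s\<in>layers. \<forall>t\<in>layers. s < t \<longrightarrow>
    (\<forall>p. prime p \<longrightarrow> (\<forall>i\<in>torsion_part D s p. \<forall>j\<in>layer D t. \<forall>l\<in>{1..m}.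
       l \<notin> lower_layers D s \<union> torsion_part D s p \<longrightarrow> conj_exp D i j l = 0)) \<and>
    (\<forall>i\<in>free_part D s. \<forall>j\<in>layer D t. \<forall>l\<in>{1..m}.
       l \<notin> lower_layers D s \<union> layer D s \<longrightarrow> conj_exp D i j l = 0)"
  using valid_conjugates unfolding valid_conjugates_def by (elim conjE)

lemma conj_exp_same_layer:
  assumes "s \<in> layers" "i \<in> layer D s" "j \<in> layer D s" "i < j"
  shows "conj_exp D i j i = 1"
    and "l \<in> {1..m} \<Longrightarrow> conj_exp D i j l \<noteq> 0 \<Longrightarrow> l \<in> lower_layers D s \<union> {i}"
  using assms conj_exp_same_layer_props by blast+

lemma conj_exp_torsion:
  assumes "s \<in> layers" "t \<in> layers" "s < t" "prime p" "i \<in> torsion_part D s p" "j \<in> layer D t"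
    and "l \<in> {1..m}" "conj_exp D i j l \<noteq> 0"
  shows "l \<in> lower_layers D s \<union> torsion_part D s p"
  using assms conj_exp_diff_layer by blast

lemma conj_exp_free:
  assumes "s \<in> layers" "t \<in> layers" "s < t" "i \<in> free_part D s" "j \<in> layer D t"
    and "l \<in> {1..m}" "conj_exp D i j l \<noteq> 0"
  shows "l \<in> lower_layers D s \<union> layer D s"
  using assms conj_exp_diff_layer by blast

lemma conj_exp_support:
  assumes "s \<in> layers" "i \<in> layer D s" "j \<in> {1..m}" "i < j" "l \<in> {1..m}" "conj_exp D i j l \<noteq> 0"
  shows "l \<in> lower_layers D s \<union> layer D s"
proof -
  obtain t where t: "t \<in> layers" "j \<in> layer D t"
    using obtain_layer assms(3) by blast
  have "s \<le> t"
    using layer_le[OF assms(1) t(1) assms(2) t(2)] assms(4) by simp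
  then consider "s = t" | "s < t"
    by linarith
  then show ?thesis
  proof cases
    case 1
    then show ?thesis
      using conj_exp_same_layer(2)[OF assms(1,2) _ assms(4,5,6)] t(2) assms(2) by auto
  next
    case 2
    show ?thesis
      using assms(1,2)
    proof (cases rule: layer_cases)
      case free
      then show ?thesis
        using conj_exp_free[OF assms(1) t(1) 2 _ t(2) assms(5,6)] by blast
    next
      case (torsion p)
      then show ?thesis
        using conj_exp_torsion[OF assms(1) t(1) 2 torsion t(2) assms(5,6)] torsion_subset assms(1) by blast
    qed
  qed
qed

text \<open>The letters that may occur lie in the layer of i or below, so they precede j if j is in
  a later layer. If i and j share a layer, the only letter of that layer that may occur is i, which
  again precedes j.\<close>

lemma conj_exp_zero:
  assumes "i \<in> {1..m}" "i < j" "j \<le> l" "l \<le> m"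
  shows "conj_exp D i j l = 0"
proof (rule ccontr)
  assume nonzero: "conj_exp D i j l \<noteq> 0"
  obtain s where s: "s \<in> layers" "i \<in> layer D s"
    using obtain_layer assms(1) by blast
  obtain t where t: "t \<in> layers" "j \<in> layer D t"
    using obtain_layer[of j] assms by auto
  have l: "l \<in> lower_layers D s \<union> layer D s"
    using assms by (intro conj_exp_support[OF s _ assms(2) _ nonzero]) auto
  consider "s = t" | "s < t"
    using layer_le[OF s(1) t(1) s(2) t(2)] assms by force
  then show False
  proof cases
    case 1
    then have "l \<in> lower_layers D s \<union> {i}"
      using conj_exp_same_layer(2)[OF s _ assms(2) _ nonzero] t assms by auto
    then show False
      using lower_less[OF s(1) _ s(2), of l] assms by auto
  next
    case 2
    then show False
      using l lower_less[OF s(1) _ s(2), of l] layer_less[OF s(1) t(1) 2 _ t(2), of l] assms by auto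
  qed
qed

text \<open>That 1 is admissible uses e \<ge> 1 in n(x) = p^e. It makes each generator its own
  normal form, so that \<delta>(z) has the intended values on generators.\<close>

lemma exp_range_0 [simp]: "j \<in> {1..m} \<Longrightarrow> 0 \<in> exp_range D j"
  and exp_range_1: "j \<in> {1..m} \<Longrightarrow> 1 \<in> exp_range D j"
proof -
  assume "j \<in> {1..m}"
  then obtain s where s: "s \<in> layers" "j \<in> layer D s"
    using obtain_layer by blast
  then have "0 \<in> exp_range D j \<and> 1 \<in> exp_range D j"
  proof (cases rule: layer_cases)
    case free
    then show ?thesis
      using exponent_free s by (auto simp: exp_range_def)
  next
    case (torsion p)
    then obtain e where "e \<ge> 1" "exponent D j = enat (p ^ e)"
      using exponent_torsion s by blast
    then obtain q where "1 < q" "exponent D j = enat q"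
      using one_less_power[OF prime_gt_1_nat[OF torsion(1)], of e] by auto
    then show ?thesis
      by (simp add: exp_range_def)
  qed
  then show "0 \<in> exp_range D j" "1 \<in> exp_range D j"
    by auto
qed

text \<open>The bound is \<open>Suc k\<close> and not \<open>k\<close>, because \<pi> of the letter
  k+1 is already a word in the first k letters; the criteria read it in this form in
  \<open>H k\<close>.\<close>

lemma power_word_eq:
  assumes "i \<in> {1..m}" "exponent D i < \<infinity>" "i \<le> Suc k" "k \<le> m"
  shows "power_word D i = normal_word k (power_exp D i)"
  unfolding power_word_def using assms by (intro normal_word_restrict power_exp_zero) auto

lemma conj_word_eq:
  assumes "i \<in> {1..m}" "i < j" "j \<le> Suc k" "k \<le> m"
  shows "conj_word D i j = normal_word k (conj_exp D i j)"
  unfolding conj_word_def using assms by (intro normal_word_restrict conj_exp_zero) auto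

section \<open>The groups H_k: relations, universal property, normal forms\<close>

lemma group_H: "group (H k)"
  unfolding sub_group_def by (rule group_presented_group)

lemma x_closed: "i \<in> {1..k} \<Longrightarrow> x k i \<in> carrier (H k)"
  unfolding gen_def sub_elem_def sub_group_def carrier_presented_group by simp

lemma x_funcset: "x k \<in> {1..k} \<rightarrow> carrier (H k)"
  using x_closed by blast

lemma sub_elem_eq: "w \<in> words {1..k} \<Longrightarrow> sub_elem D k w = word_eval (H k) (x k) w"
  using word_eval_presented_group[of w "{1..k}" "sub_relations D k"]
  unfolding gen_def sub_elem_def sub_group_def by (simp add: fun_eq_iff)

lemma sub_elem_normal_word: "sub_elem D k (normal_word k e) = descending_prod (H k) (x k) e k"
  using group.word_eval_normal_word[OF group_H x_funcset] normal_word_words[of k e "{1..k}"]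
  by (simp add: sub_elem_eq)

lemma sub_elem_closed: "w \<in> words {1..k} \<Longrightarrow> sub_elem D k w \<in> carrier (H k)"
  unfolding sub_elem_def sub_group_def carrier_presented_group by simp

lemma sub_elem_eq_iff:
  "\<lbrakk>u \<in> words {1..k}; v \<in> words {1..k}\<rbrakk> \<Longrightarrow>
    sub_elem D k u = sub_elem D k v \<longleftrightarrow> word_eq {1..k} (sub_relations D k) u v"
  unfolding sub_elem_def by (rule word_class_eq_iff)

lemma H_elem:
  assumes "g \<in> carrier (H k)"
  obtains w where "w \<in> words {1..k}" "g = word_eval (H k) (x k) w"
  using assms sub_elem_eq unfolding sub_group_def carrier_presented_group sub_elem_def by blast

lemma relation_power:
  assumes "i \<in> {1..k}" "exponent D i = enat n" "k \<le> m"
  shows "x k i [^]\<^bsub>H k\<^esub> n = descending_prod (H k) (x k) (power_exp D i) k"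
proof -
  interpret group "H k"
    by (rule group_H)
  have words: "replicate n (i, True) \<in> words {1..k}" "normal_word k (power_exp D i) \<in> words {1..k}"
    using assms by (auto intro: words_replicate normal_word_words)
  have "power_word D i = normal_word k (power_exp D i)"
    using assms by (intro power_word_eq) auto
  then have "(replicate n (i, True), normal_word k (power_exp D i)) \<in> sub_relations D k"
    using assms unfolding sub_relations_def by (intro UnI1 CollectI exI[of _ i]) auto
  then have "word_eq {1..k} (sub_relations D k) (replicate n (i, True)) (normal_word k (power_exp D i))"
    using words by (intro word_eq.relation)
  then have "sub_elem D k (replicate n (i, True)) = sub_elem D k (normal_word k (power_exp D i))"
    using words by (simp add: sub_elem_eq_iff)
  then show ?thesis
    using words assms(1) by (simp add: sub_elem_normal_word sub_elem_eq word_eval_replicate x_closed)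
qed

lemma relation_conj:
  assumes "i \<in> {1..k}" "j \<in> {1..k}" "i < j" "k \<le> m"
  shows "inv\<^bsub>H k\<^esub> x k j \<otimes>\<^bsub>H k\<^esub> x k i \<otimes>\<^bsub>H k\<^esub> x k j
    = descending_prod (H k) (x k) (conj_exp D i j) k"
proof -
  interpret group "H k"
    by (rule group_H)
  let ?u = "[(j, False), (i, True), (j, True)]"
  have words: "?u \<in> words {1..k}" "normal_word k (conj_exp D i j) \<in> words {1..k}"
    using assms by (auto intro: normal_word_words)
  have "conj_word D i j = normal_word k (conj_exp D i j)"
    using assms by (intro conj_word_eq) auto
  then have "(?u, normal_word k (conj_exp D i j)) \<in> sub_relations D k"
    using assms unfolding sub_relations_def by (intro UnI2 CollectI exI[of _ i] exI[of _ j]) auto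
  then have "word_eq {1..k} (sub_relations D k) ?u (normal_word k (conj_exp D i j))"
    using words by (intro word_eq.relation)
  then have "sub_elem D k ?u = sub_elem D k (normal_word k (conj_exp D i j))"
    using words by (simp add: sub_elem_eq_iff)
  then show ?thesis
    using words assms by (simp add: sub_elem_normal_word sub_elem_eq x_closed m_assoc)
qed

lemma universal_property:
  assumes "group G" "f \<in> {1..k} \<rightarrow> carrier G" "k \<le> m"
    and power: "\<And>i n. \<lbrakk>i \<in> {1..k}; exponent D i = enat n\<rbrakk> \<Longrightarrow>
      f i [^]\<^bsub>G\<^esub> n = descending_prod G f (power_exp D i) k"
    and conj: "\<And>i j. \<lbrakk>i \<in> {1..k}; j \<in> {1..k}; i < j\<rbrakk> \<Longrightarrow>
      inv\<^bsub>G\<^esub> f j \<otimes>\<^bsub>G\<^esub> f i \<otimes>\<^bsub>G\<^esub> f j = descending_prod G f (conj_exp D i j) k"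
  obtains h where "h \<in> hom (H k) G" "\<And>i. i \<in> {1..k} \<Longrightarrow> h (x k i) = f i"
proof -
  interpret G: group G
    by fact
  have "word_eval G f u = word_eval G f v" if uv: "(u, v) \<in> sub_relations D k" for u v
  proof -
    consider (power) i where "i \<in> {1..k}" "exponent D i < \<infinity>"
        "u = replicate (the_enat (exponent D i)) (i, True)" "v = power_word D i"
      | (conj) i j where "i \<in> {1..k}" "j \<in> {1..k}" "i < j"
        "u = [(j, False), (i, True), (j, True)]" "v = conj_word D i j"
      using uv by (auto simp: sub_relations_def)
    then show ?thesis
    proof cases
      case (power i)
      then obtain n where n: "exponent D i = enat n"
        by (cases "exponent D i") auto
      have "f i \<in> carrier G" "power_word D i = normal_word k (power_exp D i)"
        using power assms(2,3) by (auto intro!: power_word_eq)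
      then show ?thesis
        using power n assms(4)[OF power(1) n] assms(2)
        by (simp add: G.word_eval_replicate G.word_eval_normal_word)
    next
      case (conj i j)
      have "f i \<in> carrier G" "f j \<in> carrier G" "conj_word D i j = normal_word k (conj_exp D i j)"
        using conj assms(2,3) by (auto intro!: conj_word_eq)
      then show ?thesis
        using conj(4,5) assms(5)[OF conj(1-3)] assms(2)
        by (simp add: G.word_eval_normal_word G.m_assoc)
    qed
  qed
  with assms(1,2) obtain h where h: "h \<in> hom (H k) G"
    "\<And>w. w \<in> words {1..k} \<Longrightarrow> h (sub_elem D k w) = word_eval G f w"
    unfolding sub_group_def sub_elem_def by (rule von_Dyck) blast+
  have "h (x k i) = f i" if "i \<in> {1..k}" for i
  proof -
    have "f i \<in> carrier G"
      using that assms(2) by auto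
    then show ?thesis
      using h(2)[of "[(i, True)]"] that by (simp add: gen_def)
  qed
  with h(1) that show thesis
    by blast
qed

lemma hom_eqI:
  assumes "group G" "h \<in> hom (H k) G" "h' \<in> hom (H k) G"
    and "\<And>i. i \<in> {1..k} \<Longrightarrow> h (x k i) = h' (x k i)" and g: "g \<in> carrier (H k)"
  shows "h g = h' g"
proof -
  obtain w where w: "w \<in> words {1..k}" "g = word_eval (H k) (x k) w"
    using g by (rule H_elem)
  then show ?thesis
    using group.word_eval_hom[OF group_H assms(2,1) x_funcset w(1)]
      group.word_eval_hom[OF group_H assms(3,1) x_funcset w(1)]
      word_eval_cong[OF w(1), of "\<lambda>i. h (x k i)" "\<lambda>i. h' (x k i)"] assms(4)
    by simp
qed

lemma subgroup_top:
  assumes "subgroup U (H k)" "\<And>i. i \<in> {1..k} \<Longrightarrow> x k i \<in> U"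
  shows "U = carrier (H k)"
proof
  show "carrier (H k) \<subseteq> U"
  proof
    fix g assume "g \<in> carrier (H k)"
    then obtain w where w: "w \<in> words {1..k}" "g = word_eval (H k) (x k) w"
      by (rule H_elem)
    show "g \<in> U"
      unfolding w(2) by (rule group.word_eval_in_subgroup[OF group_H assms w(1)])
  qed
qed (rule subgroup.subset[OF assms(1)])

lemma normal_form_exists:
  assumes "consistent D k" "g \<in> carrier (H k)"
  obtains r where "r \<in> (\<Pi>\<^sub>E i\<in>{1..k}. exp_range D i)" "g = descending_prod (H k) (x k) r k"
  using assms unfolding consistent_def is_normal_form_def by blast

lemma normal_form_unique:
  assumes "consistent D k" "\<And>i. i \<in> {1..k} \<Longrightarrow> d i \<in> exp_range D i"
    and "\<And>i. i \<in> {1..k} \<Longrightarrow> e i \<in> exp_range D i"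
    and "descending_prod (H k) (x k) d k = descending_prod (H k) (x k) e k" and i: "i \<in> {1..k}"
  shows "d i = e i"
proof -
  let ?g = "descending_prod (H k) (x k) e k"
  have "?g \<in> carrier (H k)"
    by (rule group.descending_prod_closed[OF group_H x_funcset])
  then have ex1: "\<exists>!r. is_normal_form D k ?g r"
    using assms(1) by (auto simp: consistent_def)
  have "is_normal_form D k ?g (restrict d {1..k})"
    using assms(2) unfolding is_normal_form_def assms(4)[symmetric]
    by (auto intro!: descending_prod_cong)
  moreover have "is_normal_form D k ?g (restrict e {1..k})"
    using assms(3) unfolding is_normal_form_def by (auto intro!: descending_prod_cong)
  ultimately have "restrict d {1..k} = restrict e {1..k}"
    using ex1 by blast
  then show ?thesis
    using i by (metis restrict_apply')
qed

lemma delta_map_normal_form: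
  assumes "consistent D k" "\<And>i. i \<in> {1..k} \<Longrightarrow> e i \<in> exp_range D i"
  shows "delta_map D k (descending_prod (H k) (x k) e k)
    = descending_prod (H k) (\<lambda>i. sub_elem D k (conj_word D i (Suc k))) e k"
proof -
  let ?g = "descending_prod (H k) (x k) e k"
  have "?g \<in> carrier (H k)"
    by (rule group.descending_prod_closed[OF group_H x_funcset])
  then have ex1: "\<exists>!r. is_normal_form D k ?g r"
    using assms(1) by (auto simp: consistent_def)
  have "is_normal_form D k ?g (restrict e {1..k})"
    using assms(2) unfolding is_normal_form_def by (auto intro!: descending_prod_cong)
  then have "(THE r. is_normal_form D k ?g r) = restrict e {1..k}"
    by (rule the1_equality[OF ex1])
  then show ?thesis
    unfolding delta_map_def by (auto intro!: descending_prod_cong)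
qed

lemma delta_map_gen:
  assumes "consistent D k" "i \<in> {1..k}" "k < m"
  shows "delta_map D k (x k i) = descending_prod (H k) (x k) (conj_exp D i (Suc k)) k"
proof -
  interpret group "H k"
    by (rule group_H)
  have closed: "(\<lambda>i. sub_elem D k (conj_word D i (Suc k))) \<in> {1..k} \<rightarrow> carrier (H k)"
    using assms(3) by (auto simp: conj_word_eq[where k = k] intro!: sub_elem_closed normal_word_words)
  have "x k i = descending_prod (H k) (x k) (\<lambda>j. if j = i then 1 else 0) k"
    using descending_prod_single[OF x_funcset assms(2), of 1] x_closed[OF assms(2)] by (simp add: int_pow_1)
  then have "delta_map D k (x k i)
      = descending_prod (H k) (\<lambda>i. sub_elem D k (conj_word D i (Suc k))) (\<lambda>j. if j = i then 1 else 0) k"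
    using assms exp_range_1 delta_map_normal_form[OF assms(1), of "\<lambda>j. if j = i then 1 else 0"] by auto
  also have "\<dots> = sub_elem D k (conj_word D i (Suc k))"
    using descending_prod_single[OF closed assms(2), of 1] closed assms(2) by (simp add: Pi_iff int_pow_1)
  also have "conj_word D i (Suc k) = normal_word k (conj_exp D i (Suc k))"
    using assms by (intro conj_word_eq) auto
  finally show ?thesis
    by (simp add: sub_elem_normal_word)
qed

text \<open>The right-hand sides of the relations of \<open>H k\<close> involve no letter beyond k,
  so the relations hold verbatim in \<open>H n\<close>. The natural map thus exists before any
  consistency is known.\<close>

lemma subpresentation_hom:
  assumes "k \<le> n" "n \<le> m"
  obtains \<iota> where "\<iota> \<in> hom (H k) (H n)" "\<And>i. i \<in> {1..k} \<Longrightarrow> \<iota> (x k i) = x n i"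
proof -
  have x: "x n \<in> {1..k} \<rightarrow> carrier (H n)"
    using assms(1) x_closed by auto
  have extend: "descending_prod (H n) (x n) e n = descending_prod (H n) (x n) e k"
    if "\<And>i. k < i \<Longrightarrow> i \<le> n \<Longrightarrow> e i = 0" for e
    using that assms(1) x by (intro group.descending_prod_extend[OF group_H]) auto
  obtain \<iota> where "\<iota> \<in> hom (H k) (H n)" "\<And>i. i \<in> {1..k} \<Longrightarrow> \<iota> (x k i) = x n i"
  proof (rule universal_property[OF group_H x])
    fix i q assume i: "i \<in> {1..k}" "exponent D i = enat q"
    have "power_exp D i j = 0" if "k < j" "j \<le> n" for j
      using i assms that by (intro power_exp_zero) auto
    then show "x n i [^]\<^bsub>H n\<^esub> q = descending_prod (H n) (x n) (power_exp D i) k"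
      using relation_power[of i n q] extend i assms by auto
  next
    fix i j assume ij: "i \<in> {1..k}" "j \<in> {1..k}" "i < j"
    have "conj_exp D i j l = 0" if "k < l" "l \<le> n" for l
      using ij assms that by (intro conj_exp_zero) auto
    then show "inv\<^bsub>H n\<^esub> x n j \<otimes>\<^bsub>H n\<^esub> x n i \<otimes>\<^bsub>H n\<^esub> x n j
        = descending_prod (H n) (x n) (conj_exp D i j) k"
      using relation_conj[of i n j] extend ij assms by auto
  qed (use assms in auto)
  with that show thesis
    by blast
qed

text \<open>Padding with zeros turns a normal form of \<open>H k\<close> into one of
  \<open>H n\<close>. Existence of normal forms in \<open>H k\<close> and their uniqueness in
  \<open>H n\<close> then make the natural map injective.\<close>

lemma embedding:
  assumes "consistent D k" "consistent D n" "k \<le> n" "n \<le> m"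
  obtains \<iota> where "\<iota> \<in> hom (H k) (H n)" "inj_on \<iota> (carrier (H k))"
    "\<And>i. i \<in> {1..k} \<Longrightarrow> \<iota> (x k i) = x n i"
proof -
  interpret K: group "H k"
    by (rule group_H)
  interpret G: group "H n"
    by (rule group_H)
  have x: "x n \<in> {1..k} \<rightarrow> carrier (H n)"
    using assms(3) x_closed by auto
  have extend: "descending_prod (H n) (x n) e n = descending_prod (H n) (x n) e k"
    if "\<And>i. k < i \<Longrightarrow> i \<le> n \<Longrightarrow> e i = 0" for e
    using that assms(3) x by (intro G.descending_prod_extend) auto
  obtain \<iota> where \<iota>: "\<iota> \<in> hom (H k) (H n)" "\<And>i. i \<in> {1..k} \<Longrightarrow> \<iota> (x k i) = x n i"
    using subpresentation_hom[OF assms(3,4)] by blast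
  have image: "\<iota> (descending_prod (H k) (x k) e k)
      = descending_prod (H n) (x n) (\<lambda>i. if i \<le> k then e i else 0) n" for e
  proof -
    have "\<iota> (descending_prod (H k) (x k) e k) = descending_prod (H n) (\<lambda>i. \<iota> (x k i)) e k"
      by (rule K.descending_prod_hom[OF \<iota>(1) group_H x_funcset])
    also have "\<dots> = descending_prod (H n) (x n) (\<lambda>i. if i \<le> k then e i else 0) k"
      using \<iota>(2) by (intro descending_prod_cong) auto
    finally show ?thesis
      using extend[of "\<lambda>i. if i \<le> k then e i else 0"] by simp
  qed
  have "inj_on \<iota> (carrier (H k))"
  proof (rule inj_onI)
    fix g h assume gh: "g \<in> carrier (H k)" "h \<in> carrier (H k)" "\<iota> g = \<iota> h"
    obtain d where d: "d \<in> (\<Pi>\<^sub>E i\<in>{1..k}. exp_range D i)" "g = descending_prod (H k) (x k) d k"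
      using assms(1) gh(1) by (rule normal_form_exists)
    obtain e where e: "e \<in> (\<Pi>\<^sub>E i\<in>{1..k}. exp_range D i)" "h = descending_prod (H k) (x k) e k"
      using assms(1) gh(2) by (rule normal_form_exists)
    have range: "(if i \<le> k then r i else 0) \<in> exp_range D i"
      if "r \<in> (\<Pi>\<^sub>E i\<in>{1..k}. exp_range D i)" "i \<in> {1..n}" for r i
      using that assms(4) by auto
    have "d i = e i" if "i \<in> {1..k}" for i
      using normal_form_unique[OF assms(2) range[OF d(1)] range[OF e(1)]
          gh(3)[unfolded d(2) e(2) image], of i] that assms(3) by auto
    then show "g = h"
      unfolding d(2) e(2) by (intro descending_prod_cong) auto
  qed
  with \<iota> that show thesis
    by blast
qed

end

section \<open>Necessity of the criteria\<close>

primrec exponent_sum :: "nat \<Rightarrow> nat word \<Rightarrow> int" where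
  "exponent_sum l [] = 0"
| "exponent_sum l (a # w) = (if fst a = l then (if snd a then 1 else - 1) else 0) + exponent_sum l w"

lemma exponent_sum_append [simp]: "exponent_sum l (u @ v) = exponent_sum l u + exponent_sum l v"
  by (induction u) auto

lemma exponent_sum_inverse_word [simp]: "exponent_sum l (inverse_word w) = - exponent_sum l w"
  by (induction w) (auto simp: inverse_word_Cons)

lemma exponent_sum_replicate:
  "exponent_sum l (replicate n (i, b)) = (if i = l then (if b then int n else - int n) else 0)"
  by (induction n) auto

lemma exponent_sum_normal_word:
  "exponent_sum l (normal_word k e) = (if l \<in> {1..k} then e l else 0)"
  by (induction k) (auto simp: normal_word_Suc word_power_def exponent_sum_replicate)

text \<open>The homomorphism of free groups that sends the letter i to \<sigma>(i), on unreduced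
  words; it serves to lift conjugation by z to words.\<close>

definition substitute_word :: "('a \<Rightarrow> 'b word) \<Rightarrow> 'a word \<Rightarrow> 'b word" where
  "substitute_word \<sigma> w = concat (map (\<lambda>(i, b). if b then \<sigma> i else inverse_word (\<sigma> i)) w)"

lemma substitute_word_Nil [simp]: "substitute_word \<sigma> [] = []"
  by (simp add: substitute_word_def)

lemma substitute_word_Cons [simp]: "substitute_word \<sigma> (a # w) =
  (if snd a then \<sigma> (fst a) else inverse_word (\<sigma> (fst a))) @ substitute_word \<sigma> w"
  by (simp add: substitute_word_def split_beta)

lemma substitute_word_words:
  "(\<And>i. i \<in> S \<Longrightarrow> \<sigma> i \<in> words T) \<Longrightarrow> w \<in> words S \<Longrightarrow> substitute_word \<sigma> w \<in> words T"
  by (induction w) auto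

lemma (in group) word_eval_substitute_word:
  assumes "f \<in> T \<rightarrow> carrier G" "\<And>i. i \<in> S \<Longrightarrow> \<sigma> i \<in> words T" "w \<in> words S"
  shows "word_eval G f (substitute_word \<sigma> w) = word_eval G (\<lambda>i. word_eval G f (\<sigma> i)) w"
  using assms(3)
proof (induction w)
  case (Cons a w)
  then show ?case
    using substitute_word_words[of S \<sigma> T w] assms(1,2)
    by (simp add: word_eval_append word_eval_inverse)
qed simp

lemma (in group) subgroup_word_eval_image:
  assumes "f \<in> S \<rightarrow> carrier G"
  shows "subgroup (word_eval G f ` words S) G"
proof
  fix g h assume "g \<in> word_eval G f ` words S" "h \<in> word_eval G f ` words S"
  then obtain u v where uv: "u \<in> words S" "v \<in> words S" "g = word_eval G f u" "h = word_eval G f v"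
    by blast
  then show "g \<otimes> h \<in> word_eval G f ` words S"
    using word_eval_append[OF assms uv(1,2)] by (intro image_eqI[of _ _ "u @ v"]) auto
next
  fix g assume "g \<in> word_eval G f ` words S"
  then obtain u where u: "u \<in> words S" "g = word_eval G f u"
    by blast
  then show "inv g \<in> word_eval G f ` words S"
    using word_eval_inverse[OF assms u(1)] by (intro image_eqI[of _ _ "inverse_word u"]) auto
qed (use assms in \<open>auto intro: image_eqI[of _ _ "[]"]\<close>)

section \<open>Criteria (1)-(4) and then (5) from consistency\<close>

context presentation
begin

lemma embedding_descending_prod:
  assumes "k \<le> m" and \<iota>: "\<iota> \<in> hom (H k) (H m)" "\<And>i. i \<in> {1..k} \<Longrightarrow> \<iota> (x k i) = x m i"
    and "\<And>i. k < i \<Longrightarrow> i \<le> m \<Longrightarrow> e i = 0"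
  shows "\<iota> (descending_prod (H k) (x k) e k) = descending_prod (H m) (x m) e m"
proof -
  have "\<iota> (descending_prod (H k) (x k) e k) = descending_prod (H m) (\<lambda>i. \<iota> (x k i)) e k"
    by (rule group.descending_prod_hom[OF group_H \<iota>(1) group_H x_funcset])
  also have "\<dots> = descending_prod (H m) (x m) e k"
    using \<iota>(2) by (intro descending_prod_cong) auto
  also have "\<dots> = descending_prod (H m) (x m) e m"
    using assms(1,4) x_closed by (intro group.descending_prod_extend[OF group_H, symmetric]) auto
  finally show ?thesis .
qed

text \<open>On generators this is the relation x^z = \<delta>(x, z) of \<open>G\<close>. On a normal
  form \<delta>(z) is defined factor by factor, and conjugation, being a homomorphism, acts in the
  same way.\<close>

lemma embedding_delta_map:
  assumes cons: "consistent D k" and k: "k < m"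
    and \<iota>: "\<iota> \<in> hom (H k) (H m)" "\<And>i. i \<in> {1..k} \<Longrightarrow> \<iota> (x k i) = x m i"
    and g: "g \<in> carrier (H k)"
  shows "\<iota> (delta_map D k g) = inv\<^bsub>H m\<^esub> x m (Suc k) \<otimes>\<^bsub>H m\<^esub> \<iota> g \<otimes>\<^bsub>H m\<^esub> x m (Suc k)"
proof -
  interpret K: group "H k"
    by (rule group_H)
  interpret G: group "H m"
    by (rule group_H)
  let ?z = "x m (Suc k)"
  have z: "?z \<in> carrier (H m)"
    using k by (intro x_closed) auto
  have x: "x m \<in> {1..k} \<rightarrow> carrier (H m)"
    using x_closed k by auto
  have gens: "\<iota> (sub_elem D k (conj_word D i (Suc k))) = inv\<^bsub>H m\<^esub> ?z \<otimes>\<^bsub>H m\<^esub> \<iota> (x k i) \<otimes>\<^bsub>H m\<^esub> ?z"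
    if i: "i \<in> {1..k}" for i
  proof -
    have "conj_word D i (Suc k) = normal_word k (conj_exp D i (Suc k))"
      using i k by (intro conj_word_eq) auto
    then have "\<iota> (sub_elem D k (conj_word D i (Suc k)))
        = \<iota> (descending_prod (H k) (x k) (conj_exp D i (Suc k)) k)"
      by (simp add: sub_elem_normal_word)
    also have "\<dots> = descending_prod (H m) (x m) (conj_exp D i (Suc k)) m"
      using k i by (intro embedding_descending_prod \<iota> conj_exp_zero) auto
    also have "\<dots> = inv\<^bsub>H m\<^esub> ?z \<otimes>\<^bsub>H m\<^esub> x m i \<otimes>\<^bsub>H m\<^esub> ?z"
      using k i by (intro relation_conj[symmetric]) auto
    finally show ?thesis
      using \<iota>(2)[OF i] by simp
  qed
  obtain r where r: "r \<in> (\<Pi>\<^sub>E i\<in>{1..k}. exp_range D i)" "g = descending_prod (H k) (x k) r k"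
    using cons g by (rule normal_form_exists)
  have closed: "(\<lambda>i. sub_elem D k (conj_word D i (Suc k))) \<in> {1..k} \<rightarrow> carrier (H k)"
    using k by (auto simp: conj_word_eq[where k = k] intro!: sub_elem_closed normal_word_words)
  have "\<iota> (delta_map D k g)
      = \<iota> (descending_prod (H k) (\<lambda>i. sub_elem D k (conj_word D i (Suc k))) r k)"
    unfolding r(2) using r(1) by (subst delta_map_normal_form[OF cons]) auto
  also have "\<dots> = descending_prod (H m) (\<lambda>i. \<iota> (sub_elem D k (conj_word D i (Suc k)))) r k"
    by (rule K.descending_prod_hom[OF \<iota>(1) group_H closed])
  also have "\<dots> = descending_prod (H m) (\<lambda>i. inv\<^bsub>H m\<^esub> ?z \<otimes>\<^bsub>H m\<^esub> \<iota> (x k i) \<otimes>\<^bsub>H m\<^esub> ?z) r k"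
    using gens by (intro descending_prod_cong) auto
  also have "\<dots> = inv\<^bsub>H m\<^esub> ?z \<otimes>\<^bsub>H m\<^esub> descending_prod (H m) (\<lambda>i. \<iota> (x k i)) r k \<otimes>\<^bsub>H m\<^esub> ?z"
    using x_closed hom_in_carrier[OF \<iota>(1)]
    by (intro G.descending_prod_hom[OF G.conj_hom[OF z] group_H, symmetric]) auto
  also have "descending_prod (H m) (\<lambda>i. \<iota> (x k i)) r k = \<iota> g"
    unfolding r(2) by (rule K.descending_prod_hom[OF \<iota>(1) group_H x_funcset, symmetric])
  finally show ?thesis .
qed

lemma delta_map_closed:
  assumes "consistent D k" "k < m" "g \<in> carrier (H k)"
  shows "delta_map D k g \<in> carrier (H k)"
proof -
  obtain r where r: "r \<in> (\<Pi>\<^sub>E i\<in>{1..k}. exp_range D i)" "g = descending_prod (H k) (x k) r k"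
    using assms(1,3) by (rule normal_form_exists)
  have closed: "(\<lambda>i. sub_elem D k (conj_word D i (Suc k))) \<in> {1..k} \<rightarrow> carrier (H k)"
    using assms(2) by (auto simp: conj_word_eq[where k = k] intro!: sub_elem_closed normal_word_words)
  have "delta_map D k g = descending_prod (H k) (\<lambda>i. sub_elem D k (conj_word D i (Suc k))) r k"
    unfolding r(2) using r(1) by (intro delta_map_normal_form[OF assms(1)]) auto
  then show ?thesis
    using group.descending_prod_closed[OF group_H closed] by simp
qed

lemma consistent_imp_criteria_1_to_4:
  assumes cons: "consistent D k" "consistent D m" and k: "k < m"
  shows "criterion1 D k \<and> criterion2 D k \<and> criterion3 D k \<and> criterion4 D k"
proof -
  interpret K: group "H k"
    by (rule group_H)
  interpret G: group "H m"
    by (rule group_H)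
  let ?z = "x m (Suc k)"
  let ?\<delta> = "delta_map D k"
  have z: "?z \<in> carrier (H m)"
    using k by (intro x_closed) auto
  have x: "x m \<in> {1..k} \<rightarrow> carrier (H m)"
    using x_closed k by auto
  obtain \<iota> where \<iota>: "\<iota> \<in> hom (H k) (H m)" "inj_on \<iota> (carrier (H k))"
    "\<And>i. i \<in> {1..k} \<Longrightarrow> \<iota> (x k i) = x m i"
    using embedding[OF cons] k by auto
  interpret \<iota>: group_hom "H k" "H m" \<iota>
    using \<iota>(1) by (simp add: group_hom_def group_hom_axioms_def group_H)
  have conj: "\<iota> (?\<delta> g) = inv\<^bsub>H m\<^esub> ?z \<otimes>\<^bsub>H m\<^esub> \<iota> g \<otimes>\<^bsub>H m\<^esub> ?z" if "g \<in> carrier (H k)" for g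
    using cons(1) k \<iota>(1,3) that by (rule embedding_delta_map)
  note closed = delta_map_closed[OF cons(1) k]
  have inj: "g = h" if "\<iota> g = \<iota> h" "g \<in> carrier (H k)" "h \<in> carrier (H k)" for g h
    using \<iota>(2) that by (auto dest: inj_onD)
  have \<delta>_hom: "?\<delta> \<in> hom (H k) (H k)"
  proof (rule homI)
    fix g h assume gh: "g \<in> carrier (H k)" "h \<in> carrier (H k)"
    have "\<iota> (?\<delta> (g \<otimes>\<^bsub>H k\<^esub> h)) = inv\<^bsub>H m\<^esub> ?z \<otimes>\<^bsub>H m\<^esub> (\<iota> g \<otimes>\<^bsub>H m\<^esub> \<iota> h) \<otimes>\<^bsub>H m\<^esub> ?z"
      using conj[OF K.m_closed[OF gh]] gh by simp
    also have "\<dots> = \<iota> (?\<delta> g) \<otimes>\<^bsub>H m\<^esub> \<iota> (?\<delta> h)"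
      unfolding conj[OF gh(1)] conj[OF gh(2)] using gh z by (intro G.conj_mult) auto
    also have "\<dots> = \<iota> (?\<delta> g \<otimes>\<^bsub>H k\<^esub> ?\<delta> h)"
      using gh closed by simp
    finally show "?\<delta> (g \<otimes>\<^bsub>H k\<^esub> h) = ?\<delta> g \<otimes>\<^bsub>H k\<^esub> ?\<delta> h"
      using gh closed by - (rule inj, simp_all)
  qed (rule closed)
  then interpret \<delta>: group_hom "H k" "H k" ?\<delta>
    by (simp add: group_hom_def group_hom_axioms_def group_H)
  have power: "sub_elem D k (power_word D (Suc k)) \<in> carrier (H k) \<and>
      \<iota> (sub_elem D k (power_word D (Suc k))) = ?z [^]\<^bsub>H m\<^esub> q"
    if q: "exponent D (Suc k) = enat q" for q
  proof -
    have pw: "power_word D (Suc k) = normal_word k (power_exp D (Suc k))"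
      using q k by (intro power_word_eq) auto
    have "\<iota> (descending_prod (H k) (x k) (power_exp D (Suc k)) k)
        = descending_prod (H m) (x m) (power_exp D (Suc k)) m"
      using k q by (intro embedding_descending_prod \<iota> power_exp_zero) auto
    also have "\<dots> = ?z [^]\<^bsub>H m\<^esub> q"
      using k q by (intro relation_power[symmetric]) auto
    finally show ?thesis
      using K.descending_prod_closed[OF x_funcset] by (simp add: pw sub_elem_normal_word)
  qed
  have "criterion1 D k"
    unfolding criterion1_def
  proof
    assume "exponent D (Suc k) < \<infinity>"
    then obtain q where q: "exponent D (Suc k) = enat q"
      by (cases "exponent D (Suc k)") auto
    \<comment> \<open>In \<open>G\<close>, criterion (1) says that z commutes with its own power z^q
      = \<pi>(z).\<close>
    have "?z [^]\<^bsub>H m\<^esub> q \<otimes>\<^bsub>H m\<^esub> ?z = ?z \<otimes>\<^bsub>H m\<^esub> ?z [^]\<^bsub>H m\<^esub> q"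
      using z by (metis G.nat_pow_Suc G.nat_pow_Suc2)
    then show "?\<delta> (sub_elem D k (power_word D (Suc k))) = sub_elem D k (power_word D (Suc k))"
      using power[OF q] z by - (rule inj, simp_all add: conj closed G.m_assoc)
  qed
  moreover have "criterion2 D k"
    unfolding criterion2_def
  proof (intro ballI impI)
    fix i assume i: "i \<in> {1..k}" "exponent D i < \<infinity>"
    then obtain q where q: "exponent D i = enat q"
      by (cases "exponent D i") auto
    have "power_word D i = normal_word k (power_exp D i)"
      using i k by (intro power_word_eq) auto
    then have "sub_elem D k (power_word D i) = x k i [^]\<^bsub>H k\<^esub> q"
      using relation_power[OF i(1) q] k by (simp add: sub_elem_normal_word)
    then show "?\<delta> (sub_elem D k (power_word D i)) = ?\<delta> (x k i) [^]\<^bsub>H k\<^esub> the_enat (exponent D i)"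
      using q x_closed[OF i(1)] by (simp add: \<delta>.hom_nat_pow)
  qed
  moreover have "criterion3 D k"
    unfolding criterion3_def
  proof (intro impI ballI)
    fix i assume "exponent D (Suc k) < \<infinity>" and i: "i \<in> {1..k}"
    then obtain q where q: "exponent D (Suc k) = enat q"
      by (cases "exponent D (Suc k)") auto
    \<comment> \<open>The n-th iterate of \<delta>(z) is conjugation by z^n; for n = q this power is
      \<pi>(z).\<close>
    have iterate: "(?\<delta> ^^ n) (x k i) \<in> carrier (H k) \<and>
      \<iota> ((?\<delta> ^^ n) (x k i)) = inv\<^bsub>H m\<^esub> (?z [^]\<^bsub>H m\<^esub> n) \<otimes>\<^bsub>H m\<^esub> \<iota> (x k i) \<otimes>\<^bsub>H m\<^esub> ?z [^]\<^bsub>H m\<^esub> n" for n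
    proof (induction n)
      case (Suc n)
      then show ?case
        using z x_closed[OF i] by (simp add: conj closed G.m_assoc G.inv_mult_group)
    qed (use x_closed[OF i] in simp)
    let ?c = "sub_elem D k (power_word D (Suc k))"
    have "(?\<delta> ^^ q) (x k i) = inv\<^bsub>H k\<^esub> ?c \<otimes>\<^bsub>H k\<^esub> x k i \<otimes>\<^bsub>H k\<^esub> ?c"
      using iterate[of q] power[OF q] x_closed[OF i] by - (rule inj, simp_all)
    then show "(?\<delta> ^^ the_enat (exponent D (Suc k))) (x k i) = conj_by (H k) (x k i) ?c"
      using q by (simp add: conj_by_def)
  qed
  moreover have "criterion4 D k"
    unfolding criterion4_def conj_by_def using x_closed by simp
  ultimately show ?thesis
    by blast
qed

text \<open>As k ends the layer of l, conjugation by later layers is absent. So l occurs on a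
  right-hand side only when x_l itself is conjugated by a letter of its own layer, and there with
  exponent 1. The power relation of l changes the exponent sum by n(l), a multiple of q.\<close>

lemma exponent_sum_relation:
  assumes s: "s \<in> layers" and l: "l \<in> layer D s" and k: "k = Max (layer D s)"
    and q: "\<And>n. exponent D l = enat n \<Longrightarrow> q dvd int n"
    and uv: "(u, v) \<in> sub_relations D k"
  shows "[exponent_sum l u = exponent_sum l v] (mod q)"
proof -
  have fin: "finite (layer D s)"
    using layer_subset[OF s] finite_subset by blast
  have k: "k \<in> layer D s"
    unfolding k using fin l by (intro Max_in) auto
  have lm: "l \<in> {1..m}" "k \<in> {1..m}"
    using layer_subset[OF s] l k by auto
  consider (power) i where "i \<in> {1..k}" "exponent D i < \<infinity>"
      "u = replicate (the_enat (exponent D i)) (i, True)" "v = power_word D i"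
    | (conj) i j where "i \<in> {1..k}" "j \<in> {1..k}" "i < j"
      "u = [(j, False), (i, True), (j, True)]" "v = conj_word D i j"
    using uv by (auto simp: sub_relations_def)
  then show ?thesis
  proof cases
    case (power i)
    then obtain n where n: "exponent D i = enat n"
      by (cases "exponent D i") auto
    have im: "i \<in> {1..m}"
      using power(1) lm by auto
    then obtain t where t: "t \<in> layers" "i \<in> layer D t"
      by (rule obtain_layer)
    have "t \<le> s"
      using layer_le[OF t(1) s t(2) k] power(1) by auto
    then have "power_exp D i l = 0"
      using power_exp_support[OF t power(2) lm(1)] lower_iff[OF t(1) s l] by auto
    moreover have "i = l \<longrightarrow> q dvd int n"
      using q n by auto
    ultimately show ?thesis
      using power(3,4) n lm
      by (simp add: exponent_sum_replicate power_word_def exponent_sum_normal_word cong_0_iff)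
  next
    case (conj i j)
    have ij: "i \<in> {1..m}" "j \<in> {1..m}"
      using conj(1,2) lm by auto
    obtain t where t: "t \<in> layers" "i \<in> layer D t"
      using obtain_layer[OF ij(1)] by blast
    obtain t' where t': "t' \<in> layers" "j \<in> layer D t'"
      using obtain_layer[OF ij(2)] by blast
    have le: "t \<le> t'" "t' \<le> s"
      using layer_le[OF t(1) t'(1) t(2) t'(2)] layer_le[OF t'(1) s t'(2) k] conj by auto
    have "conj_exp D i j l = (if i = l then 1 else 0)"
    proof (cases "t = s")
      case True
      then have "t' = s"
        using le by simp
      then show ?thesis
        using conj_exp_same_layer[OF s _ _ conj(3)] t t' \<open>t = s\<close> lm lower_iff[OF s s l] by fastforce
    next
      case False
      then have "l \<notin> lower_layers D t \<union> layer D t"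
        using lower_iff[OF t(1) s l] le layer_unique[OF t(1) s _ l] by auto
      then show ?thesis
        using conj_exp_support[OF t ij(2) conj(3) lm(1)] t(2) by auto
    qed
    then show ?thesis
      using conj(4,5) lm by (simp add: conj_word_def exponent_sum_normal_word)
  qed
qed

text \<open>Hence the exponent sum of l induces a homomorphism from this particular
  \<open>H k\<close> to the integers modulo q.\<close>

lemma exponent_sum_cong:
  assumes "word_eq {1..k} (sub_relations D k) u v" "s \<in> layers" "l \<in> layer D s"
    and "k = Max (layer D s)" "\<And>n. exponent D l = enat n \<Longrightarrow> q dvd int n"
  shows "[exponent_sum l u = exponent_sum l v] (mod q)"
  using assms(1)
proof induction
  case (relation u v)
  then show ?case
    using exponent_sum_relation[OF assms(2-)] by blast
qed (auto intro: cong_sym cong_trans cong_add)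

text \<open>Substitution acts on vectors of exponent sums by a matrix, of which \<open>a\<close> is
  the column for l. Writing the hypothesis as a sum over \<open>T\<close> makes letters of
  \<open>W\<close> outside \<open>T\<close> contribute 0.\<close>

lemma exponent_sum_substitute_word:
  assumes "finite T" "\<And>i. i \<in> W \<Longrightarrow> exponent_sum l (\<sigma> i) = (\<Sum>j\<in>T. (if i = j then a j else 0))"
    and "w \<in> words W"
  shows "exponent_sum l (substitute_word \<sigma> w) = (\<Sum>j\<in>T. exponent_sum j w * a j)"
  using assms(3)
proof (induction w)
  case (Cons c w)
  have "exponent_sum l (substitute_word \<sigma> (c # w))
      = (\<Sum>j\<in>T. (if snd c then 1 else - 1) * (if fst c = j then a j else 0)) +
        (\<Sum>j\<in>T. exponent_sum j w * a j)"
    using Cons assms(2) by (simp add: sum_negf sum_distrib_left[symmetric])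
  then show ?case
    by (simp only: sum.distrib[symmetric] exponent_sum.simps)
      (auto intro!: sum.cong simp: algebra_simps)
qed simp

lemma section_det_det_on: "section_det D z T = det_on T (\<lambda>i l. conj_exp D i z l)"
  by (simp add: section_det_def det_on_def)

text \<open>
  Conjugation by \<open>z\<close> maps the subgroup generated by \<open>W\<close> onto itself, by the maximal condition;
  writing the generators in \<open>T\<close> as images and comparing exponent sums gives a left inverse of
  the matrix modulo \<open>q\<close>.
\<close>

lemma consistent_imp_section_det_unit:
  assumes cons: "consistent D (Max (layer D s))" "consistent D m"
    and s: "s \<in> layers" "s < t" and z: "t \<in> layers" "z \<in> layer D t"
    and T: "T \<subseteq> layer D s" "T \<subseteq> W" and W: "W \<subseteq> lower_layers D s \<union> layer D s"
    and q: "\<And>l n. l \<in> T \<Longrightarrow> exponent D l = enat n \<Longrightarrow> q dvd int n"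
    and closed: "\<And>i l. \<lbrakk>i \<in> W; l \<in> {1..m}; conj_exp D i z l \<noteq> 0\<rbrakk> \<Longrightarrow> l \<in> W"
    and zero: "\<And>i l. \<lbrakk>i \<in> W; i \<notin> T; l \<in> T\<rbrakk> \<Longrightarrow> conj_exp D i z l = 0"
  shows "\<exists>d. [d * section_det D z T = 1] (mod q)"
proof -
  define k where "k = Max (layer D s)"
  interpret G: group "H m"
    by (rule group_H)
  have fin: "finite (layer D s)"
    using layer_subset[OF s(1)] finite_subset by blast
  have k: "k \<in> layer D s"
    unfolding k_def using fin layers_nonempty s(1) by (intro Max_in) auto
  have zm: "z \<in> {1..m}" and km: "k \<in> {1..m}"
    using layer_subset[OF z(1)] z(2) layer_subset[OF s(1)] k by auto
  have Wk: "W \<subseteq> {1..k}"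
  proof
    fix i assume i: "i \<in> W"
    then have "i \<le> k"
      using W fin lower_less[OF s(1) _ k, of i] unfolding k_def by force
    moreover have "1 \<le> i"
      using i W lower_subset[OF s(1)] layer_subset[OF s(1)] by force
    ultimately show "i \<in> {1..k}"
      by simp
  qed
  have Wm: "W \<subseteq> {1..m}"
    using Wk km by auto
  have Wz: "i < z" if "i \<in> W" for i
    using that Wk layer_less[OF s(1) z(1) s(2) k z(2)] by auto
  have x: "x m \<in> W \<rightarrow> carrier (H m)"
    using Wm x_closed by blast
  have xz: "x m z \<in> carrier (H m)"
    using zm by (rule x_closed)
  define \<sigma> where "\<sigma> i = normal_word m (conj_exp D i z)" for i
  have \<sigma>: "\<sigma> i \<in> words W" if "i \<in> W" for i
    unfolding \<sigma>_def using closed[OF that] by (intro normal_word_words)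
  have conj: "inv\<^bsub>H m\<^esub> x m z \<otimes>\<^bsub>H m\<^esub> word_eval (H m) (x m) w \<otimes>\<^bsub>H m\<^esub> x m z
      = word_eval (H m) (x m) (substitute_word \<sigma> w)" if w: "w \<in> words W" for w
  proof -
    have "inv\<^bsub>H m\<^esub> x m z \<otimes>\<^bsub>H m\<^esub> word_eval (H m) (x m) w \<otimes>\<^bsub>H m\<^esub> x m z
        = word_eval (H m) (\<lambda>i. inv\<^bsub>H m\<^esub> x m z \<otimes>\<^bsub>H m\<^esub> x m i \<otimes>\<^bsub>H m\<^esub> x m z) w"
      by (rule G.word_eval_hom[OF G.conj_hom[OF xz] group_H x w])
    also have "\<dots> = word_eval (H m) (\<lambda>i. word_eval (H m) (x m) (\<sigma> i)) w"
    proof (rule word_eval_cong[OF w])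
      fix i assume "i \<in> W"
      then show "inv\<^bsub>H m\<^esub> x m z \<otimes>\<^bsub>H m\<^esub> x m i \<otimes>\<^bsub>H m\<^esub> x m z = word_eval (H m) (x m) (\<sigma> i)"
        unfolding \<sigma>_def G.word_eval_normal_word[OF x_funcset]
        using Wm Wz zm by (intro relation_conj) auto
    qed
    also have "\<dots> = word_eval (H m) (x m) (substitute_word \<sigma> w)"
      by (rule G.word_eval_substitute_word[OF x \<sigma> w, symmetric])
    finally show ?thesis .
  qed
  define U where "U = word_eval (H m) (x m) ` words W"
  have U: "subgroup U (H m)"
    unfolding U_def by (rule G.subgroup_word_eval_image[OF x])
  have "x m z \<in> normalizing (H m) U"
  proof (rule G.max_condition_conj_stable[OF _ U xz])
    show "max_condition_on (H m) (carrier (H m))"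
      using cons(2) by (intro G.polycyclic_max_condition) (simp add: consistent_def)
    fix u assume "u \<in> U"
    then obtain w where w: "w \<in> words W" "u = word_eval (H m) (x m) w"
      by (auto simp: U_def)
    show "inv\<^bsub>H m\<^esub> x m z \<otimes>\<^bsub>H m\<^esub> u \<otimes>\<^bsub>H m\<^esub> x m z \<in> U"
      unfolding w(2) conj[OF w(1)] U_def by (rule imageI substitute_word_words[OF \<sigma> w(1)])+
  qed
  then have preimage: "\<exists>w\<in>words W. x m z \<otimes>\<^bsub>H m\<^esub> x m i \<otimes>\<^bsub>H m\<^esub> inv\<^bsub>H m\<^esub> x m z = word_eval (H m) (x m) w"
    if "i \<in> W" for i
  proof -
    have "x m i \<in> carrier (H m)"
      using that x by auto
    then have "x m i \<in> U"
      unfolding U_def using that by (intro image_eqI[of _ _ "[(i, True)]"]) auto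
    then have "x m z \<otimes>\<^bsub>H m\<^esub> x m i \<otimes>\<^bsub>H m\<^esub> inv\<^bsub>H m\<^esub> x m z \<in> U"
      using \<open>x m z \<in> normalizing (H m) U\<close> by (simp add: normalizing_def)
    then show ?thesis
      unfolding U_def by blast
  qed
  then obtain w where w: "\<And>i. i \<in> W \<Longrightarrow> w i \<in> words W"
    "\<And>i. i \<in> W \<Longrightarrow> x m z \<otimes>\<^bsub>H m\<^esub> x m i \<otimes>\<^bsub>H m\<^esub> inv\<^bsub>H m\<^esub> x m z = word_eval (H m) (x m) (w i)"
    by metis
  have gen_eq: "x m i = word_eval (H m) (x m) (substitute_word \<sigma> (w i))" if i: "i \<in> W" for i
  proof -
    have "x m i \<in> carrier (H m)"
      using i x by auto
    then have "x m i = inv\<^bsub>H m\<^esub> x m z \<otimes>\<^bsub>H m\<^esub>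
        (x m z \<otimes>\<^bsub>H m\<^esub> x m i \<otimes>\<^bsub>H m\<^esub> inv\<^bsub>H m\<^esub> x m z) \<otimes>\<^bsub>H m\<^esub> x m z"
      using xz by (simp add: G.m_assoc)
    then show ?thesis
      unfolding w(2)[OF i] conj[OF w(1)[OF i]] .
  qed
  obtain \<iota> where \<iota>: "\<iota> \<in> hom (H k) (H m)" "inj_on \<iota> (carrier (H k))"
    "\<And>i. i \<in> {1..k} \<Longrightarrow> \<iota> (x k i) = x m i"
    using embedding[OF cons(1,2)] km unfolding k_def by auto
  have \<iota>_word: "\<iota> (sub_elem D k w) = word_eval (H m) (x m) w" if w: "w \<in> words {1..k}" for w
  proof -
    have "\<iota> (sub_elem D k w) = word_eval (H m) (\<lambda>i. \<iota> (x k i)) w"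
      unfolding sub_elem_eq[OF w] by (rule group.word_eval_hom[OF group_H \<iota>(1) group_H x_funcset w])
    then show ?thesis
      using word_eval_cong[OF w \<iota>(3)] by simp
  qed
  \<comment> \<open>In \<open>G\<close> the exponent sum of l need not be invariant, since later
    layers may act nontrivially. The identity is therefore pulled back to \<open>H k\<close> through
    the embedding.\<close>
  have eq: "word_eq {1..k} (sub_relations D k) [(i, True)] (substitute_word \<sigma> (w i))" if i: "i \<in> W" for i
  proof -
    have words: "[(i, True)] \<in> words {1..k}" "substitute_word \<sigma> (w i) \<in> words {1..k}"
      using i Wk substitute_word_words[OF \<sigma> w(1)[OF i]] words_mono[OF Wk] by auto
    have "x m i \<in> carrier (H m)"
      using i x by auto
    then have "\<iota> (sub_elem D k [(i, True)]) = \<iota> (sub_elem D k (substitute_word \<sigma> (w i)))"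
      unfolding \<iota>_word[OF words(1)] \<iota>_word[OF words(2)] gen_eq[OF i, symmetric] by simp
    then have "sub_elem D k [(i, True)] = sub_elem D k (substitute_word \<sigma> (w i))"
      using inj_onD[OF \<iota>(2)] sub_elem_closed words by blast
    then show ?thesis
      using words by (simp add: sub_elem_eq_iff)
  qed
  have finT: "finite T"
    using T(1) fin finite_subset by blast
  \<comment> \<open>The exponent sums of \<open>w i\<close> form the row for i of the left
    inverse.\<close>
  have "[(\<Sum>j\<in>T. exponent_sum j (w i) * conj_exp D j z l) = (if i = l then 1 else 0)] (mod q)"
    if il: "i \<in> T" "l \<in> T" for i l
  proof -
    have lm: "l \<in> {1..m}"
      using il T Wm by auto
    have "exponent_sum l (\<sigma> j) = (\<Sum>j'\<in>T. (if j = j' then conj_exp D j' z l else 0))" if "j \<in> W" for j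
      using that zero[OF that _ il(2)] finT lm by (simp add: \<sigma>_def exponent_sum_normal_word)
    then have "exponent_sum l (substitute_word \<sigma> (w i)) = (\<Sum>j\<in>T. exponent_sum j (w i) * conj_exp D j z l)"
      using il T(2) w(1) by (intro exponent_sum_substitute_word[OF finT, of W]) auto
    moreover have "[exponent_sum l (substitute_word \<sigma> (w i)) = exponent_sum l [(i, True)]] (mod q)"
      using il T q by (intro cong_sym[OF exponent_sum_cong[OF eq s(1) _ k_def]]) auto
    moreover have "exponent_sum l [(i, True)] = (if i = l then 1 else 0)"
      by simp
    ultimately show ?thesis
      by (simp only:)
  qed
  then show ?thesis
    unfolding section_det_det_on by (intro det_unit_mod[OF finT])
qed

lemma consistent_imp_criterion5:
  assumes cons: "consistent D m" "\<And>j. j \<le> k \<Longrightarrow> consistent D j" and k: "k < m"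
  shows "criterion5 D k"
proof -
  have zm: "Suc k \<in> {1..m}"
    using k by simp
  then obtain t where t: "t \<in> layers" "Suc k \<in> layer D t"
    by (rule obtain_layer)
  show ?thesis
    unfolding criterion5_def layer_index_eq[OF t]
  proof (intro ballI conjI allI impI)
    fix s assume "s \<in> {1..<t}"
    then have s: "s \<in> layers" "s < t"
      using t(1) by auto
    have "finite (layer D s)"
      using layer_subset[OF s(1)] finite_subset by blast
    then have "Max (layer D s) \<in> layer D s"
      using layers_nonempty s(1) by (intro Max_in) auto
    then have "Max (layer D s) \<le> k"
      using layer_less[OF s(1) t(1) s(2) _ t(2)] by fastforce
    then have cons_s: "consistent D (Max (layer D s))"
      by (rule cons(2))
    have lower: "l \<in> lower_layers D s"
      if il: "i \<in> lower_layers D s" "l \<in> {1..m}" "conj_exp D i (Suc k) l \<noteq> 0" for i l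
    proof -
      obtain s' where s': "s' \<in> layers" "s' < s" "i \<in> layer D s'"
        by (rule lower_layersE[OF il(1) s(1)])
      have "i < Suc k"
        using layer_less[OF s'(1) t(1) _ s'(3) t(2)] s'(2) s(2) by simp
      then have "l \<in> lower_layers D s' \<union> layer D s'"
        using conj_exp_support[OF s'(1,3) zm _ il(2,3)] by simp
      moreover have "lower_layers D s' \<subseteq> lower_layers D s"
        using s'(2) unfolding lower_layers_def by (intro UN_mono) auto
      moreover have "layer D s' \<subseteq> lower_layers D s"
        using s' by (auto simp: lower_layers_def)
      ultimately show ?thesis
        by blast
    qed
    have disjoint: "i \<notin> lower_layers D s" if "i \<in> layer D s" for i
      using lower_iff[OF s(1,1) that] by simp
    {
      fix p :: nat assume p: "prime p"
      \<comment> \<open>The modulus p is admissible because it divides every n(x) with x in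
        X_s(p).\<close>
      have "\<exists>d. [d * section_det D (Suc k) (torsion_part D s p) = 1] (mod int p)"
      proof (rule consistent_imp_section_det_unit[OF cons_s cons(1) s t,
            where W = "lower_layers D s \<union> torsion_part D s p"])
        fix l n assume l: "l \<in> torsion_part D s p" "exponent D l = enat n"
        obtain e where "1 \<le> e" "exponent D l = enat (p ^ e)"
          using exponent_torsion[OF s(1) p l(1)] by blast
        then have "n = p ^ e" "0 < e"
          using l(2) by auto
        then show "int p dvd int n"
          by (simp add: dvd_power)
      next
        show "l \<in> lower_layers D s \<union> torsion_part D s p"
          if "i \<in> lower_layers D s \<union> torsion_part D s p" "l \<in> {1..m}" "conj_exp D i (Suc k) l \<noteq> 0" for i l
          using that lower conj_exp_torsion[OF s(1) t(1) s(2) p _ t(2) that(2,3)] by blast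
        show "conj_exp D i (Suc k) l = 0"
          if "i \<in> lower_layers D s \<union> torsion_part D s p" "i \<notin> torsion_part D s p" "l \<in> torsion_part D s p" for i l
          using that lower[of i l] torsion_subset[OF s(1) p] disjoint layer_subset[OF s(1)] by blast
      qed (use torsion_subset[OF s(1) p] in auto)
      then obtain d where d: "[d * section_det D (Suc k) (torsion_part D s p) = 1] (mod int p)"
        by blast
      show "\<not> [section_det D (Suc k) (torsion_part D s p) = 0] (mod int p)"
      proof
        assume "[section_det D (Suc k) (torsion_part D s p) = 0] (mod int p)"
        then have "[d * section_det D (Suc k) (torsion_part D s p) = d * 0] (mod int p)"
          by (intro cong_mult cong_refl)
        then have "[1 = 0] (mod int p)"
          using d by (metis cong_sym cong_trans mult_zero_right)
        then show False
          using prime_gt_1_nat[OF p] by (simp add: cong_0_iff)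
      qed
    }
    \<comment> \<open>Modulus 0 means equality of integers and is admissible because the letters of
      \<open>T\<close> have infinite exponent. \<open>W\<close> contains the whole layer, since
      \<delta>(x, z) for a free letter x may involve torsion letters; the rows of torsion letters
      vanish in the free columns.\<close>
    have "\<exists>d. [d * section_det D (Suc k) (free_part D s) = 1] (mod 0)"
    proof (rule consistent_imp_section_det_unit[OF cons_s cons(1) s t,
          where W = "lower_layers D s \<union> layer D s"])
      show "0 dvd int n" if "l \<in> free_part D s" "exponent D l = enat n" for l n
        using exponent_free[OF s(1) that(1)] that(2) by simp
      show "l \<in> lower_layers D s \<union> layer D s"
        if "i \<in> lower_layers D s \<union> layer D s" "l \<in> {1..m}" "conj_exp D i (Suc k) l \<noteq> 0" for i l
        using that lower conj_exp_support[OF s(1) _ zm _ that(2,3)] layer_less[OF s(1) t(1) s(2) _ t(2)] by blast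
      show "conj_exp D i (Suc k) l = 0"
        if il: "i \<in> lower_layers D s \<union> layer D s" "i \<notin> free_part D s" "l \<in> free_part D s" for i l
      proof (rule ccontr)
        assume nonzero: "conj_exp D i (Suc k) l \<noteq> 0"
        have l: "l \<in> layer D s" "l \<in> {1..m}"
          using il(3) free_subset[OF s(1)] layer_subset[OF s(1)] by auto
        then have "i \<in> layer D s"
          using il(1) lower[OF _ l(2) nonzero] disjoint by blast
        then obtain p where p: "prime p" "i \<in> torsion_part D s p"
          using il(2) by (cases rule: layer_cases[OF s(1)]) auto
        have "l \<in> lower_layers D s \<union> torsion_part D s p"
          by (rule conj_exp_torsion[OF s(1) t(1) s(2) p t(2) l(2) nonzero])
        then show False
          using disjoint[OF l(1)] torsion_free_disjoint[OF s(1) p(1)] il(3) by blast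
      qed
    qed (use free_subset[OF s(1)] in auto)
    then obtain d where "d * section_det D (Suc k) (free_part D s) = 1"
      by auto
    then show "section_det D (Suc k) (free_part D s) \<in> {1, - 1}"
      by (metis insertCI pos_zmult_eq_1_iff_lemma mult.commute)
  qed
qed

end

section \<open>Sufficiency of the criteria\<close>

context group
begin

text \<open>Comparing powers, rather than bases and exponents separately, lets the exponents differ
  at a factor whose base is trivial.\<close>

lemma descending_prod_cong_pow:
  "(\<And>i. i \<in> {1..k} \<Longrightarrow> g i [^] d i = h i [^] e i) \<Longrightarrow>
    descending_prod G g d k = descending_prod G h e k" for d e :: "nat \<Rightarrow> int"
  by (induction k) auto

lemma subgroup_centralizer:
  assumes a: "a \<in> carrier G"
  shows "subgroup {y \<in> carrier G. a \<otimes> y = y \<otimes> a} G"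
proof
  fix y z assume yz: "y \<in> {y \<in> carrier G. a \<otimes> y = y \<otimes> a}" "z \<in> {y \<in> carrier G. a \<otimes> y = y \<otimes> a}"
  then have "a \<otimes> (y \<otimes> z) = y \<otimes> a \<otimes> z"
    using a by (simp add: m_assoc[symmetric])
  also have "\<dots> = y \<otimes> z \<otimes> a"
    using yz a by (simp add: m_assoc)
  finally show "y \<otimes> z \<in> {y \<in> carrier G. a \<otimes> y = y \<otimes> a}"
    using yz by simp
next
  fix y assume y: "y \<in> {y \<in> carrier G. a \<otimes> y = y \<otimes> a}"
  then have yc: "y \<in> carrier G" and eq: "a \<otimes> y = y \<otimes> a"
    by auto
  have "a \<otimes> inv y = inv y \<otimes> (y \<otimes> a) \<otimes> inv y"
    using a yc by (simp add: m_assoc)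
  also have "\<dots> = inv y \<otimes> (a \<otimes> y) \<otimes> inv y"
    by (simp only: eq)
  also have "\<dots> = inv y \<otimes> a"
    using yc a by (simp add: m_assoc)
  finally show "inv y \<in> {y \<in> carrier G. a \<otimes> y = y \<otimes> a}"
    using y by simp
qed (use a in auto)

lemma descending_prod_add:
  assumes "g \<in> {1..k} \<rightarrow> carrier G"
    and "\<And>i j. i \<in> {1..k} \<Longrightarrow> j \<in> {1..k} \<Longrightarrow> g i \<otimes> g j = g j \<otimes> g i"
  shows "descending_prod G g (\<lambda>i. d i + e i) k = descending_prod G g d k \<otimes> descending_prod G g e k"
  using assms
proof (induction k)
  case (Suc k)
  have g: "g \<in> {1..k} \<rightarrow> carrier G" "g (Suc k) \<in> carrier G"
    using Suc.prems(1) by auto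
  let ?a = "g (Suc k)"
  let ?D = "descending_prod G g d k" and ?E = "descending_prod G g e k"
  \<comment> \<open>Centralizers are used twice: \<open>?a\<close> commutes with every base in
    \<open>?D\<close> and so with \<open>?D\<close>; therefore \<open>?D\<close> commutes with every
    power of \<open>?a\<close>.\<close>
  have "?D \<in> {y \<in> carrier G. ?a \<otimes> y = y \<otimes> ?a}"
    using Suc.prems g by (intro descending_prod_in_subgroup[OF subgroup_centralizer]) auto
  then have "?a \<in> {y \<in> carrier G. ?D \<otimes> y = y \<otimes> ?D}"
    using g by auto
  then have "?a [^] e (Suc k) \<in> {y \<in> carrier G. ?D \<otimes> y = y \<otimes> ?D}"
    using g by (intro subgroup_int_pow_closed subgroup_centralizer) auto
  then have comm: "?D \<otimes> ?a [^] e (Suc k) = ?a [^] e (Suc k) \<otimes> ?D"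
    by simp
  have "descending_prod G g (\<lambda>i. d i + e i) (Suc k)
      = (?a [^] d (Suc k) \<otimes> ?a [^] e (Suc k)) \<otimes> (?D \<otimes> ?E)"
    using Suc.IH[OF g(1)] Suc.prems(2) g by (simp add: int_pow_mult)
  also have "\<dots> = ?a [^] d (Suc k) \<otimes> (?a [^] e (Suc k) \<otimes> ?D) \<otimes> ?E"
    using g by (simp add: m_assoc)
  also have "\<dots> = (?a [^] d (Suc k) \<otimes> ?D) \<otimes> (?a [^] e (Suc k) \<otimes> ?E)"
    unfolding comm[symmetric] using g by (simp add: m_assoc)
  finally show ?case
    by simp
qed simp

lemma subgroup_cyclic_product:
  assumes B: "subgroup B G" and z: "z \<in> normalizing G B"
  shows "subgroup {z [^] n \<otimes> b | (n::int) b. b \<in> B} G"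
proof -
  interpret B: subgroup B G
    by fact
  have [simp]: "z \<in> carrier G"
    using z by (simp add: normalizing_def)
  have pow: "z [^] n \<in> normalizing G B" for n :: int
    using z by (intro subgroup_int_pow_closed subgroup_normalizing B.subset)
  show ?thesis
  proof
    show "{z [^] n \<otimes> b | (n::int) b. b \<in> B} \<subseteq> carrier G"
      by auto
    show "\<one> \<in> {z [^] n \<otimes> b | (n::int) b. b \<in> B}"
      by (intro CollectI exI[of _ 0] exI[of _ \<one>]) auto
  next
    fix g h assume "g \<in> {z [^] n \<otimes> b | (n::int) b. b \<in> B}" "h \<in> {z [^] n \<otimes> b | (n::int) b. b \<in> B}"
    then obtain i j :: int and b c where gh: "g = z [^] i \<otimes> b" "h = z [^] j \<otimes> c" "b \<in> B" "c \<in> B"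
      by blast
    have "inv (z [^] j) \<otimes> b \<otimes> z [^] j \<in> B"
      using pow[of j] gh(3) by (simp add: normalizing_def)
    moreover have "g \<otimes> h = z [^] (i + j) \<otimes> ((inv (z [^] j) \<otimes> b \<otimes> z [^] j) \<otimes> c)"
      using gh by (simp add: int_pow_mult m_assoc)
    ultimately show "g \<otimes> h \<in> {z [^] n \<otimes> b | (n::int) b. b \<in> B}"
      using gh(4) by blast
  next
    fix g assume "g \<in> {z [^] n \<otimes> b | (n::int) b. b \<in> B}"
    then obtain i :: int and b where g: "g = z [^] i \<otimes> b" "b \<in> B"
      by blast
    have "z [^] i \<otimes> inv b \<otimes> inv (z [^] i) \<in> B"
      using pow[of i] g(2) by (simp add: normalizing_def)
    moreover have "inv g = z [^] (- i) \<otimes> (z [^] i \<otimes> inv b \<otimes> inv (z [^] i))"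
      using g by (simp add: int_pow_neg m_assoc inv_mult_group)
    ultimately show "inv g \<in> {z [^] n \<otimes> b | (n::int) b. b \<in> B}"
      by blast
  qed
qed

text \<open>It suffices to conjugate the generators of the subgroup in one direction; the maximal
  condition supplies the other direction.\<close>

lemma normalizing_word_eval_image:
  assumes f: "f \<in> S \<rightarrow> carrier G" and max: "max_condition_on G (carrier G)" and z: "z \<in> carrier G"
    and conj: "\<And>i. i \<in> S \<Longrightarrow> inv z \<otimes> f i \<otimes> z \<in> word_eval G f ` words S"
  shows "z \<in> normalizing G (word_eval G f ` words S)"
proof (rule max_condition_conj_stable[OF max subgroup_word_eval_image[OF f] z])
  fix u assume "u \<in> word_eval G f ` words S"
  then obtain w where w: "w \<in> words S" "u = word_eval G f w"
    by blast
  show "inv z \<otimes> u \<otimes> z \<in> word_eval G f ` words S"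
    unfolding w(2) word_eval_hom[OF conj_hom[OF z] is_group f w(1)]
    by (rule word_eval_in_subgroup[OF subgroup_word_eval_image[OF f] conj w(1)])
qed

lemma word_eval_image_gen:
  "f \<in> S \<rightarrow> carrier G \<Longrightarrow> i \<in> S \<Longrightarrow> f i \<in> word_eval G f ` words S"
  by (intro image_eqI[of _ _ "[(i, True)]"]) (auto simp: Pi_iff)

end

section \<open>From the criteria to an automorphism \<delta>(z), and to the next group\<close>

context presentation
begin

lemma delta_map_descending_prod:
  assumes "consistent D k" "k < m" "\<And>i. i \<in> {1..k} \<Longrightarrow> e i \<in> exp_range D i"
  shows "delta_map D k (descending_prod (H k) (x k) e k)
    = descending_prod (H k) (\<lambda>i. delta_map D k (x k i)) e k"
proof -
  have "sub_elem D k (conj_word D i (Suc k)) = delta_map D k (x k i)" if "i \<in> {1..k}" for i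
    using that assms(2) delta_map_gen[OF assms(1) that assms(2)]
    by (subst conj_word_eq[where k = k]) (auto simp: sub_elem_normal_word)
  moreover have "delta_map D k (descending_prod (H k) (x k) e k)
      = descending_prod (H k) (\<lambda>i. sub_elem D k (conj_word D i (Suc k))) e k"
    using assms(1,3) by (rule delta_map_normal_form)
  moreover have "descending_prod (H k) (\<lambda>i. sub_elem D k (conj_word D i (Suc k))) e k
      = descending_prod (H k) (\<lambda>i. delta_map D k (x k i)) e k"
    using calculation(1) by (intro descending_prod_cong) auto
  ultimately show ?thesis
    by (simp only:)
qed

text \<open>The words \<pi>(x) and \<delta>(x, y) have admissible exponents, so they are normal
  forms and \<delta>(z) acts on them letter by letter. This turns (2) and (4) into the relations of
  \<open>H k\<close> for the images of the generators.\<close>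

lemma criteria_imp_delta_map_hom:
  assumes cons: "consistent D k" and k: "k < m" and crit: "criterion2 D k" "criterion4 D k"
  shows "delta_map D k \<in> hom (H k) (H k)"
proof -
  interpret K: group "H k"
    by (rule group_H)
  let ?\<delta> = "delta_map D k"
  have gens: "(\<lambda>i. ?\<delta> (x k i)) \<in> {1..k} \<rightarrow> carrier (H k)"
    using delta_map_closed[OF cons k] x_closed by auto
  obtain \<phi> where \<phi>: "\<phi> \<in> hom (H k) (H k)" "\<And>i. i \<in> {1..k} \<Longrightarrow> \<phi> (x k i) = ?\<delta> (x k i)"
  proof (rule universal_property[OF group_H gens])
    fix i n assume i: "i \<in> {1..k}" "exponent D i = enat n"
    obtain s where s: "s \<in> layers" "i \<in> layer D s"
      using obtain_layer[of i] i(1) k by auto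
    have "power_word D i = normal_word k (power_exp D i)"
      using i k by (intro power_word_eq) auto
    then have "?\<delta> (x k i) [^]\<^bsub>H k\<^esub> n = ?\<delta> (descending_prod (H k) (x k) (power_exp D i) k)"
      using crit(1)[unfolded criterion2_def, rule_format, OF i(1)] i(2) by (simp add: sub_elem_normal_word)
    also have "\<dots> = descending_prod (H k) (\<lambda>i. ?\<delta> (x k i)) (power_exp D i) k"
      using k i power_exp_range[OF s] by (intro delta_map_descending_prod[OF cons k]) auto
    finally show "?\<delta> (x k i) [^]\<^bsub>H k\<^esub> n = descending_prod (H k) (\<lambda>i. ?\<delta> (x k i)) (power_exp D i) k" .
  next
    fix i j assume ij: "i \<in> {1..k}" "j \<in> {1..k}" "i < j"
    have "conj_by (H k) (?\<delta> (x k i)) (?\<delta> (x k j)) = ?\<delta> (conj_by (H k) (x k i) (x k j))"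
      using crit(2) ij by (simp add: criterion4_def)
    also have "conj_by (H k) (x k i) (x k j) = descending_prod (H k) (x k) (conj_exp D i j) k"
      unfolding conj_by_def using ij k by (intro relation_conj) auto
    also have "?\<delta> \<dots> = descending_prod (H k) (\<lambda>i. ?\<delta> (x k i)) (conj_exp D i j) k"
      using k ij by (intro delta_map_descending_prod[OF cons k] conj_exp_range) auto
    finally show "inv\<^bsub>H k\<^esub> ?\<delta> (x k j) \<otimes>\<^bsub>H k\<^esub> ?\<delta> (x k i) \<otimes>\<^bsub>H k\<^esub> ?\<delta> (x k j)
        = descending_prod (H k) (\<lambda>i. ?\<delta> (x k i)) (conj_exp D i j) k"
      by (simp add: conj_by_def)
  qed (use k in auto)
  \<comment> \<open>\<delta>(z) is defined through normal forms, and there it agrees with every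
    homomorphism that has the same values on generators.\<close>
  have "\<phi> g = ?\<delta> g" if g: "g \<in> carrier (H k)" for g
  proof -
    obtain r where r: "r \<in> (\<Pi>\<^sub>E i\<in>{1..k}. exp_range D i)" "g = descending_prod (H k) (x k) r k"
      using cons g by (rule normal_form_exists)
    have "\<phi> g = descending_prod (H k) (\<lambda>i. \<phi> (x k i)) r k"
      unfolding r(2) by (rule K.descending_prod_hom[OF \<phi>(1) group_H x_funcset])
    also have "\<dots> = descending_prod (H k) (\<lambda>i. ?\<delta> (x k i)) r k"
      using \<phi>(2) by (intro descending_prod_cong) auto
    also have "\<dots> = ?\<delta> g"
      unfolding r(2) using r(1) by (intro delta_map_descending_prod[OF cons k, symmetric]) auto
    finally show ?thesis .
  qed
  then show ?thesis
    using \<phi>(1) by (auto simp: hom_def Pi_iff)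
qed

definition lower_subgroup :: "nat \<Rightarrow> nat \<Rightarrow> nat word set set" where
  "lower_subgroup k s = word_eval (H k) (x k) ` words (lower_layers D s \<inter> {1..k})"

lemma lower_gen_mem:
  "i \<in> lower_layers D s \<Longrightarrow> i \<in> {1..k} \<Longrightarrow> x k i \<in> lower_subgroup k s"
  unfolding lower_subgroup_def using x_closed
  by (intro group.word_eval_image_gen[OF group_H]) auto

lemma subgroup_lower_subgroup: "subgroup (lower_subgroup k s) (H k)"
  unfolding lower_subgroup_def using x_closed
  by (intro group.subgroup_word_eval_image[OF group_H]) auto

text \<open>The relations give x^y only for x before y. Otherwise y is in the layer of x or below,
  hence in the subgroup itself. Conjugation by the inverse of y is handled by the maximal condition,
  which consistency of \<open>H k\<close> provides.\<close>

lemma normal_lower_subgroup: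
  assumes cons: "consistent D k" and k: "k \<le> m" and s: "s \<in> layers"
  shows "lower_subgroup k s \<lhd> H k"
proof -
  interpret K: group "H k"
    by (rule group_H)
  let ?N = "lower_subgroup k s"
  let ?W = "lower_layers D s \<inter> {1..k}"
  have N: "subgroup ?N (H k)"
    by (rule subgroup_lower_subgroup)
  have x: "x k \<in> ?W \<rightarrow> carrier (H k)"
    using x_closed by auto
  have max: "max_condition_on (H k) (carrier (H k))"
    using cons by (intro K.polycyclic_max_condition) (simp add: consistent_def)
  have "x k j \<in> normalizing (H k) ?N" if j: "j \<in> {1..k}" for j
    unfolding lower_subgroup_def
  proof (rule K.normalizing_word_eval_image[OF x max x_closed[OF j]], fold lower_subgroup_def)
    fix i assume i: "i \<in> ?W"
    obtain t where t: "t \<in> layers" "t < s" "i \<in> layer D t"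
      using i s by (auto elim: lower_layersE)
    have xi: "x k i \<in> ?N"
      using i by (intro lower_gen_mem) auto
    show "inv\<^bsub>H k\<^esub> x k j \<otimes>\<^bsub>H k\<^esub> x k i \<otimes>\<^bsub>H k\<^esub> x k j \<in> ?N"
    proof (cases "i < j")
      case True
      have "l \<in> lower_layers D s" if "l \<in> {1..k}" "conj_exp D i j l \<noteq> 0" for l
      proof -
        have "l \<in> lower_layers D t \<union> layer D t"
          using that j k True by (intro conj_exp_support[OF t(1,3)]) auto
        moreover have "lower_layers D t \<subseteq> lower_layers D s"
          using t(2) unfolding lower_layers_def by (intro UN_mono) auto
        moreover have "layer D t \<subseteq> lower_layers D s"
          using t by (auto simp: lower_layers_def)
        ultimately show ?thesis
          by blast
      qed
      then have "descending_prod (H k) (x k) (conj_exp D i j) k \<in> ?N"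
        using x_closed lower_gen_mem by (intro K.descending_prod_in_subgroup[OF N]) auto
      then show ?thesis
        using relation_conj[of i k j] i j True k by auto
    next
      case False
      obtain t' where t': "t' \<in> layers" "j \<in> layer D t'"
        using obtain_layer[of j] j k by auto
      have "t' \<le> t"
        using layer_le[OF t'(1) t(1) t'(2) t(3)] False by simp
      then have "j \<in> lower_layers D s"
        using lower_iff[OF s t'] t(2) by simp
      then have "x k j \<in> ?N"
        using j by (rule lower_gen_mem)
      then show ?thesis
        using xi N by (intro subgroup.m_closed subgroup.m_inv_closed)
    qed
  qed
  then have "normalizing (H k) ?N = carrier (H k)"
    using subgroup.subset[OF N] by (intro subgroup_top K.subgroup_normalizing)
  then show ?thesis
    using N by (intro K.normalI_normalizing) auto
qed

text \<open>
  Modulo \<open>N = \<langle>X\<^sub>1 \<union> \<dots> \<union> X\<^bsub>s-1\<^esub>\<rangle>\<close> the generators in \<open>X\<^sub>s\<close> commute. The exponent vectors whose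
  products lie in the image of \<open>\<delta>(z)\<close> modulo \<open>N\<close> form a lattice containing the rows of the matrix,
  hence, by Cramer's rule, the multiples of the unit vectors by the determinant.
\<close>

lemma layer_generators_in_image:
  assumes cons: "consistent D k" and k: "k < m" and hom: "delta_map D k \<in> hom (H k) (H k)"
    and s: "s \<in> layers" "s < t" and t: "t \<in> layers" "Suc k \<in> layer D t"
    and lower: "\<And>i. i \<in> lower_layers D s \<Longrightarrow> x k i \<in> delta_map D k ` carrier (H k)"
    and det_torsion: "\<And>p. prime p \<Longrightarrow> \<not> [section_det D (Suc k) (torsion_part D s p) = 0] (mod int p)"
    and det_free: "section_det D (Suc k) (free_part D s) \<in> {1, - 1}"
    and i: "i \<in> layer D s"
  shows "x k i \<in> delta_map D k ` carrier (H k)"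
proof -
  interpret K: group "H k"
    by (rule group_H)
  let ?\<delta> = "delta_map D k"
  interpret \<delta>: group_hom "H k" "H k" ?\<delta>
    using hom by (simp add: group_hom_def group_hom_axioms_def group_H)
  define I where "I = ?\<delta> ` carrier (H k)"
  have I: "subgroup I (H k)"
    unfolding I_def by (rule \<delta>.img_is_subgroup)
  have layer_k: "layer D s \<subseteq> {1..k}"
  proof
    fix j assume j: "j \<in> layer D s"
    then have "j < Suc k"
      using layer_less[OF s(1) t(1) s(2) _ t(2)] by blast
    then show "j \<in> {1..k}"
      using layer_subset[OF s(1)] j by auto
  qed
  have lower_k: "lower_layers D s \<subseteq> {1..k}"
  proof
    fix j assume j: "j \<in> lower_layers D s"
    then have "j < i"
      using lower_less s(1) i by blast
    moreover have "1 \<le> j"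
      using j lower_subset[OF s(1)] by auto
    ultimately show "j \<in> {1..k}"
      using layer_k i by auto
  qed
  define N where "N = lower_subgroup k s"
  have "N \<lhd> H k"
    unfolding N_def using cons k s(1) by (intro normal_lower_subgroup) auto
  then interpret N: normal N "H k" .
  have NI: "N \<subseteq> I"
    unfolding N_def lower_subgroup_def
  proof (intro image_subsetI K.word_eval_in_subgroup[OF I])
    show "x k j \<in> I" if "j \<in> lower_layers D s \<inter> {1..k}" for j
      using that lower unfolding I_def by blast
  qed
  define Q where "Q = H k Mod N"
  define \<eta> where "\<eta> g = N #>\<^bsub>H k\<^esub> g" for g
  interpret Q: group Q
    unfolding Q_def by (rule N.factorgroup_is_group)
  interpret \<eta>: group_hom "H k" Q \<eta>
    using N.r_coset_hom_Mod unfolding \<eta>_def Q_def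
    by (simp add: group_hom_def group_hom_axioms_def group_H N.factorgroup_is_group)
  have \<eta>_one: "\<eta> g = \<one>\<^bsub>Q\<^esub>" if "g \<in> N" for g
    using that N.subgroup_axioms by (simp add: \<eta>_def Q_def K.coset_join2 N.mem_carrier)
  have \<eta>_I: "g \<in> I" if g: "\<eta> g \<in> \<eta> ` I" "g \<in> carrier (H k)" for g
  proof -
    obtain h where h: "h \<in> I" "\<eta> g = \<eta> h"
      using g(1) by blast
    have "g \<in> N #>\<^bsub>H k\<^esub> h"
      using K.rcos_self[OF g(2) N.subgroup_axioms] h(2) by (simp add: \<eta>_def)
    then obtain n where "n \<in> N" "g = n \<otimes>\<^bsub>H k\<^esub> h"
      by (auto simp: r_coset_def)
    then show ?thesis
      using NI h(1) I by (auto intro: subgroup.m_closed)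
  qed
  have \<eta>I: "subgroup (\<eta> ` I) Q"
    by (rule \<eta>.subgroup_img_is_subgroup[OF I])
  \<comment> \<open>Letters outside X_s are replaced by 1. Then all \<open>y j\<close> commute, and
    \<open>P v\<close> depends only on the values of v on X_s.\<close>
  define y where "y j = (if j \<in> layer D s then \<eta> (x k j) else \<one>\<^bsub>Q\<^esub>)" for j
  have y: "y \<in> {1..k} \<rightarrow> carrier Q"
    using x_closed by (auto simp: y_def)
  define P where "P v = descending_prod Q y v k" for v
  have P_closed: "P v \<in> carrier Q" for v
    unfolding P_def by (rule Q.descending_prod_closed[OF y])
  have P_cong: "P v = P w" if "\<And>l. l \<in> layer D s \<Longrightarrow> v l = w l" for v w
    unfolding P_def using that by (intro Q.descending_prod_cong_pow) (auto simp: y_def)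
  have P_eta: "\<eta> (descending_prod (H k) (x k) v k) = P v"
    if "\<And>l. l \<in> {1..k} \<Longrightarrow> v l \<noteq> 0 \<Longrightarrow> l \<in> lower_layers D s \<union> layer D s" for v
  proof -
    have "\<eta> (descending_prod (H k) (x k) v k) = descending_prod Q (\<lambda>i. \<eta> (x k i)) v k"
      by (rule K.descending_prod_hom[OF \<eta>.homh Q.is_group x_funcset])
    also have "\<dots> = P v"
      unfolding P_def
    proof (rule Q.descending_prod_cong_pow)
      fix l assume l: "l \<in> {1..k}"
      show "\<eta> (x k l) [^]\<^bsub>Q\<^esub> v l = y l [^]\<^bsub>Q\<^esub> v l"
      proof (cases "v l = 0 \<or> l \<in> layer D s")
        case False
        then have "l \<in> lower_layers D s"
          using that l by blast
        then have "\<eta> (x k l) = \<one>\<^bsub>Q\<^esub>"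
          using l by (intro \<eta>_one) (simp add: N_def lower_gen_mem)
        then show ?thesis
          using False by (simp add: y_def)
      qed (auto simp: y_def)
    qed
    finally show ?thesis .
  qed
  have P_single: "P (\<lambda>l. if l = j then a else 0) = \<eta> (x k j) [^]\<^bsub>Q\<^esub> a" if "j \<in> layer D s" for j a
    unfolding P_def using Q.descending_prod_single[OF y, of j a] that layer_k by (auto simp: y_def)
  \<comment> \<open>Within one layer, conjugating x_a by x_b changes it only by lower letters, that
    is, by an element of \<open>N\<close>.\<close>
  have comm_less: "\<eta> (x k a) \<otimes>\<^bsub>Q\<^esub> \<eta> (x k b) = \<eta> (x k b) \<otimes>\<^bsub>Q\<^esub> \<eta> (x k a)"
    if ab: "a \<in> layer D s" "b \<in> layer D s" "a < b" for a b
  proof -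
    have abk: "a \<in> {1..k}" "b \<in> {1..k}"
      using ab layer_k by auto
    have [simp]: "x k a \<in> carrier (H k)" "x k b \<in> carrier (H k)"
      using x_closed abk by auto
    have support: "l \<in> lower_layers D s \<union> {a}" if "l \<in> {1..k}" "conj_exp D a b l \<noteq> 0" for l
      using conj_exp_same_layer(2)[OF s(1) ab _ that(2)] that(1) k by auto
    have "\<eta> (inv\<^bsub>H k\<^esub> x k b \<otimes>\<^bsub>H k\<^esub> x k a \<otimes>\<^bsub>H k\<^esub> x k b) = P (conj_exp D a b)"
      using relation_conj[OF abk ab(3)] k support ab(1) by (subst P_eta[symmetric]) auto
    also have "\<dots> = P (\<lambda>l. if l = a then 1 else 0)"
    proof (rule P_cong)
      fix l assume l: "l \<in> layer D s"
      then have "l \<notin> lower_layers D s"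
        using lower_iff[OF s(1,1)] by simp
      then show "conj_exp D a b l = (if l = a then 1 else 0)"
        using support[OF subsetD[OF layer_k l]] conj_exp_same_layer(1)[OF s(1) ab] by auto
    qed
    also have "\<dots> = \<eta> (x k a)"
      using P_single[OF ab(1), of 1] by (simp add: Q.int_pow_1)
    finally have "inv\<^bsub>Q\<^esub> \<eta> (x k b) \<otimes>\<^bsub>Q\<^esub> \<eta> (x k a) \<otimes>\<^bsub>Q\<^esub> \<eta> (x k b) = \<eta> (x k a)"
      by simp
    then have "\<eta> (x k b) \<otimes>\<^bsub>Q\<^esub> (inv\<^bsub>Q\<^esub> \<eta> (x k b) \<otimes>\<^bsub>Q\<^esub> \<eta> (x k a) \<otimes>\<^bsub>Q\<^esub> \<eta> (x k b))
        = \<eta> (x k b) \<otimes>\<^bsub>Q\<^esub> \<eta> (x k a)"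
      by (rule arg_cong)
    then show ?thesis
      by (simp add: Q.m_assoc)
  qed
  have comm: "y a \<otimes>\<^bsub>Q\<^esub> y b = y b \<otimes>\<^bsub>Q\<^esub> y a" if "a \<in> {1..k}" "b \<in> {1..k}" for a b
    using comm_less[of a b] comm_less[of b a] that x_closed
    by (cases a b rule: linorder_cases) (auto simp: y_def)
  have P_add: "P (\<lambda>l. v l + w l) = P v \<otimes>\<^bsub>Q\<^esub> P w" for v w
    unfolding P_def by (rule Q.descending_prod_add[OF y comm])
  define M where "M = {v. P v \<in> \<eta> ` I}"
  have P_zero: "P (\<lambda>_. 0) = \<one>\<^bsub>Q\<^esub>"
    using P_single[OF i, of 0] by (simp cong: if_cong)
  have M_zero: "(\<lambda>_. 0) \<in> M"
    using P_zero subgroup.one_closed[OF \<eta>I] by (simp add: M_def)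
  have M_diff: "(\<lambda>l. v l - w l) \<in> M" if "v \<in> M" "w \<in> M" for v w
  proof -
    have "P v = P (\<lambda>l. v l - w l) \<otimes>\<^bsub>Q\<^esub> P w"
      using P_add[of "\<lambda>l. v l - w l" w] by simp
    then have "P (\<lambda>l. v l - w l) = P v \<otimes>\<^bsub>Q\<^esub> inv\<^bsub>Q\<^esub> P w"
      using P_closed by (simp add: Q.m_assoc)
    then show ?thesis
      using that \<eta>I by (simp add: M_def subgroup.m_closed subgroup.m_inv_closed)
  qed
  have M_add: "(\<lambda>l. v l + w l) \<in> M" if "v \<in> M" "w \<in> M" for v w
    by (rule int_lattice_closed(1)[OF M_zero _ that]) (rule M_diff)
  have M_mult: "(\<lambda>l. a * v l) \<in> M" if "v \<in> M" for a v
    by (rule int_lattice_closed(2)[OF M_zero _ that]) (rule M_diff)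
  have M_sum: "(\<lambda>l. \<Sum>j\<in>S. v j l) \<in> M" if "finite S" "\<And>j. j \<in> S \<Longrightarrow> v j \<in> M" for S v
    by (rule int_lattice_closed(3)[OF M_zero _ that(1)]) (rule M_diff, assumption+, rule that(2))
  have M_unit: "x k j \<in> I" if "j \<in> layer D s" "(\<lambda>l. if l = j then 1 else 0) \<in> M" for j
    using that P_single[OF that(1), of 1] x_closed layer_k
    by (intro \<eta>_I) (auto simp: M_def Q.int_pow_1)
  have unit_M: "(\<lambda>l. if l = j then a else 0) \<in> M" if j: "j \<in> layer D s" "x k j \<in> I" for j a
  proof -
    have "\<eta> (x k j) [^]\<^bsub>Q\<^esub> a \<in> \<eta> ` I"
      using j by (intro Q.subgroup_int_pow_closed[OF \<eta>I]) auto
    then show ?thesis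
      using P_single[OF j(1)] by (simp add: M_def)
  qed
  have row: "conj_exp D j (Suc k) \<in> M" if j: "j \<in> layer D s" for j
  proof -
    have jk: "j \<in> {1..k}"
      using j layer_k by blast
    have "\<eta> (?\<delta> (x k j)) = P (conj_exp D j (Suc k))"
      unfolding delta_map_gen[OF cons jk k]
      using k jk by (intro P_eta conj_exp_support[OF s(1) j]) auto
    moreover have "?\<delta> (x k j) \<in> I"
      using x_closed[OF jk] by (simp add: I_def)
    ultimately show ?thesis
      by (auto simp: M_def)
  qed
  have M_cong: "w \<in> M" if "v \<in> M" "\<And>l. l \<in> layer D s \<Longrightarrow> v l = w l" for v w
    using that P_cong[of v w] by (simp add: M_def)
  have fin: "finite (layer D s)"
    using layer_k finite_subset by blast
  have not_lower: "l \<notin> lower_layers D s" if "l \<in> layer D s" for l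
    using lower_iff[OF s(1,1) that] by simp
  \<comment> \<open>Two multiples of the unit vector at j lie in the lattice: the one by the
    determinant, and the one by p^e, because x_j^(p^e) = \<pi>(x_j) lies in \<open>N\<close>. The
    determinant is prime to p, so Bezout's identity yields the unit vector itself.\<close>
  have torsion_I: "x k j \<in> I" if p: "prime p" and j: "j \<in> torsion_part D s p" for p j
  proof -
    let ?T = "torsion_part D s p"
    let ?d = "section_det D (Suc k) ?T"
    have T: "?T \<subseteq> layer D s"
      by (rule torsion_subset[OF s(1) p])
    have det: "(\<lambda>l. if l = j then ?d else 0) \<in> M"
      unfolding section_det_det_on
    proof (rule det_mem_lattice[OF M_zero M_diff _ _ j])
      show "finite ?T"
        using T fin finite_subset by blast
      fix a assume a: "a \<in> ?T"
      show "(\<lambda>l. if l \<in> ?T then conj_exp D a (Suc k) l else 0) \<in> M"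
      proof (rule M_cong[OF row])
        show "a \<in> layer D s"
          using a T by blast
        fix l assume l: "l \<in> layer D s"
        then have "l \<in> {1..m}"
          using layer_subset[OF s(1)] by blast
        then show "conj_exp D a (Suc k) l = (if l \<in> ?T then conj_exp D a (Suc k) l else 0)"
          using conj_exp_torsion[OF s(1) t(1) s(2) p a t(2)] not_lower[OF l] by auto
      qed
    qed
    obtain e where e: "1 \<le> e" "exponent D j = enat (p ^ e)"
      using exponent_torsion[OF s(1) p j] by blast
    have jl: "j \<in> layer D s" "j \<in> {1..k}"
      using j T layer_k by auto
    have "\<eta> (x k j) [^]\<^bsub>Q\<^esub> (p ^ e) = \<eta> (x k j [^]\<^bsub>H k\<^esub> (p ^ e))"
      using x_closed[OF jl(2)] by (simp add: \<eta>.hom_nat_pow)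
    also have "x k j [^]\<^bsub>H k\<^esub> (p ^ e) = descending_prod (H k) (x k) (power_exp D j) k"
      using jl e k by (intro relation_power) auto
    also have "\<eta> \<dots> = \<one>\<^bsub>Q\<^esub>"
    proof (rule \<eta>_one, unfold N_def, rule K.descending_prod_in_subgroup[OF subgroup_lower_subgroup x_closed])
      fix l assume "l \<in> {1..k}" "power_exp D j l \<noteq> 0"
      then show "x k l \<in> lower_subgroup k s"
        using power_exp_support[OF s(1) jl(1)] e(2) k by (intro lower_gen_mem) auto
    qed
    finally have order: "\<eta> (x k j) [^]\<^bsub>Q\<^esub> (int (p ^ e) * a) = \<one>\<^bsub>Q\<^esub>" for a
      using x_closed[OF jl(2)] Q.int_pow_pow[of "\<eta> (x k j)" "int (p ^ e)" a]
      by (simp add: int_pow_int del: of_nat_power)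
    have "coprime ?d (int (p ^ e))"
      using det_torsion[OF p] p by (auto simp: cong_0_iff coprime_commute prime_imp_coprime_int
          intro!: coprime_power_right_iff[THEN iffD2])
    then obtain d where "[?d * d = 1] (mod int (p ^ e))"
      using cong_solve_coprime_int by blast
    then obtain a where a: "1 = d * ?d + int (p ^ e) * a"
      by (metis cong_iff_lin mult.commute)
    have "(\<lambda>l. d * (if l = j then ?d else 0)) \<in> M"
      using det by (rule M_mult)
    moreover have "(\<lambda>l. if l = j then int (p ^ e) * a else 0) \<in> M"
      using P_single[OF jl(1)] order subgroup.one_closed[OF \<eta>I] by (simp add: M_def)
    ultimately have "(\<lambda>l. d * (if l = j then ?d else 0) + (if l = j then int (p ^ e) * a else 0)) \<in> M"
      by (rule M_add)
    also have "(\<lambda>l. d * (if l = j then ?d else 0) + (if l = j then int (p ^ e) * a else 0))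
        = (\<lambda>l. if l = j then 1 else 0)"
      using a by auto
    finally show ?thesis
      using jl(1) by (intro M_unit)
  qed
  have "x k i \<in> I"
    using s(1) i
  proof (cases rule: layer_cases)
    case (torsion p)
    then show ?thesis
      by (rule torsion_I)
  next
    case free: free
    let ?T = "free_part D s"
    let ?d = "section_det D (Suc k) ?T"
    have T: "?T \<subseteq> layer D s"
      by (rule free_subset[OF s(1)])
    have det: "(\<lambda>l. if l = i then ?d else 0) \<in> M"
      unfolding section_det_det_on
    proof (rule det_mem_lattice[OF M_zero M_diff _ _ free])
      show "finite ?T"
        using T fin finite_subset by blast
      fix a assume a: "a \<in> ?T"
      let ?v = "conj_exp D a (Suc k)"
      let ?S = "layer D s - ?T"
      \<comment> \<open>The row of a free letter may have entries at torsion letters. The unit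
        vectors there are already in the lattice, so these entries can be subtracted; for this
        reason the torsion parts come first.\<close>
      have "(\<lambda>l. \<Sum>j\<in>?S. if l = j then ?v j else 0) \<in> M"
      proof (rule M_sum)
        fix j assume j: "j \<in> ?S"
        then obtain p where "prime p" "j \<in> torsion_part D s p"
          by (cases rule: layer_cases[OF s(1)]) auto
        then show "(\<lambda>l. if l = j then ?v j else 0) \<in> M"
          using j torsion_I by (intro unit_M) auto
      qed (use fin in auto)
      moreover have "?v \<in> M"
        using a T by (intro row) auto
      ultimately have "(\<lambda>l. ?v l - (\<Sum>j\<in>?S. if l = j then ?v j else 0)) \<in> M"
        using M_diff by blast
      then show "(\<lambda>l. if l \<in> ?T then ?v l else 0) \<in> M"
        by (rule M_cong) (use fin in \<open>auto simp: sum.delta\<close>)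
    qed
    \<comment> \<open>The determinant is 1 or -1, hence its own inverse.\<close>
    have "(\<lambda>l. ?d * (if l = i then ?d else 0)) \<in> M"
      using det by (rule M_mult)
    also have "(\<lambda>l. ?d * (if l = i then ?d else 0)) = (\<lambda>l. if l = i then 1 else 0)"
      using det_free by auto
    finally show ?thesis
      using i by (intro M_unit)
  qed
  then show ?thesis
    by (simp add: I_def)
qed

text \<open>Induction over the layers from the bottom. Below the layer of z this is the determinant
  argument; in the layer of z the exponents of \<delta>(x, z) make \<delta>(z) fix each generator
  modulo lower layers, which are already in the image.\<close>

lemma criteria_imp_delta_map_surj:
  assumes cons: "consistent D k" and k: "k < m" and hom: "delta_map D k \<in> hom (H k) (H k)"
    and crit: "criterion5 D k"
  shows "delta_map D k ` carrier (H k) = carrier (H k)"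
proof -
  interpret K: group "H k"
    by (rule group_H)
  let ?\<delta> = "delta_map D k"
  interpret \<delta>: group_hom "H k" "H k" ?\<delta>
    using hom by (simp add: group_hom_def group_hom_axioms_def group_H)
  define I where "I = ?\<delta> ` carrier (H k)"
  have I: "subgroup I (H k)"
    unfolding I_def by (rule \<delta>.img_is_subgroup)
  obtain t where t: "t \<in> layers" "Suc k \<in> layer D t"
    using obtain_layer[of "Suc k"] k by auto
  have "x k i \<in> I" if "s \<in> layers" "s \<le> t" "i \<in> layer D s" "i \<in> {1..k}" for s i
    using that
  proof (induction s arbitrary: i rule: less_induct)
    case (less s)
    have lower: "x k j \<in> I" if j: "j \<in> lower_layers D s" for j
    proof -
      obtain s' where s': "s' \<in> layers" "s' < s" "j \<in> layer D s'"
        by (rule lower_layersE[OF j less.prems(1)])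
      have "j < i"
        using lower_less[OF less.prems(1) j less.prems(3)] .
      moreover have "1 \<le> j"
        using layer_subset[OF s'(1)] s'(3) by auto
      ultimately show ?thesis
        using less.IH[OF s'(2,1) _ s'(3)] less.prems s'(2) by auto
    qed
    show ?case
    proof (cases "s < t")
      case True
      have "s \<in> {1..<layer_index D (Suc k)}"
        using less.prems(1) True layer_index_eq[OF t] by simp
      then show ?thesis
        using crit lower unfolding I_def criterion5_def
        by (intro layer_generators_in_image[OF cons k hom less.prems(1) True t _ _ _ less.prems(3)]) blast+
    next
      case False
      then have it: "i \<in> layer D t"
        using less.prems by auto
      define N where "N = lower_subgroup k t"
      have "N \<lhd> H k"
        unfolding N_def using cons k t(1) by (intro normal_lower_subgroup) auto
      then interpret N: normal N "H k" .
      define Q where "Q = H k Mod N"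
      define \<eta> where "\<eta> g = N #>\<^bsub>H k\<^esub> g" for g
      interpret Q: group Q
        unfolding Q_def by (rule N.factorgroup_is_group)
      interpret \<eta>: group_hom "H k" Q \<eta>
        using N.r_coset_hom_Mod unfolding \<eta>_def Q_def
        by (simp add: group_hom_def group_hom_axioms_def group_H N.factorgroup_is_group)
      have NI: "N \<subseteq> I"
        unfolding N_def lower_subgroup_def
      proof (intro image_subsetI K.word_eval_in_subgroup[OF I])
        show "x k j \<in> I" if "j \<in> lower_layers D t \<inter> {1..k}" for j
          using that lower False less.prems(2) by auto
      qed
      have xi: "x k i \<in> carrier (H k)"
        using less.prems(4) by (rule x_closed)
      have \<eta>x: "(\<lambda>l. \<eta> (x k l)) \<in> {1..k} \<rightarrow> carrier Q"
        using x_closed by auto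
      have "\<eta> (?\<delta> (x k i)) = descending_prod Q (\<lambda>l. \<eta> (x k l)) (conj_exp D i (Suc k)) k"
        unfolding delta_map_gen[OF cons less.prems(4) k]
        by (rule K.descending_prod_hom[OF \<eta>.homh Q.is_group x_funcset])
      also have "\<dots> = descending_prod Q (\<lambda>l. \<eta> (x k l)) (\<lambda>l. if l = i then 1 else 0) k"
      proof (rule Q.descending_prod_cong_pow)
        fix l assume l: "l \<in> {1..k}"
        have i_less: "i < Suc k"
          using less.prems(4) by simp
        consider "l = i" | "l \<noteq> i" "conj_exp D i (Suc k) l = 0" | "l \<in> lower_layers D t"
          using conj_exp_same_layer(2)[OF t(1) it t(2) i_less, of l] l k by auto
        then show "\<eta> (x k l) [^]\<^bsub>Q\<^esub> conj_exp D i (Suc k) l = \<eta> (x k l) [^]\<^bsub>Q\<^esub> (if l = i then 1 else 0 :: int)"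
        proof cases
          case 1
          then show ?thesis
            using conj_exp_same_layer(1)[OF t(1) it t(2) i_less] by simp
        next
          case 3
          then have "x k l \<in> N"
            using l by (simp add: N_def lower_gen_mem)
          then have "\<eta> (x k l) = \<one>\<^bsub>Q\<^esub>"
            using N.subgroup_axioms by (simp add: \<eta>_def Q_def K.coset_join2 N.mem_carrier)
          then show ?thesis
            by simp
        qed simp
      qed
      also have "\<dots> = \<eta> (x k i)"
        using Q.descending_prod_single[OF \<eta>x less.prems(4), of 1] xi by (simp add: Q.int_pow_1)
      finally have eq: "\<eta> (?\<delta> (x k i)) = \<eta> (x k i)" .
      have "x k i \<in> N #>\<^bsub>H k\<^esub> ?\<delta> (x k i)"
        using K.rcos_self[OF xi N.subgroup_axioms] eq by (simp add: \<eta>_def)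
      then obtain n where "n \<in> N" "x k i = n \<otimes>\<^bsub>H k\<^esub> ?\<delta> (x k i)"
        by (auto simp: r_coset_def)
      moreover have "?\<delta> (x k i) \<in> I"
        using xi by (simp add: I_def)
      ultimately show ?thesis
        using NI subgroup.m_closed[OF I] by (metis subsetD)
    qed
  qed
  moreover have "\<exists>s\<in>layers. s \<le> t \<and> i \<in> layer D s" if i: "i \<in> {1..k}" for i
  proof -
    obtain s where s: "s \<in> layers" "i \<in> layer D s"
      using obtain_layer[of i] i k by auto
    then show ?thesis
      using layer_le[OF s(1) t(1) s(2) t(2)] i by auto
  qed
  ultimately show ?thesis
    using I unfolding I_def by (intro subgroup_top) blast+
qed

text \<open>Uniqueness is read off in the abstract extension, whereas existence of normal forms and
  polycyclicity are shown inside \<open>H (Suc k)\<close>, as the product of the powers of z with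
  the image of \<open>H k\<close>, which z normalizes.\<close>

theorem criteria_imp_consistent_Suc:
  assumes cons: "consistent D k" and k: "k < m"
    and crit: "criterion1 D k" "criterion2 D k" "criterion3 D k" "criterion4 D k" "criterion5 D k"
  shows "consistent D (Suc k)"
proof -
  interpret K: group "H k"
    by (rule group_H)
  interpret G: group "H (Suc k)"
    by (rule group_H)
  let ?\<delta> = "delta_map D k"
  let ?z = "x (Suc k) (Suc k)"
  have \<delta>_hom: "?\<delta> \<in> hom (H k) (H k)"
    using cons k crit(2,4) by (rule criteria_imp_delta_map_hom)
  then interpret \<delta>: group_hom "H k" "H k" ?\<delta>
    by (simp add: group_hom_def group_hom_axioms_def group_H)
  have surj: "?\<delta> ` carrier (H k) = carrier (H k)"
    using cons k \<delta>_hom crit(5) by (rule criteria_imp_delta_map_surj)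
  have "max_condition_on (H k) (carrier (H k))"
    using cons by (intro K.polycyclic_max_condition) (simp add: consistent_def)
  then have "inj_on ?\<delta> (carrier (H k))"
    using \<delta>_hom surj by (rule K.max_condition_Hopfian)
  then have \<delta>_iso: "?\<delta> \<in> iso (H k) (H k)"
    using \<delta>_hom surj by (simp add: iso_def bij_betw_def)
  \<comment> \<open>n(z) = \<infinity> is encoded as q = 0 and c = 1, the convention of
    \<open>cyclic_extension_data\<close>.\<close>
  define q where "q = (case exponent D (Suc k) of enat n \<Rightarrow> n | \<infinity> \<Rightarrow> 0)"
  define c where "c = (case exponent D (Suc k) of
    enat n \<Rightarrow> descending_prod (H k) (x k) (power_exp D (Suc k)) k | \<infinity> \<Rightarrow> \<one>\<^bsub>H k\<^esub>)"
  have c: "c \<in> carrier (H k)"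
    by (auto simp: c_def K.descending_prod_closed[OF x_funcset] split: enat.split)
  have q_pos: "0 < n" if "exponent D (Suc k) = enat n" for n
    using exp_range_0[of "Suc k"] that k by (auto simp: exp_range_def)
  have c_power_word: "c = sub_elem D k (power_word D (Suc k))" if "exponent D (Suc k) = enat n" for n
    using that k power_word_eq[of "Suc k" k] by (simp add: c_def sub_elem_normal_word)
  have ext: "cyclic_extension_data (H k) ?\<delta> q c"
  proof
    show "?\<delta> c = c"
      using crit(1) c_power_word by (cases "exponent D (Suc k)") (auto simp: criterion1_def c_def)
    show "c = \<one>\<^bsub>H k\<^esub>" if "q = 0"
      using that q_pos by (cases "exponent D (Suc k)") (auto simp: c_def q_def)
    fix g assume g: "g \<in> carrier (H k)"
    show "(?\<delta> ^^ q) g = inv\<^bsub>H k\<^esub> c \<otimes>\<^bsub>H k\<^esub> g \<otimes>\<^bsub>H k\<^esub> c"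
    proof (cases "exponent D (Suc k)")
      case (enat n)
      \<comment> \<open>(3) speaks of generators only; both sides are homomorphisms, so it extends
        to all of \<open>H k\<close>.\<close>
      have "(?\<delta> ^^ q) (x k i) = inv\<^bsub>H k\<^esub> c \<otimes>\<^bsub>H k\<^esub> x k i \<otimes>\<^bsub>H k\<^esub> c" if "i \<in> {1..k}" for i
        using crit(3) that enat c_power_word[OF enat]
        by (simp add: criterion3_def conj_by_def q_def)
      then show ?thesis
        using hom_eqI[OF group_H K.funpow_hom[OF \<delta>_hom] K.conj_hom[OF c] _ g] by blast
    next
      case infinity
      then show ?thesis
        using g by (simp add: q_def c_def)
    qed
  qed (use \<delta>_iso c in auto)
  obtain E :: "(int \<times> nat word set) set monoid" and \<iota> \<zeta> where E: "group E" "\<iota> \<in> hom (H k) E" "\<zeta> \<in> carrier E"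
    and conj_E: "\<And>g. g \<in> carrier (H k) \<Longrightarrow> inv\<^bsub>E\<^esub> \<zeta> \<otimes>\<^bsub>E\<^esub> \<iota> g \<otimes>\<^bsub>E\<^esub> \<zeta> = \<iota> (?\<delta> g)"
    and power_E: "\<zeta> [^]\<^bsub>E\<^esub> q = \<iota> c"
    and unique_E: "\<And>(a::int) b g h. \<lbrakk>g \<in> carrier (H k); h \<in> carrier (H k); q = 0 \<or> \<bar>a - b\<bar> < int q;
      \<zeta> [^]\<^bsub>E\<^esub> a \<otimes>\<^bsub>E\<^esub> \<iota> g = \<zeta> [^]\<^bsub>E\<^esub> b \<otimes>\<^bsub>E\<^esub> \<iota> h\<rbrakk> \<Longrightarrow> a = b \<and> g = h"
    by (rule cyclic_extension_data.cyclic_extension_exists[OF ext]) (rule that; assumption)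
  interpret E: group E
    by fact
  interpret \<iota>: group_hom "H k" E \<iota>
    using E by (simp add: group_hom_def group_hom_axioms_def group_H)
  define f where "f i = (if i = Suc k then \<zeta> else \<iota> (x k i))" for i
  have f: "f \<in> {1..Suc k} \<rightarrow> carrier E"
    using E(3) x_closed by (auto simp: f_def le_Suc_eq)
  have f_prod: "descending_prod E f e (Suc k)
      = \<zeta> [^]\<^bsub>E\<^esub> e (Suc k) \<otimes>\<^bsub>E\<^esub> \<iota> (descending_prod (H k) (x k) e k)" for e
  proof -
    have "descending_prod E f e k = descending_prod E (\<lambda>i. \<iota> (x k i)) e k"
      by (intro descending_prod_cong) (auto simp: f_def)
    also have "\<dots> = \<iota> (descending_prod (H k) (x k) e k)"
      by (rule K.descending_prod_hom[OF \<iota>.homh E(1) x_funcset, symmetric])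
    finally show ?thesis
      by (simp add: f_def)
  qed
  have f_prod_0: "descending_prod E f e (Suc k) = \<iota> (descending_prod (H k) (x k) e k)"
    if "e (Suc k) = 0" for e
    unfolding f_prod using that K.descending_prod_closed[OF x_funcset] by simp
  obtain \<psi> where \<psi>: "\<psi> \<in> hom (H (Suc k)) E" "\<And>i. i \<in> {1..Suc k} \<Longrightarrow> \<psi> (x (Suc k) i) = f i"
  proof (rule universal_property[OF E(1) f])
    fix i n assume i: "i \<in> {1..Suc k}" "exponent D i = enat n"
    have "power_exp D i (Suc k) = 0"
      using i k by (intro power_exp_zero) auto
    then have eq: "descending_prod E f (power_exp D i) (Suc k) = \<iota> (descending_prod (H k) (x k) (power_exp D i) k)"
      by (rule f_prod_0)
    show "f i [^]\<^bsub>E\<^esub> n = descending_prod E f (power_exp D i) (Suc k)"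
    proof (cases "i = Suc k")
      case True
      then show ?thesis
        using i power_E unfolding eq by (simp add: f_def q_def c_def)
    next
      case False
      then have "i \<in> {1..k}"
        using i by auto
      then show ?thesis
        using relation_power[of i k n] i k x_closed False unfolding eq
        by (simp add: f_def \<iota>.hom_nat_pow[symmetric])
    qed
  next
    fix i j assume ij: "i \<in> {1..Suc k}" "j \<in> {1..Suc k}" "i < j"
    then have ik: "i \<in> {1..k}" "i \<noteq> Suc k"
      by auto
    then have xi: "x k i \<in> carrier (H k)"
      by (intro x_closed)
    have "conj_exp D i j (Suc k) = 0"
      using ij k by (intro conj_exp_zero) auto
    then have eq: "descending_prod E f (conj_exp D i j) (Suc k) = \<iota> (descending_prod (H k) (x k) (conj_exp D i j) k)"
      by (rule f_prod_0)
    show "inv\<^bsub>E\<^esub> f j \<otimes>\<^bsub>E\<^esub> f i \<otimes>\<^bsub>E\<^esub> f j = descending_prod E f (conj_exp D i j) (Suc k)"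
    proof (cases "j = Suc k")
      case True
      then show ?thesis
        using ik conj_E[OF xi] delta_map_gen[OF cons ik(1) k] unfolding eq by (simp add: f_def)
    next
      case False
      then have jk: "j \<in> {1..k}"
        using ij by auto
      have "\<iota> (inv\<^bsub>H k\<^esub> x k j \<otimes>\<^bsub>H k\<^esub> x k i \<otimes>\<^bsub>H k\<^esub> x k j) = \<iota> (descending_prod (H k) (x k) (conj_exp D i j) k)"
        using relation_conj[OF ik(1) jk ij(3)] k by simp
      then show ?thesis
        using xi x_closed[OF jk] ik False unfolding eq by (simp add: f_def)
    qed
  qed (use k in auto)
  \<comment> \<open>The image displays the top exponent and the part from \<open>H k\<close>
    separately, as \<open>unique_E\<close> requires.\<close>
  have \<psi>_prod: "\<psi> (descending_prod (H (Suc k)) (x (Suc k)) e (Suc k))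
      = \<zeta> [^]\<^bsub>E\<^esub> e (Suc k) \<otimes>\<^bsub>E\<^esub> \<iota> (descending_prod (H k) (x k) e k)" for e
  proof -
    have "\<psi> (descending_prod (H (Suc k)) (x (Suc k)) e (Suc k))
        = descending_prod E (\<lambda>i. \<psi> (x (Suc k) i)) e (Suc k)"
      by (rule G.descending_prod_hom[OF \<psi>(1) E(1) x_funcset])
    also have "\<dots> = descending_prod E f e (Suc k)"
      using \<psi>(2) by (intro descending_prod_cong) auto
    finally show ?thesis
      by (simp only: f_prod)
  qed
  have unique: "r = r'" if r: "is_normal_form D (Suc k) g r" "is_normal_form D (Suc k) g r'" for g r r'
  proof -
    have range: "\<And>i. i \<in> {1..Suc k} \<Longrightarrow> r i \<in> exp_range D i" "\<And>i. i \<in> {1..Suc k} \<Longrightarrow> r' i \<in> exp_range D i"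
      using r by (auto simp: is_normal_form_def)
    have "\<zeta> [^]\<^bsub>E\<^esub> r (Suc k) \<otimes>\<^bsub>E\<^esub> \<iota> (descending_prod (H k) (x k) r k)
        = \<zeta> [^]\<^bsub>E\<^esub> r' (Suc k) \<otimes>\<^bsub>E\<^esub> \<iota> (descending_prod (H k) (x k) r' k)"
      using r unfolding is_normal_form_def \<psi>_prod[symmetric] by simp
    \<comment> \<open>Admissible exponents lie in \<open>{0..<q}\<close> when n(z) is finite, so two
      of them differ by less than q.\<close>
    moreover have "q = 0 \<or> \<bar>r (Suc k) - r' (Suc k)\<bar> < int q"
      using range[of "Suc k"] by (cases "exponent D (Suc k)") (auto simp: exp_range_def q_def)
    ultimately have eq: "r (Suc k) = r' (Suc k)"
      "descending_prod (H k) (x k) r k = descending_prod (H k) (x k) r' k"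
      using unique_E K.descending_prod_closed[OF x_funcset] by blast+
    have "r i = r' i" if "i \<in> {1..k}" for i
      using range that by (intro normal_form_unique[OF cons _ _ eq(2) that]) auto
    then have "r i = r' i" if "i \<in> {1..Suc k}" for i
      using that eq(1) by (cases "i = Suc k") auto
    then show ?thesis
      using r unfolding is_normal_form_def by (intro PiE_ext[of r "{1..Suc k}" "exp_range D" r']) auto
  qed
  obtain \<kappa> where \<kappa>: "\<kappa> \<in> hom (H k) (H (Suc k))" "\<And>i. i \<in> {1..k} \<Longrightarrow> \<kappa> (x k i) = x (Suc k) i"
    using subpresentation_hom[of k "Suc k"] k by auto
  interpret \<kappa>: group_hom "H k" "H (Suc k)" \<kappa>
    using \<kappa>(1) by (simp add: group_hom_def group_hom_axioms_def group_H)
  have z: "?z \<in> carrier (H (Suc k))"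
    by (rule x_closed) simp
  have \<kappa>_prod: "\<kappa> (descending_prod (H k) (x k) e k) = descending_prod (H (Suc k)) (x (Suc k)) e k" for e
  proof -
    have "\<kappa> (descending_prod (H k) (x k) e k) = descending_prod (H (Suc k)) (\<lambda>i. \<kappa> (x k i)) e k"
      by (rule K.descending_prod_hom[OF \<kappa>(1) group_H x_funcset])
    also have "\<dots> = descending_prod (H (Suc k)) (x (Suc k)) e k"
      using \<kappa>(2) by (intro descending_prod_cong) auto
    finally show ?thesis .
  qed
  have \<kappa>_prod_Suc: "\<kappa> (descending_prod (H k) (x k) e k) = descending_prod (H (Suc k)) (x (Suc k)) e (Suc k)"
    if "e (Suc k) = 0" for e
    using that x_closed unfolding \<kappa>_prod by (intro G.descending_prod_extend[symmetric]) (auto simp: le_Suc_eq)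
  have \<kappa>_\<delta>: "\<kappa> (?\<delta> g) = inv\<^bsub>H (Suc k)\<^esub> ?z \<otimes>\<^bsub>H (Suc k)\<^esub> \<kappa> g \<otimes>\<^bsub>H (Suc k)\<^esub> ?z"
    if g: "g \<in> carrier (H k)" for g
  proof (rule hom_eqI[OF group_H _ _ _ g])
    show "(\<lambda>g. \<kappa> (?\<delta> g)) \<in> hom (H k) (H (Suc k))"
      by (auto intro!: homI)
    show "(\<lambda>g. inv\<^bsub>H (Suc k)\<^esub> ?z \<otimes>\<^bsub>H (Suc k)\<^esub> \<kappa> g \<otimes>\<^bsub>H (Suc k)\<^esub> ?z) \<in> hom (H k) (H (Suc k))"
      using z by (auto intro!: homI simp: G.conj_mult)
    fix i assume i: "i \<in> {1..k}"
    have "\<kappa> (?\<delta> (x k i)) = descending_prod (H (Suc k)) (x (Suc k)) (conj_exp D i (Suc k)) (Suc k)"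
      unfolding delta_map_gen[OF cons i k] using i k by (intro \<kappa>_prod_Suc conj_exp_zero) auto
    also have "\<dots> = inv\<^bsub>H (Suc k)\<^esub> ?z \<otimes>\<^bsub>H (Suc k)\<^esub> x (Suc k) i \<otimes>\<^bsub>H (Suc k)\<^esub> ?z"
      using i k by (intro relation_conj[symmetric]) auto
    finally show "\<kappa> (?\<delta> (x k i)) = inv\<^bsub>H (Suc k)\<^esub> ?z \<otimes>\<^bsub>H (Suc k)\<^esub> \<kappa> (x k i) \<otimes>\<^bsub>H (Suc k)\<^esub> ?z"
      using \<kappa>(2)[OF i] by simp
  qed
  define B where "B = \<kappa> ` carrier (H k)"
  have B: "subgroup B (H (Suc k))"
    unfolding B_def by (rule \<kappa>.img_is_subgroup)
  have zB: "?z \<in> normalizing (H (Suc k)) B"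
  proof -
    have "inv\<^bsub>H (Suc k)\<^esub> ?z \<otimes>\<^bsub>H (Suc k)\<^esub> b \<otimes>\<^bsub>H (Suc k)\<^esub> ?z \<in> B"
      "?z \<otimes>\<^bsub>H (Suc k)\<^esub> b \<otimes>\<^bsub>H (Suc k)\<^esub> inv\<^bsub>H (Suc k)\<^esub> ?z \<in> B" if b: "b \<in> B" for b
    proof -
      obtain g where g: "g \<in> carrier (H k)" "b = \<kappa> g"
        using b by (auto simp: B_def)
      show "inv\<^bsub>H (Suc k)\<^esub> ?z \<otimes>\<^bsub>H (Suc k)\<^esub> b \<otimes>\<^bsub>H (Suc k)\<^esub> ?z \<in> B"
        using g \<kappa>_\<delta>[OF g(1)] by (auto simp: B_def)
      \<comment> \<open>Here surjectivity of \<delta>(z) enters: the relations describe only z^(-1)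
        b z, and a preimage under \<delta>(z) is needed to express z b z^(-1).\<close>
      obtain h where h: "h \<in> carrier (H k)" "g = ?\<delta> h"
        using g(1) surj by (metis imageE)
      have "?z \<otimes>\<^bsub>H (Suc k)\<^esub> b \<otimes>\<^bsub>H (Suc k)\<^esub> inv\<^bsub>H (Suc k)\<^esub> ?z = \<kappa> h"
        using h(1) z unfolding g(2) h(2) \<kappa>_\<delta>[OF h(1)] by (simp add: G.m_assoc)
      then show "?z \<otimes>\<^bsub>H (Suc k)\<^esub> b \<otimes>\<^bsub>H (Suc k)\<^esub> inv\<^bsub>H (Suc k)\<^esub> ?z \<in> B"
        using h(1) by (auto simp: B_def)
    qed
    then show ?thesis
      using z by (simp add: normalizing_def)
  qed
  let ?U = "{?z [^]\<^bsub>H (Suc k)\<^esub> n \<otimes>\<^bsub>H (Suc k)\<^esub> b | (n::int) b. b \<in> B}"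
  have U: "?U = carrier (H (Suc k))"
  proof (rule subgroup_top)
    show "subgroup ?U (H (Suc k))"
      using B zB by (rule G.subgroup_cyclic_product)
    fix i assume i: "i \<in> {1..Suc k}"
    show "x (Suc k) i \<in> ?U"
    proof (cases "i = Suc k")
      case True
      then show ?thesis
        using z subgroup.one_closed[OF B]
        by (intro CollectI exI[of _ 1] exI[of _ "\<one>\<^bsub>H (Suc k)\<^esub>"]) (auto simp: G.int_pow_1)
    next
      case False
      then have ik: "i \<in> {1..k}"
        using i by auto
      then have "x (Suc k) i \<in> B"
        using \<kappa>(2)[OF ik] x_closed[OF ik] by (auto simp: B_def intro!: image_eqI[of _ _ "x k i"])
      then show ?thesis
        using x_closed[OF i] by (intro CollectI exI[of _ 0] exI[of _ "x (Suc k) i"]) auto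
    qed
  qed
  have "cyclic_extension (H (Suc k)) B (carrier (H (Suc k))) ?z"
    unfolding cyclic_extension_def
  proof (intro conjI ballI)
    fix g assume "g \<in> carrier (H (Suc k))"
    then have "g \<in> ?U"
      by (simp only: U)
    then obtain n :: int and b where g: "g = ?z [^]\<^bsub>H (Suc k)\<^esub> n \<otimes>\<^bsub>H (Suc k)\<^esub> b" "b \<in> B"
      by blast
    have "?z [^]\<^bsub>H (Suc k)\<^esub> n \<in> normalizing (H (Suc k)) B"
      using zB by (intro G.subgroup_int_pow_closed G.subgroup_normalizing subgroup.subset[OF B])
    then have "?z [^]\<^bsub>H (Suc k)\<^esub> n \<otimes>\<^bsub>H (Suc k)\<^esub> b \<otimes>\<^bsub>H (Suc k)\<^esub> inv\<^bsub>H (Suc k)\<^esub> (?z [^]\<^bsub>H (Suc k)\<^esub> n) \<in> B"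
      using g(2) by (simp add: normalizing_def)
    then show "\<exists>n::int. g \<otimes>\<^bsub>H (Suc k)\<^esub> ?z [^]\<^bsub>H (Suc k)\<^esub> n \<in> B"
      using g(1) z by (intro exI[of _ "- n"]) (simp add: G.int_pow_neg)
  qed (use B zB z G.subgroup_self subgroup.subset[OF B] in auto)
  then have polycyclic: "polycyclic (H (Suc k))"
    using cons unfolding B_def consistent_def by (intro \<kappa>.polycyclic_extension) auto
  have exists: "\<exists>r. is_normal_form D (Suc k) g r" if g: "g \<in> carrier (H (Suc k))" for g
  proof -
    have "g \<in> ?U"
      using g by (simp only: U)
    then obtain n :: int and h where h: "h \<in> carrier (H k)" "g = ?z [^]\<^bsub>H (Suc k)\<^esub> n \<otimes>\<^bsub>H (Suc k)\<^esub> \<kappa> h"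
      by (auto simp: B_def)
    have "\<exists>a h. a \<in> exp_range D (Suc k) \<and> h \<in> carrier (H k) \<and> g = ?z [^]\<^bsub>H (Suc k)\<^esub> a \<otimes>\<^bsub>H (Suc k)\<^esub> \<kappa> h"
    proof (cases "exponent D (Suc k)")
      case (enat q')
      have "?z [^]\<^bsub>H (Suc k)\<^esub> q' = descending_prod (H (Suc k)) (x (Suc k)) (power_exp D (Suc k)) (Suc k)"
        using enat k by (intro relation_power) auto
      also have "\<dots> = \<kappa> c"
        unfolding c_def using enat k by (simp add: \<kappa>_prod_Suc power_exp_zero del: descending_prod.simps)
      finally have zq: "?z [^]\<^bsub>H (Suc k)\<^esub> int q' = \<kappa> c"
        by (simp add: int_pow_int)
      \<comment> \<open>Division with remainder brings the exponent of z into range; the power of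
        z^q' = \<kappa>(c) that splits off is absorbed into the part from
        \<open>H k\<close>.\<close>
      have "?z [^]\<^bsub>H (Suc k)\<^esub> n = ?z [^]\<^bsub>H (Suc k)\<^esub> (n mod int q' + int q' * (n div int q'))"
        by simp
      also have "\<dots> = ?z [^]\<^bsub>H (Suc k)\<^esub> (n mod int q') \<otimes>\<^bsub>H (Suc k)\<^esub>
          ?z [^]\<^bsub>H (Suc k)\<^esub> (int q' * (n div int q'))"
        using z by (rule G.int_pow_mult)
      also have "?z [^]\<^bsub>H (Suc k)\<^esub> (int q' * (n div int q')) = \<kappa> (c [^]\<^bsub>H k\<^esub> (n div int q'))"
        using z c zq G.int_pow_pow[OF z, of "int q'" "n div int q'"] by (simp only: \<kappa>.hom_int_pow)
      finally have "g = ?z [^]\<^bsub>H (Suc k)\<^esub> (n mod int q') \<otimes>\<^bsub>H (Suc k)\<^esub>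
          \<kappa> (c [^]\<^bsub>H k\<^esub> (n div int q') \<otimes>\<^bsub>H k\<^esub> h)"
        using h c z by (simp add: G.m_assoc)
      moreover have "n mod int q' \<in> exp_range D (Suc k)"
        using q_pos[OF enat] enat by (simp add: exp_range_def)
      ultimately show ?thesis
        using h(1) c by blast
    next
      case infinity
      then show ?thesis
        using h by (intro exI[of _ n] exI[of _ h]) (simp add: exp_range_def)
    qed
    then obtain a h where ah: "a \<in> exp_range D (Suc k)" "h \<in> carrier (H k)"
      "g = ?z [^]\<^bsub>H (Suc k)\<^esub> a \<otimes>\<^bsub>H (Suc k)\<^esub> \<kappa> h"
      by blast
    obtain r where r: "r \<in> (\<Pi>\<^sub>E i\<in>{1..k}. exp_range D i)" "h = descending_prod (H k) (x k) r k"
      using cons ah(2) by (rule normal_form_exists)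
    have "is_normal_form D (Suc k) g (r(Suc k := a))"
      unfolding is_normal_form_def
    proof
      show "r(Suc k := a) \<in> (\<Pi>\<^sub>E i\<in>{1..Suc k}. exp_range D i)"
        using r(1) ah(1) by (auto simp: PiE_iff extensional_def le_Suc_eq)
      have "descending_prod (H (Suc k)) (x (Suc k)) (r(Suc k := a)) k = \<kappa> h"
        unfolding r(2) \<kappa>_prod by (intro descending_prod_cong) auto
      then show "g = descending_prod (H (Suc k)) (x (Suc k)) (r(Suc k := a)) (Suc k)"
        using ah(3) by simp
    qed
    then show ?thesis
      by blast
  qed
  show ?thesis
    unfolding consistent_def using polycyclic exists unique by blast
qed

section \<open>The first generator and the induction over the generators\<close>

lemma consistent_0: "consistent D 0"
proof -
  interpret group "H 0"
    by (rule group_H)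
  have "carrier (H 0) = {\<one>\<^bsub>H 0\<^esub>}"
    using subgroup_top[of "{\<one>\<^bsub>H 0\<^esub>}" 0] triv_subgroup by auto
  then have "polycyclic (H 0)"
    by (intro polycyclicI[of "\<lambda>_. {\<one>\<^bsub>H 0\<^esub>}" 0]) auto
  moreover have "\<exists>!r. is_normal_form D 0 g r" if "g \<in> carrier (H 0)" for g
    using that \<open>carrier (H 0) = _\<close> by (auto simp: is_normal_form_def)
  ultimately show ?thesis
    by (simp add: consistent_def)
qed

text \<open>The theorem begins with z = x_2, but the induction begins with the trivial group
  \<open>H 0\<close>. For z = x_1, (2)-(4) are vacuous or trivial, (1) compares trivial elements
  because \<pi>(x_1) is the empty word, and (5) is empty because x_1 lies in the first
  layer.\<close>

lemma criteria_0:
  assumes "0 < m"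
  shows "criterion1 D 0 \<and> criterion2 D 0 \<and> criterion3 D 0 \<and> criterion4 D 0 \<and> criterion5 D 0"
proof -
  obtain t where t: "t \<in> layers" "1 \<in> layer D t"
    using obtain_layer[of 1] assms by auto
  have "t = 1"
  proof (rule ccontr)
    assume "t \<noteq> 1"
    then have "1 \<in> layers" "1 < t"
      using t(1) by auto
    moreover obtain j where "j \<in> layer D 1"
      using layers_nonempty \<open>1 \<in> layers\<close> by blast
    ultimately have "j < 1" "j \<in> {1..m}"
      using layer_less[OF _ t(1) _ _ t(2)] layer_subset by blast+
    then show False
      by simp
  qed
  then have "criterion5 D 0"
    using layer_index_eq[OF t] by (simp add: criterion5_def)
  moreover have "criterion1 D 0"
  proof -
    have "sub_elem D 0 (power_word D 1) = \<one>\<^bsub>H 0\<^esub>" if "exponent D 1 < \<infinity>"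
      using power_word_eq[of 1 0] that assms sub_elem_normal_word[of 0] by simp
    then show ?thesis
      by (simp add: criterion1_def delta_map_def)
  qed
  ultimately show ?thesis
    by (simp add: criterion2_def criterion3_def criterion4_def)
qed

text \<open>Strong induction is needed: (5) for x_(j+1) draws on the groups at the last letters of
  all earlier layers, while (1)-(4) draw on H_j. The sufficiency step then yields H_(j+1).\<close>

lemma consistent_imp_subpresentations:
  assumes "consistent D m"
  shows "k \<le> m \<Longrightarrow> consistent D k"
proof (induction k rule: less_induct)
  case (less k)
  show ?case
  proof (cases k)
    case 0
    then show ?thesis
      by (simp add: consistent_0)
  next
    case (Suc j)
    then have cons: "consistent D i" if "i \<le> j" for i
      using that less by simp
    have "criterion5 D j"
      using less.prems Suc by (intro consistent_imp_criterion5[OF assms cons]) auto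
    then show ?thesis
      using consistent_imp_criteria_1_to_4[OF cons assms, of j] criteria_imp_consistent_Suc[OF cons, of j]
        Suc less.prems by simp
  qed
qed

end

theorem theorem2:
  fixes D :: presentation_data
  assumes "refined_solvable_presentation D"
  shows "consistent D (num_gens D) \<longleftrightarrow>
    (\<forall>k\<in>{1..<num_gens D}. consistent D k \<longrightarrow>
       criterion1 D k \<and> criterion2 D k \<and> criterion3 D k \<and> criterion4 D k \<and> criterion5 D k)"
proof
  interpret presentation D
    by standard (rule assms)
  {
    assume cons: "consistent D m"
    show "\<forall>k\<in>{1..<m}. consistent D k \<longrightarrow>
       criterion1 D k \<and> criterion2 D k \<and> criterion3 D k \<and> criterion4 D k \<and> criterion5 D k"
    proof (intro ballI impI)
      fix k assume k: "k \<in> {1..<m}" "consistent D k"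
      \<comment> \<open>(5) uses consistency of every H_j with j at most k, not just of H_k; it is
        inherited from \<open>G\<close>.\<close>
      have "criterion5 D k"
        using k by (intro consistent_imp_criterion5[OF cons consistent_imp_subpresentations[OF cons]]) auto
      then show "criterion1 D k \<and> criterion2 D k \<and> criterion3 D k \<and> criterion4 D k \<and> criterion5 D k"
        using consistent_imp_criteria_1_to_4[OF k(2) cons] k(1) by simp
    qed
  next
    assume crit: "\<forall>k\<in>{1..<m}. consistent D k \<longrightarrow>
       criterion1 D k \<and> criterion2 D k \<and> criterion3 D k \<and> criterion4 D k \<and> criterion5 D k"
    have "k \<le> m \<Longrightarrow> consistent D k" for k
    proof (induction k)
      case 0
      then show ?case
        by (simp add: consistent_0)
    next
      case (Suc k)
      \<comment> \<open>The case k = 0 is outside the range of the assumed criteria and comes from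
        \<open>criteria_0\<close>.\<close>
      have "criterion1 D k \<and> criterion2 D k \<and> criterion3 D k \<and> criterion4 D k \<and> criterion5 D k"
        using Suc crit criteria_0 by (cases "k = 0") auto
      then show ?case
        using criteria_imp_consistent_Suc[of k] Suc by simp
    qed
    then show "consistent D m"
      by simp
  }
qed

end
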